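(* The following $m$-equivalences between two-element sets of patterns hold (where a chain $P\sim Q\sim R$ means that all the sets listed are pairwise $m$-equivalent): (a) $\{122,1111\}\sim\{212,1111\}$; (b) $\{111,1223\}\sim\{111,1232\}\sim\{111,1322\}\sim\{111,2123\}\sim\{111,2132\}\sim\{111,2213\}$; (c) $\{111,1233\}\sim\{111,2133\}$; (d) $\{111,1234\}\sim\{111,1243\}\sim\{111,1432\}\sim\{111,2134\}\sim\{111,2143\}\sim\{111,3214\}$; (e) $\{123,1111\}\sim\{132,1111\}\sim\{213,1111\}$; (f) $\{123,1112\}\sim\{213,1112\}$; (g) $\{112,1234\}\sim\{112,2134\}\sim\{112,3214\}$; (h) $\{112,2314\}\sim\{112,3124\}$.
   Context: A (finite, reduced) multiset is $S=1^{a_1}2^{a_2}\cdots k^{a_k}$ with $k\ge 1$ and all $a_i\ge 1$, meaning that $i$ occurs with multiplicity $a_i$. A multipermutation of $S$ is a word having exactly $a_i$ occurrences of each letter $i\in[k]=\{1,\dots,k\}$ and no other letters. A word $\pi=\pi_1\cdots\pi_n$ contains a pattern (word) $\rho=\rho_1\cdots\rho_\ell$ if there are indices $i(1)<\cdots<i(\ell)$ such that for all $a,b\in[\ell]$: $\pi_{i(a)}<\pi_{i(b)}$ iff $\rho_a<\rho_b$, and $\pi_{i(a)}>\pi_{i(b)}$ iff $\rho_a>\rho_b$; otherwise $\pi$ avoids $\rho$. For a set $P$ of patterns, $\mathrm{av}(S;P)$ is the number of multipermutations of $S$ that avoid every pattern in $P$. Two sets of patterns $P,Q$ are $m$-equivalent,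 written here $P\sim Q$, if $\mathrm{av}(S;P)=\mathrm{av}(S;Q)$ for every multiset $S$. *)

theory Defs
  imports "HOL-Combinatorics.Multiset_Permutations"
begin

text \<open>
  The multisets \<open>1^{a_1} 2^{a_2} \<dots> k^{a_k}\<close> with \<open>k \<ge> 1\<close> and all \<open>a_i \<ge> 1\<close>: the support
  is exactly \<open>{1..k}\<close>, and the multiplicities \<open>a_i = count S i\<close> are otherwise arbitrary.
\<close>
definition reduced_mset :: "nat multiset \<Rightarrow> bool" where
  "reduced_mset S \<longleftrightarrow> (\<exists>k\<ge>1. set_mset S = {1..k})"

text \<open>Positions are 0-based, as usual for lists.\<close>
definition contains_pattern :: "nat list \<Rightarrow> nat list \<Rightarrow> bool" where
  "contains_pattern w r \<longleftrightarrow>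
     (\<exists>i :: nat \<Rightarrow> nat.
        strict_mono_on {..<length r} i \<and>
        (\<forall>a<length r. i a < length w) \<and>
        (\<forall>a<length r. \<forall>b<length r.
           (w ! i a < w ! i b \<longleftrightarrow> r ! a < r ! b) \<and>
           (w ! i a > w ! i b \<longleftrightarrow> r ! a > r ! b)))"

definition av :: "nat multiset \<Rightarrow> nat list set \<Rightarrow> nat" where
  "av S P = card {w \<in> permutations_of_multiset S. \<forall>r\<in>P. \<not> contains_pattern w r}"

definition m_equivalent :: "nat list set \<Rightarrow> nat list set \<Rightarrow> bool" where
  "m_equivalent P Q \<longleftrightarrow> (\<forall>S. reduced_mset S \<longrightarrow> av S P = av S Q)"

end

theory Submission
  imports Defs "HOL-Library.Sublist" "HOL-Computational_Algebra.Polynomial"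
begin

text \<open>
  Reversal of words preserves the numbers of avoiders, and so does the complement of letters when the
  multiset is complemented as well; reduced multisets are permuted by this.  The constant patterns 111
  and 1111 only bound the multiplicities.  So parts (a) to (e) are statements about single patterns on
  multisets with bounded multiplicities.

  For (a) and (b) the copies of the largest letter are inserted last.  With 122 as well as with 212, the
  number of possibilities is the number of gaps between the smaller letters.  For a pattern with one 1,
  one 3 and two letters 2, where 1 precedes 3, one keeps track of the number \<open>m\<close> of active gaps, into
  which a larger letter may be inserted.  One new letter yields \<open>m\<close> words with \<open>m + 1\<close> active gaps; two
  equal new letters yield, for each \<open>j < m\<close>, exactly \<open>j + 1\<close> words with \<open>j + 3\<close> active gaps.  This rule
  is proved for 2132, 2123, 1223 and 2213 (lemmas \<open>card_active_insert2\<close> and \<open>sum_child_label\<close>), and the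
  patterns 1232 and 1322 are reverse complements.

  All other pairs are of the form \<open>p @ X\<close> and \<open>q @ X\<close> with letters in \<open>X\<close> that exceed those of \<open>p\<close> and
  \<open>q\<close>, possibly after a reverse complement.  Words are read from the right, so \<open>X\<close> comes first.  The
  letters that lie below an occurrence of \<open>X\<close> already read are inner letters.  The other letters do not
  change when the inner ones are permuted, and they determine at every inner position a threshold below
  which its letter must lie.  The thresholds increase, so the inner letters form a filling of a Ferrers
  board with one entry in each column (\<open>card_scan_ok_eq\<close>), and \<open>p @ X\<close> is avoided exactly if the
  filling avoids \<open>rev p\<close>.  The patterns 112 and 1112 of parts (f) to (h) have this form, too: they bound the
  multiplicities of the inner letters, which are determined by the outer letters.
  It remains to compare fillings of a fixed board with fixed multiplicities of the rows.

  Avoiding 12 or 21 forces the entry of each column (\<open>card_fits_sorted_eq\<close>).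

  For 123, 321 and 312 the entries that are available at some column are divided into blocks. The
  entry that is used must be the first of some block, and then all blocks behind it are merged.
  The blocks are listed by increasing rows for 123 and by decreasing rows for 321 and 312. Yet the
  number of ways to continue depends only on the symmetric polynomial \<open>\<Prod>(1 + x +
  \<dots> + x\<^sup>b)\<close> over the block sizes \<open>b\<close>: it is a linear function of
  that polynomial, because the polynomials of the successors of a state add up to a linear image
  of the polynomial of that state (\<open>step_poly_eq\<close>, \<open>card_state_words\<close>).

  For 132 and 213 the rows are used once each.  Avoiding 132 is described by the entries that have to
  wait for the next lower one, avoiding 213 by the levels (cuts) above which everything is used before
  everything below.  Fillings with prescribed waiting entries correspond in number to fillings whose
  cuts dominate them (\<open>ascending_count_eq_sum_cut_count\<close>); the induction rests on the elementary
  identity \<open>card_dominates_eq\<close> between two sets of integers.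
\<close>

section \<open>Containment through subsequences, and the symmetries\<close>

text \<open>
  Agreement of all strict comparisons forces agreement of equalities, so this relates an occurrence,
  read off as a list, to its pattern.
\<close>
definition order_iso :: "nat list \<Rightarrow> nat list \<Rightarrow> bool" where
  "order_iso s r \<longleftrightarrow> length s = length r \<and>
     (\<forall>a<length r. \<forall>b<length r. s ! a < s ! b \<longleftrightarrow> r ! a < r ! b)"

lemma subseq_iff_embedding:
  "subseq s w \<longleftrightarrow>
     (\<exists>i. strict_mono_on {..<length s} i \<and> (\<forall>a<length s. i a < length w \<and> w ! i a = s ! a))"
  (is "_ \<longleftrightarrow> (\<exists>i. ?emb i s w)")
proof
  assume "subseq s w"
  thus "\<exists>i. ?emb i s w"
  proof (induction rule: list_emb.induct)
    case (list_emb_Nil ys)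
    show ?case by (simp add: strict_mono_on_def)
  next
    case (list_emb_Cons xs ys y)
    then obtain i where "?emb i xs ys" by blast
    hence "?emb (Suc \<circ> i) xs (y # ys)" by (auto simp: strict_mono_on_def)
    thus ?case by blast
  next
    case (list_emb_Cons2 x y xs ys)
    then obtain i where i: "?emb i xs ys" by blast
    define j where "j = (\<lambda>a. case a of 0 \<Rightarrow> 0 | Suc b \<Rightarrow> Suc (i b))"
    have "?emb j (x # xs) (y # ys)"
      using i list_emb_Cons2(1)
      by (auto simp: strict_mono_on_def j_def less_Suc_eq_0_disj nth_Cons' split: nat.splits)
    thus ?case by blast
  qed
next
  assume "\<exists>i. ?emb i s w"
  then obtain i where "?emb i s w" by blast
  thus "subseq s w"
  proof (induction w arbitrary: s i)
    case Nil
    thus ?case by (cases s) auto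
  next
    case (Cons y w)
    show ?case
    proof (cases s)
      case Nil
      thus ?thesis by simp
    next
      case s: (Cons x xs)
      have pos: "i (Suc a) > i a" if "Suc a < length s" for a
        using Cons.prems that by (auto simp: strict_mono_on_def)
      have pos': "i (Suc a) > i 0" if "Suc a < length s" for a
        using Cons.prems that by (intro strict_mono_onD[of "{..<length s}" i]) auto
      show ?thesis
      proof (cases "i 0 = 0")
        case True
        define j where "j = (\<lambda>a. i (Suc a) - 1)"
        have ij: "i (Suc a) = Suc (j a)" if "a < length xs" for a
          using pos'[of a] that s by (simp add: j_def)
        have "?emb j xs w"
        proof (intro conjI allI impI)
          show "strict_mono_on {..<length xs} j"
          proof (rule strict_mono_onI)
            fix a b assume "a \<in> {..<length xs}" "b \<in> {..<length xs}" "a < b"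
            moreover from this have "i (Suc a) < i (Suc b)"
              using Cons.prems s by (auto simp: strict_mono_on_def)
            ultimately show "j a < j b" using ij by auto
          qed
          fix a assume a: "a < length xs"
          have "i (Suc a) < length (y # w) \<and> (y # w) ! i (Suc a) = s ! Suc a"
            using Cons.prems s a by auto
          thus "j a < length w" "w ! j a = xs ! a" using ij[OF a] s by auto
        qed
        hence "subseq xs w" by (rule Cons.IH)
        moreover have "(y # w) ! i 0 = s ! 0" using Cons.prems s by auto
        hence "x = y" using s True by simp
        ultimately show ?thesis using s by simp
      next
        case False
        define j where "j = (\<lambda>a. i a - 1)"
        have ij: "i a = Suc (j a)" if "a < length s" for a
          using pos'[of "a - 1"] that s False by (cases a) (auto simp: j_def)
        have "?emb j s w"
        proof (intro conjI allI impI)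
          show "strict_mono_on {..<length s} j"
          proof (rule strict_mono_onI)
            fix a b assume "a \<in> {..<length s}" "b \<in> {..<length s}" "a < b"
            moreover from this have "i a < i b"
              using Cons.prems by (auto simp: strict_mono_on_def)
            ultimately show "j a < j b" using ij by auto
          qed
          fix a assume a: "a < length s"
          have "i a < length (y # w) \<and> (y # w) ! i a = s ! a"
            using Cons.prems a by auto
          thus "j a < length w" "w ! j a = s ! a" using ij[OF a] by auto
        qed
        hence "subseq s w" by (rule Cons.IH)
        thus ?thesis by (rule list_emb_Cons)
      qed
    qed
  qed
qed

lemma contains_pattern_iff:
  "contains_pattern w r \<longleftrightarrow> (\<exists>s. subseq s w \<and> order_iso s r)"
proof
  assume "contains_pattern w r"
  then obtain i where i: "strict_mono_on {..<length r} i" "\<forall>a<length r. i a < length w"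
     "\<forall>a<length r. \<forall>b<length r. (w ! i a < w ! i b \<longleftrightarrow> r ! a < r ! b)"
    unfolding contains_pattern_def by blast
  define s where "s = map (\<lambda>a. w ! i a) [0..<length r]"
  have "subseq s w" unfolding subseq_iff_embedding using i by (intro exI[of _ i]) (simp add: s_def)
  moreover have "order_iso s r" using i by (simp add: order_iso_def s_def)
  ultimately show "\<exists>s. subseq s w \<and> order_iso s r" by blast
next
  assume "\<exists>s. subseq s w \<and> order_iso s r"
  then obtain s where s: "subseq s w" "order_iso s r" by blast
  then obtain i where i: "strict_mono_on {..<length s} i"
     "\<forall>a<length s. i a < length w \<and> w ! i a = s ! a"
    unfolding subseq_iff_embedding by blast
  thus "contains_pattern w r" using s(2) unfolding contains_pattern_def order_iso_def
    by (intro exI[of _ i]) auto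
qed

lemma contains_pattern_subseq:
  "contains_pattern u r \<Longrightarrow> subseq u w \<Longrightarrow> contains_pattern w r"
  unfolding contains_pattern_iff using subseq_order.order_trans by blast

lemma contains_pattern_Nil [simp]: "contains_pattern [] r \<longleftrightarrow> r = []"
  unfolding contains_pattern_iff by (auto simp: order_iso_def dest: list_emb_length)

lemma subseq_rev_iff: "subseq (rev s) (rev w) \<longleftrightarrow> subseq s w"
proof -
  have "subseq (rev s) (rev w)" if "subseq s w" for s w :: "'a list"
    using that
  proof (induction rule: list_emb.induct)
    case (list_emb_Cons2 x y xs ys)
    thus ?case by (auto intro: list_emb_append_mono)
  qed (auto intro: subseq_rev_drop_many)
  from this[of s w] this[of "rev s" "rev w"] show ?thesis by auto
qed

lemma order_iso_rev: "order_iso s r \<Longrightarrow> order_iso (rev s) (rev r)"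
  unfolding order_iso_def
proof (intro conjI allI impI; elim conjE)
  fix a b assume "length s = length r"
    and "\<forall>a<length r. \<forall>b<length r. (s ! a < s ! b) = (r ! a < r ! b)"
    and "a < length (rev r)" "b < length (rev r)"
  thus "(rev s ! a < rev s ! b) = (rev r ! a < rev r ! b)"
    by (simp add: rev_nth)
qed simp

lemma contains_pattern_rev: "contains_pattern (rev w) (rev r) \<longleftrightarrow> contains_pattern w r"
proof -
  have "contains_pattern (rev w) (rev r)" if "contains_pattern w r" for w r :: "nat list"
  proof -
    obtain s where "subseq s w" "order_iso s r" using \<open>contains_pattern w r\<close> unfolding contains_pattern_iff by blast
    thus ?thesis unfolding contains_pattern_iff
      by (intro exI[of _ "rev s"]) (simp add: subseq_rev_iff order_iso_rev)
  qed
  from this[of w r] this[of "rev w" "rev r"] show ?thesis by auto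
qed

lemma av_rev: "av S (rev ` P) = av S P"
proof -
  let ?A = "{w \<in> permutations_of_multiset S. \<forall>r\<in>P. \<not> contains_pattern w r}"
  let ?B = "{w \<in> permutations_of_multiset S. \<forall>r\<in>rev ` P. \<not> contains_pattern w r}"
  have eq: "contains_pattern (rev w) r \<longleftrightarrow> contains_pattern w (rev r)" for w r
    using contains_pattern_rev[of "rev w" r] by simp
  have "w \<in> rev ` ?A \<longleftrightarrow> w \<in> ?B" for w
  proof -
    have "w \<in> rev ` ?A \<longleftrightarrow> rev w \<in> ?A" by (auto simp: image_iff intro: bexI[of _ "rev w"])
    also have "\<dots> \<longleftrightarrow> w \<in> ?B" by (simp add: permutations_of_multiset_def eq)
    finally show ?thesis .
  qed
  hence "rev ` ?A = ?B" by blast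
  moreover have "card (rev ` ?A) = card ?A" by (rule card_image) (simp add: inj_on_def)
  ultimately show ?thesis unfolding av_def by simp
qed

lemma m_equivalent_rev: "m_equivalent (rev ` P) (rev ` Q) \<longleftrightarrow> m_equivalent P Q"
  by (simp add: m_equivalent_def av_rev)

lemma contains_pattern_map_antimono:
  fixes f g :: "nat \<Rightarrow> nat"
  assumes f: "\<And>x y. x \<in> set w \<Longrightarrow> y \<in> set w \<Longrightarrow> f x < f y \<longleftrightarrow> y < x"
    and g: "\<And>x y. x \<in> set r \<Longrightarrow> y \<in> set r \<Longrightarrow> g x < g y \<longleftrightarrow> y < x"
  shows "contains_pattern (map f w) (map g r) \<longleftrightarrow> contains_pattern w r"
proof -
  have iso: "order_iso (map f s) (map g r) \<longleftrightarrow> order_iso s r" if "subseq s w" for s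
  proof (cases "length s = length r")
    case True
    have s: "set s \<subseteq> set w" using that by (auto simp: subseq_conv_nths dest: in_set_nthsD)
    have F: "map f s ! a < map f s ! b \<longleftrightarrow> s ! b < s ! a" if "a < length r" "b < length r" for a b
      using that True f[of "s ! a" "s ! b"] s by (simp add: subset_iff)
    have G: "map g r ! a < map g r ! b \<longleftrightarrow> r ! b < r ! a" if "a < length r" "b < length r" for a b
      using that g[of "r ! a" "r ! b"] by simp
    have "order_iso (map f s) (map g r) \<longleftrightarrow>
        (\<forall>a<length r. \<forall>b<length r. (s ! b < s ! a) = (r ! b < r ! a))"
      unfolding order_iso_def using True by (simp add: F G del: nth_map)
    also have "\<dots> \<longleftrightarrow> order_iso s r" unfolding order_iso_def using True by auto
    finally show ?thesis .
  qed (simp add: order_iso_def)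
  moreover have "subseq t (map f w) \<longleftrightarrow> (\<exists>s. t = map f s \<and> subseq s w)" for t
    unfolding subseq_conv_nths by (auto simp: nths_map)
  ultimately show ?thesis unfolding contains_pattern_iff by auto
qed

text \<open>
  Complementing the letters of words and of patterns reverses every comparison.  The bounds only
  keep the truncated subtractions injective.
\<close>
lemma av_complement:
  assumes S: "\<And>x. x \<in># S \<Longrightarrow> x \<le> k" and P: "\<And>r x. r \<in> P \<Longrightarrow> x \<in> set r \<Longrightarrow> x \<le> c"
  shows "av (image_mset (\<lambda>x. k - x) S) (map (\<lambda>x. c - x) ` P) = av S P"
proof -
  let ?f = "map (\<lambda>x. k - x)"
  let ?A = "{w \<in> permutations_of_multiset S. \<forall>r\<in>P. \<not> contains_pattern w r}"
  let ?B = "{w \<in> permutations_of_multiset (image_mset (\<lambda>x. k - x) S).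
               \<forall>r\<in>map (\<lambda>x. c - x) ` P. \<not> contains_pattern w r}"
  have inv: "?f (?f w) = w" if "\<And>x. x \<in> set w \<Longrightarrow> x \<le> k" for w
    using that by (induction w) auto
  have eq: "contains_pattern (?f w) (map (\<lambda>x. c - x) r) \<longleftrightarrow> contains_pattern w r"
    if "\<And>x. x \<in> set w \<Longrightarrow> x \<le> k" "r \<in> P" for w r
    by (rule contains_pattern_map_antimono) (use that P in \<open>fastforce+\<close>)
  have setw: "x \<le> k" if "mset w = S" "x \<in> set w" for w x
    using S that by (metis set_mset_mset)
  have "inj_on ?f ?A"
  proof (rule inj_onI)
    fix v w assume "v \<in> ?A" "w \<in> ?A" "?f v = ?f w"
    thus "v = w" using inv[of v] inv[of w] setw
      by (auto simp: permutations_of_multiset_def)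
  qed
  moreover have "?f ` ?A = ?B"
  proof (intro equalityI subsetI)
    fix w assume "w \<in> ?f ` ?A"
    then obtain v where v: "w = ?f v" "mset v = S" "\<forall>r\<in>P. \<not> contains_pattern v r"
      by (auto simp: permutations_of_multiset_def)
    thus "w \<in> ?B" using eq[of v] setw by (auto simp: permutations_of_multiset_def)
  next
    fix w assume w: "w \<in> ?B"
    have mw: "mset w = image_mset (\<lambda>x. k - x) S" using w by (simp add: permutations_of_multiset_def)
    hence wk: "x \<le> k" if "x \<in> set w" for x
      using that by (metis (no_types, lifting) diff_le_self imageE set_image_mset set_mset_mset)
    define v where "v = ?f w"
    have wv: "w = ?f v" using inv[OF wk] by (simp add: v_def)
    have "mset v = image_mset (\<lambda>x. k - (k - x)) S"
      by (simp add: v_def mw image_mset.compositionality o_def)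
    also have "\<dots> = image_mset (\<lambda>x. x) S" by (rule image_mset_cong) (use S in auto)
    finally have mv: "mset v = S" by simp
    have "\<not> contains_pattern v r" if "r \<in> P" for r
      using w that eq[of v r] setw[OF mv] wv by auto
    thus "w \<in> ?f ` ?A" using wv mv by (auto simp: permutations_of_multiset_def)
  qed
  ultimately show ?thesis unfolding av_def using card_image[of ?f ?A] by simp
qed

lemma contains_replicate_iff:
  "contains_pattern w (replicate j a) \<longleftrightarrow> j = 0 \<or> (\<exists>x. count (mset w) x \<ge> j)"
proof (cases "j = 0")
  case True
  thus ?thesis by (auto simp: contains_pattern_iff order_iso_def)
next
  case False
  have 1: "order_iso s (replicate j a) \<longleftrightarrow> (\<exists>x. s = replicate j x)" for s
  proof
    assume s: "order_iso s (replicate j a)"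
    have "s ! b = s ! 0" if "b < j" for b
    proof -
      have "(s ! b < s ! 0) = (replicate j a ! b < replicate j a ! 0)"
           "(s ! 0 < s ! b) = (replicate j a ! 0 < replicate j a ! b)"
        using s that False unfolding order_iso_def by fastforce+
      thus ?thesis using that False by simp
    qed
    moreover have "length s = j" using s by (simp add: order_iso_def)
    ultimately have "s = replicate j (s ! 0)" by (metis length_replicate nth_equalityI nth_replicate)
    thus "\<exists>x. s = replicate j x" by blast
  qed (auto simp: order_iso_def)
  have 2: "subseq (replicate j x) w \<longleftrightarrow> count (mset w) x \<ge> j" for x
  proof
    assume "subseq (replicate j x) w"
    hence "mset (replicate j x) \<subseteq># mset w"
      by (induction rule: list_emb.induct) (auto intro: subset_mset.order_trans)
    hence "count (mset (replicate j x)) x \<le> count (mset w) x" by (rule mset_subset_eq_count)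
    thus "count (mset w) x \<ge> j" by simp
  next
    assume "count (mset w) x \<ge> j"
    moreover have "filter (\<lambda>y. y = x) w = replicate (count (mset w) x) x"
      by (induction w) auto
    ultimately have "subseq (replicate j x) (filter (\<lambda>y. y = x) w)"
      by (metis le_add_diff_inverse replicate_add prefixI prefix_imp_subseq)
    thus "subseq (replicate j x) w" using subseq_filter_left subseq_order.order_trans by blast
  qed
  show ?thesis unfolding contains_pattern_iff 1 using 2 False by auto
qed

lemma av_with_constant:
  assumes "j > 0"
  shows "av S {replicate j a, r} = (if \<exists>x. count S x \<ge> j then 0 else av S {r})"
proof -
  have "{w \<in> permutations_of_multiset S. \<forall>q\<in>{replicate j a, r}. \<not> contains_pattern w q} =
     (if \<exists>x. count S x \<ge> j then {} else {w \<in> permutations_of_multiset S. \<forall>q\<in>{r}. \<not> contains_pattern w q})"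
    using assms by (auto simp: permutations_of_multiset_def contains_replicate_iff)
  thus ?thesis by (simp add: av_def)
qed

text \<open>
  A constant pattern of length \<open>j\<close> occurs in every arrangement of a multiset in which some
  multiplicity is at least \<open>j\<close>, and in no arrangement of any other multiset.  Between two sets that
  share such a pattern, only multisets with multiplicities below \<open>j\<close> can make a difference.
\<close>
definition equiv_below :: "nat \<Rightarrow> nat list \<Rightarrow> nat list \<Rightarrow> bool" where
  "equiv_below j p q \<longleftrightarrow> (\<forall>S. reduced_mset S \<longrightarrow> (\<forall>x. count S x < j) \<longrightarrow> av S {p} = av S {q})"

lemma equiv_below_sym: "equiv_below j p q \<Longrightarrow> equiv_below j q p"
  and equiv_below_trans: "equiv_below j p q \<Longrightarrow> equiv_below j q r \<Longrightarrow> equiv_below j p r"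
  unfolding equiv_below_def by auto

lemma equiv_belowI:
  assumes "\<And>S. \<forall>x. count S x < j \<Longrightarrow> av S {p} = av S {q}"
  shows "equiv_below j p q"
  using assms unfolding equiv_below_def by blast

lemma m_equivalent_constant_iff:
  assumes "j > 0"
  shows "m_equivalent {replicate j a, p} {replicate j a, q} \<longleftrightarrow> equiv_below j p q"
  unfolding m_equivalent_def equiv_below_def
  by (simp add: av_with_constant[OF assms]) (use linorder_not_le in blast)

lemma equiv_below_rev: "equiv_below j (rev p) (rev q) \<longleftrightarrow> equiv_below j p q"
  using av_rev[of _ "{p}"] av_rev[of _ "{q}"] by (simp add: equiv_below_def)

text \<open>
  On the support \<open>{1..k}\<close> of a reduced multiset the complement is \<open>x \<mapsto> k + 1 - x\<close>, which permutes
  the support; so the complemented multiset is again reduced and has the same multiplicities.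
\<close>
lemma equiv_below_complement:
  assumes "equiv_below j p q" "\<forall>x\<in>set p. x \<le> c" "\<forall>x\<in>set q. x \<le> c"
  shows "equiv_below j (map (\<lambda>x. c - x) p) (map (\<lambda>x. c - x) q)"
  unfolding equiv_below_def
proof (intro allI impI)
  fix S assume S: "reduced_mset S" "\<forall>x. count S x < j"
  then obtain k where k: "k \<ge> 1" "set_mset S = {1..k}" by (auto simp: reduced_mset_def)
  define T where "T = image_mset (\<lambda>x. Suc k - x) S"
  have ST: "S = image_mset (\<lambda>x. Suc k - x) T"
  proof -
    have "image_mset (\<lambda>x. Suc k - x) T = image_mset (\<lambda>x. x) S"
      unfolding T_def image_mset.compositionality o_def
      by (rule image_mset_cong) (use k in auto)
    thus ?thesis by simp
  qed
  have "set_mset T = {1..k}"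
  proof -
    have "(\<lambda>x. Suc k - x) ` {1..k} = {1..k}"
    proof (intro equalityI subsetI)
      fix x assume "x \<in> {1..k}"
      hence "x = Suc k - (Suc k - x)" "Suc k - x \<in> {1..k}" by auto
      thus "x \<in> (\<lambda>x. Suc k - x) ` {1..k}" by (rule image_eqI)
    qed auto
    thus ?thesis by (simp add: T_def k)
  qed
  hence T: "reduced_mset T" "\<And>x. x \<in># T \<Longrightarrow> x \<le> Suc k" using k by (auto simp: reduced_mset_def)
  have "count T x < j" for x
  proof (cases "x \<in># T")
    case True
    hence x: "x \<le> k" "x \<ge> 1" using \<open>set_mset T = {1..k}\<close> by auto
    have "{y. y \<in># S \<and> x = Suc k - y} = {Suc k - x}"
      using k x by auto
    hence "count T x = count S (Suc k - x)"
      by (simp add: T_def count_image_mset')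
    thus ?thesis using S(2) by simp
  next
    case False
    hence "count T x = 0" by (simp add: not_in_iff)
    thus ?thesis using S(2) by (metis gr_zeroI not_less0)
  qed
  hence "av T {p} = av T {q}" using assms(1) T(1) by (simp add: equiv_below_def)
  moreover have "av S {map (\<lambda>x. c - x) r} = av T {r}" if "\<forall>x\<in>set r. x \<le> c" for r
    using av_complement[of T "Suc k" "{r}" c] T(2) that ST[symmetric] by simp
  ultimately show "av S {map (\<lambda>x. c - x) p} = av S {map (\<lambda>x. c - x) q}"
    using assms by simp
qed

lemma pairwise_of_basepoint:
  assumes "\<And>B. B \<in> T \<Longrightarrow> m_equivalent A B"
  shows "pairwise m_equivalent T"
proof (rule pairwiseI)
  fix B C assume "B \<in> T" "C \<in> T"
  with assms[of B] assms[of C] show "m_equivalent B C" by (simp add: m_equivalent_def)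
qed

section \<open>The patterns 122 and 212\<close>

text \<open>
  Arrangements are built by inserting all copies of the largest letter last.
\<close>
lemma multiset_top_letter_induct [case_names empty top]:
  fixes S :: "nat multiset"
  assumes "P {#}" and "\<And>S k a. a > 0 \<Longrightarrow> \<forall>x\<in>#S. x < k \<Longrightarrow> P S \<Longrightarrow> P (S + replicate_mset a k)"
  shows "P S"
proof (induction "size S" arbitrary: S rule: less_induct)
  case less
  show ?case
  proof (cases "S = {#}")
    case False
    define k where "k = Max_mset S"
    define T where "T = filter_mset (\<lambda>x. x \<noteq> k) S"
    have k: "k \<in># S" using False by (simp add: k_def)
    have S: "S = T + replicate_mset (count S k) k"
      by (rule multiset_eqI) (simp add: T_def)
    have "x < k" if "x \<in># T" for x
      using that Max_ge[of "set_mset S" x] by (auto simp: T_def k_def order_le_less)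
    moreover have "size T < size S"
    proof -
      have "size S = size T + count S k" using arg_cong[OF S, of size] by simp
      thus ?thesis using k by simp
    qed
    ultimately show ?thesis using assms(2)[of "count S k" T k] less k S by auto
  qed (use assms(1) in simp)
qed

lemma length_3_iff: "length s = Suc (Suc (Suc 0)) \<longleftrightarrow> (\<exists>a b c. s = [a, b, c])"
  by (auto simp: length_Suc_conv)

lemma contains_122_iff: "contains_pattern w [1, 2, 2] \<longleftrightarrow> (\<exists>x y. y < x \<and> subseq [y, x, x] w)"
proof -
  have "order_iso s [1, 2, 2] \<longleftrightarrow> (\<exists>x y. y < x \<and> s = [y, x, x])" for s
    by (cases "\<exists>a b c. s = [a, b, c]")
       (auto simp: order_iso_def All_less_Suc length_3_iff)
  thus ?thesis unfolding contains_pattern_iff by auto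
qed

lemma contains_212_iff: "contains_pattern w [2, 1, 2] \<longleftrightarrow> (\<exists>x y. y < x \<and> subseq [x, y, x] w)"
proof -
  have "order_iso s [2, 1, 2] \<longleftrightarrow> (\<exists>x y. y < x \<and> s = [x, y, x])" for s
    by (cases "\<exists>a b c. s = [a, b, c]")
       (auto simp: order_iso_def All_less_Suc length_3_iff)
  thus ?thesis unfolding contains_pattern_iff by auto
qed

lemma subseq_Cons_append_notin: "x \<notin> set u \<Longrightarrow> subseq (x # s) (u @ v) \<longleftrightarrow> subseq (x # s) v"
  by (induction u) auto

lemma subseq_filter_iff: "subseq s (filter Q v) \<longleftrightarrow> subseq s v \<and> (\<forall>x\<in>set s. Q x)"
proof
  assume s: "subseq s (filter Q v)"
  hence "set s \<subseteq> set (filter Q v)" by (auto simp: subseq_conv_nths dest: in_set_nthsD)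
  moreover have "subseq s v" using s subseq_filter_left subseq_order.order_trans by blast
  ultimately show "subseq s v \<and> (\<forall>x\<in>set s. Q x)" by auto
next
  assume "subseq s v \<and> (\<forall>x\<in>set s. Q x)"
  thus "subseq s (filter Q v)" using subseq_filter[of s v Q] by (simp add: filter_id_conv[THEN iffD2])
qed

lemma subseq_count_le: "subseq s w \<Longrightarrow> count (mset s) x \<le> count (mset w) x"
proof -
  assume "subseq s w"
  hence "mset s \<subseteq># mset w"
    by (induction rule: list_emb.induct) (auto intro: subset_mset.order_trans)
  thus ?thesis by (rule mset_subset_eq_count)
qed

text \<open>
  If the avoiding arrangements of the enlarged multiset are parametrised by an avoiding arrangement
  \<open>w\<close> of the smaller letters and one of the \<open>size S + 1\<close> gaps of \<open>w\<close>, their numbers differ by the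
  factor \<open>size S + 1\<close>, whatever the multiplicity of the new letter.
\<close>
lemma card_insert_top:
  fixes k :: nat
  assumes k: "\<forall>x\<in>#S. x < k" and a: "a > 0"
    and J: "\<And>w i. mset w = S \<Longrightarrow> i \<le> size S \<Longrightarrow> filter (\<lambda>x. x \<noteq> k) (J w i) = w"
    and inj: "\<And>w i i'. mset w = S \<Longrightarrow> i \<le> size S \<Longrightarrow> i' \<le> size S \<Longrightarrow> J w i = J w i' \<Longrightarrow> i = i'"
    and sub: "\<And>w i. mset w = S \<Longrightarrow> ok w \<Longrightarrow> i \<le> size S \<Longrightarrow>
          mset (J w i) = S + replicate_mset a k \<and> ok (J w i)"
    and sup: "\<And>W. mset W = S + replicate_mset a k \<Longrightarrow> ok W \<Longrightarrow>
          \<exists>i\<le>size S. W = J (filter (\<lambda>x. x \<noteq> k) W) i"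
    and her: "\<And>W. ok W \<Longrightarrow> ok (filter (\<lambda>x. x \<noteq> k) W)"
  shows "card {W. mset W = S + replicate_mset a k \<and> ok W} = card {w. mset w = S \<and> ok w} * Suc (size S)"
proof -
  let ?A = "{w. mset w = S \<and> ok w} \<times> {..size S}"
  have "bij_betw (\<lambda>(w, i). J w i) ?A {W. mset W = S + replicate_mset a k \<and> ok W}"
  proof (rule bij_betw_imageI)
    show "inj_on (\<lambda>(w, i). J w i) ?A"
    proof (rule inj_onI)
      fix p q assume "p \<in> ?A" "q \<in> ?A" and eq: "(\<lambda>(w, i). J w i) p = (\<lambda>(w, i). J w i) q"
      then obtain w i w' i' where p: "p = (w, i)" "mset w = S" "i \<le> size S"
        and q: "q = (w', i')" "mset w' = S" "i' \<le> size S" by auto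
      have "w = w'" using J[OF p(2,3)] J[OF q(2,3)] eq p(1) q(1) by auto
      moreover have "i = i'" using inj[OF p(2,3) q(3)] eq p(1) q(1) calculation by auto
      ultimately show "p = q" using p q by simp
    qed
    show "(\<lambda>(w, i). J w i) ` ?A = {W. mset W = S + replicate_mset a k \<and> ok W}"
    proof (intro equalityI subsetI)
      fix W assume W: "W \<in> {W. mset W = S + replicate_mset a k \<and> ok W}"
      then obtain i where i: "i \<le> size S" "W = J (filter (\<lambda>x. x \<noteq> k) W) i" using sup by blast
      have "filter_mset (\<lambda>x. x \<noteq> k) (S + replicate_mset a k) = S"
      proof -
        have "filter_mset (\<lambda>x. x \<noteq> k) S = S" "filter_mset (\<lambda>x. x \<noteq> k) (replicate_mset a k) = {#}"
          using k by (auto simp: filter_mset_eq_conv)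
        thus ?thesis by simp
      qed
      hence "mset (filter (\<lambda>x. x \<noteq> k) W) = S" using W by simp
      thus "W \<in> (\<lambda>(w, i). J w i) ` ?A" using i her[of W] W by (intro image_eqI[of _ _ "(filter (\<lambda>x. x \<noteq> k) W, i)"]) auto
    qed (use sub in auto)
  qed
  from bij_betw_same_card[OF this] show ?thesis by (simp add: card_cartesian_product)
qed

text \<open>
  To avoid 212, the copies of the largest letter must not enclose a smaller letter: they form one
  block.
\<close>
definition insert_run :: "nat \<Rightarrow> nat \<Rightarrow> nat list \<Rightarrow> nat \<Rightarrow> nat list" where
  "insert_run k a w i = take i w @ replicate a k @ drop i w"

text \<open>
  To avoid 122, at most one copy of the largest letter may follow a smaller letter: the other copies
  form the beginning of the word.
\<close>
definition insert_last :: "nat \<Rightarrow> nat \<Rightarrow> nat list \<Rightarrow> nat \<Rightarrow> nat list" where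
  "insert_last k a w i = replicate (a - 1) k @ take i w @ k # drop i w"

lemma filter_take_drop: "\<forall>x\<in>set w. Q x \<Longrightarrow> filter Q (take i w) = take i w \<and> filter Q (drop i w) = drop i w"
  by (auto simp: filter_id_conv dest: in_set_takeD in_set_dropD)

definition no_122 :: "nat list \<Rightarrow> bool" where
  "no_122 w \<longleftrightarrow> \<not> (\<exists>x y. y < x \<and> subseq [y, x, x] w)"

definition no_212 :: "nat list \<Rightarrow> bool" where
  "no_212 w \<longleftrightarrow> \<not> (\<exists>x y. y < x \<and> subseq [x, y, x] w)"

lemma subseq_set: "subseq s w \<Longrightarrow> set s \<subseteq> set w"
  by (auto simp: subseq_conv_nths dest: in_set_nthsD)

lemma takeWhile_eq_replicate: "takeWhile (\<lambda>x. x = k) r = replicate (length (takeWhile (\<lambda>x. x = k) r)) k"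
  by (induction r) auto

lemma card_avoiding_212_step:
  assumes k: "\<forall>x\<in>#S. x < k" and a: "a > 0"
  shows "card {W. mset W = S + replicate_mset a k \<and> no_212 W}
       = card {w. mset w = S \<and> no_212 w} * Suc (size S)"
proof (rule card_insert_top[OF k a, of "insert_run k a"])
  fix w i assume w: "mset w = S" "i \<le> size S"
  have wk: "\<forall>x\<in>set w. x \<noteq> k" using w k by auto
  show "filter (\<lambda>x. x \<noteq> k) (insert_run k a w i) = w"
    using filter_take_drop[OF wk, of i] by (simp add: insert_run_def)
next
  fix w i i' assume w: "mset w = S" "i \<le> size S" "i' \<le> size S" "insert_run k a w i = insert_run k a w i'"
  have wk: "\<forall>x\<in>set w. x \<noteq> k" using w k by auto
  have "length (takeWhile (\<lambda>x. x \<noteq> k) (insert_run k a w i)) = i" if "i \<le> size S" for i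
  proof -
    have "\<forall>x\<in>set (take i w). x \<noteq> k" using wk by (auto dest: in_set_takeD)
    hence "takeWhile (\<lambda>x. x \<noteq> k) (insert_run k a w i) = take i w"
      using a by (cases a) (auto simp: insert_run_def takeWhile_append2)
    thus ?thesis using that w(1) by auto
  qed
  thus "i = i'" using w by metis
next
  fix w i assume w: "mset w = S" "no_212 w" "i \<le> size S"
  have wk: "x < k" if "x \<in> set w" for x using w k that by auto
  hence wk': "\<forall>x\<in>set w. x \<noteq> k" by auto
  have "mset (take i w) + mset (drop i w) = S" using w(1) by (metis append_take_drop_id mset_append)
  hence "mset (insert_run k a w i) = S + replicate_mset a k" by (simp add: insert_run_def ac_simps)
  moreover have "\<not> subseq [x, y, x] (insert_run k a w i)" if "y < x" for x y
  proof
    assume s: "subseq [x, y, x] (insert_run k a w i)"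
    show False
    proof (cases "x = k")
      case True
      have "k \<notin> set (take i w)" "k \<notin> set (drop i w)" using wk by (auto dest!: in_set_takeD in_set_dropD)
      have "\<not> subseq [y, k] (replicate n k @ drop i w)" for n
      proof -
        have "y \<notin> set (replicate n k)" using that True by auto
        thus ?thesis using \<open>k \<notin> set (drop i w)\<close> subseq_set[of "[y, k]" "drop i w"]
          by (auto simp: subseq_Cons_append_notin simp del: set_replicate)
      qed
      hence "\<not> subseq [k, y, k] (replicate n k @ drop i w)" for n
        by (metis subseq_Cons')
      thus False using s True \<open>k \<notin> set (take i w)\<close> by (simp add: insert_run_def subseq_Cons_append_notin)
    next
      case False
      have "x \<in> set (insert_run k a w i)" using subseq_set[OF s] by simp
      hence "x < k" using wk False by (auto simp: insert_run_def dest: in_set_takeD in_set_dropD)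
      hence "subseq [x, y, x] (filter (\<lambda>x. x \<noteq> k) (insert_run k a w i))"
        using s that by (simp add: subseq_filter_iff)
      moreover have "filter (\<lambda>x. x \<noteq> k) (insert_run k a w i) = w"
        using filter_take_drop[OF wk', of i] by (simp add: insert_run_def)
      ultimately show False using w(2) that by (auto simp: no_212_def)
    qed
  qed
  ultimately show "mset (insert_run k a w i) = S + replicate_mset a k \<and> no_212 (insert_run k a w i)"
    by (auto simp: no_212_def)
next
  fix W assume W: "mset W = S + replicate_mset a k" "no_212 W"
  have Wk: "x \<le> k" if "x \<in> set W" for x
  proof -
    have "x \<in># S + replicate_mset a k" using that W(1) by (metis set_mset_mset)
    thus ?thesis using k by (auto split: if_splits)
  qed
  have cnt: "count (mset W) k = a" using W(1) k by (auto simp: not_in_iff)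
  hence "k \<in> set W" using a by (metis count_eq_zero_iff less_irrefl set_mset_mset)
  then obtain u r where u: "W = u @ k # r" "k \<notin> set u" by (metis split_list_first)
  define v where "v = dropWhile (\<lambda>x. x = k) r"
  define b where "b = length (takeWhile (\<lambda>x. x = k) r)"
  have r: "r = replicate b k @ v"
    unfolding v_def b_def by (metis takeWhile_eq_replicate takeWhile_dropWhile_id)
  have "k \<notin> set v"
  proof
    assume kv: "k \<in> set v"
    then obtain y v' where v: "v = y # v'" by (cases v) auto
    have "y \<noteq> k" using v unfolding v_def by (simp add: dropWhile_eq_Cons_conv)
    hence "y < k" using Wk[of y] u r v by auto
    moreover have "subseq [k, y, k] W"
      using kv v \<open>y \<noteq> k\<close> unfolding u(1) r
      by (intro subseq_drop_many) (simp add: subseq_singleton_left subseq_drop_many)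
    ultimately show False using W(2) by (auto simp: no_212_def)
  qed
  have "count (mset W) k = Suc b" using u r \<open>k \<notin> set v\<close> by (simp add: count_eq_zero_iff[THEN iffD2])
  hence b: "a = Suc b" using cnt by simp
  have f: "filter (\<lambda>x. x \<noteq> k) W = u @ v"
  proof -
    have "filter (\<lambda>x. x \<noteq> k) u = u" "filter (\<lambda>x. x \<noteq> k) v = v"
      using u \<open>k \<notin> set v\<close> by (auto simp: filter_id_conv)
    thus ?thesis unfolding u(1) r by simp
  qed
  have "length u \<le> size S"
    using arg_cong[OF W(1), of size] u r b by simp
  moreover have "W = insert_run k a (filter (\<lambda>x. x \<noteq> k) W) (length u)"
    unfolding f insert_run_def b using u(1) r by simp
  ultimately show "\<exists>i\<le>size S. W = insert_run k a (filter (\<lambda>x. x \<noteq> k) W) i" by blast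
next
  fix W :: "nat list" assume "no_212 W"
  thus "no_212 (filter (\<lambda>x. x \<noteq> k) W)"
    by (auto simp: no_212_def subseq_filter_iff)
qed

lemma card_avoiding_122_step:
  assumes k: "\<forall>x\<in>#S. x < k" and a: "a > 0"
  shows "card {W. mset W = S + replicate_mset a k \<and> no_122 W}
       = card {w. mset w = S \<and> no_122 w} * Suc (size S)"
proof (rule card_insert_top[OF k a, of "insert_last k a"])
  fix w i assume w: "mset w = S" "i \<le> size S"
  have wk: "\<forall>x\<in>set w. x \<noteq> k" using w k by auto
  show "filter (\<lambda>x. x \<noteq> k) (insert_last k a w i) = w"
    using filter_take_drop[OF wk, of i] by (simp add: insert_last_def)
next
  fix w i i' assume w: "mset w = S" "i \<le> size S" "i' \<le> size S" "insert_last k a w i = insert_last k a w i'"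
  have wk: "\<forall>x\<in>set w. x \<noteq> k" using w k by auto
  have "take i w @ k # drop i w = take i' w @ k # drop i' w" using w(4) by (simp add: insert_last_def)
  moreover have "length (takeWhile (\<lambda>x. x \<noteq> k) (take i w @ k # drop i w)) = i" if "i \<le> size S" for i
  proof -
    have "\<forall>x\<in>set (take i w). x \<noteq> k" using wk by (auto dest: in_set_takeD)
    hence "takeWhile (\<lambda>x. x \<noteq> k) (take i w @ k # drop i w) = take i w"
      by (simp add: takeWhile_append2)
    thus ?thesis using that w(1) by auto
  qed
  ultimately show "i = i'" using w(2,3) by metis
next
  fix w i assume w: "mset w = S" "no_122 w" "i \<le> size S"
  have wk: "x < k" if "x \<in> set w" for x using w k that by auto
  hence wk': "\<forall>x\<in>set w. x \<noteq> k" by auto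
  have "mset (take i w) + mset (drop i w) = S" using w(1) by (metis append_take_drop_id mset_append)
  moreover have "replicate_mset a k = add_mset k (replicate_mset (a - 1) k)" using a by (cases a) auto
  ultimately have "mset (insert_last k a w i) = S + replicate_mset a k"
    by (simp add: insert_last_def ac_simps)
  moreover have "\<not> subseq [y, x, x] (insert_last k a w i)" if "y < x" for x y
  proof
    assume s: "subseq [y, x, x] (insert_last k a w i)"
    show False
    proof (cases "x = k")
      case True
      have "y \<notin> set (replicate (a - 1) k)" using that True by auto
      hence "subseq [y, k, k] (take i w @ k # drop i w)"
        using s True by (simp add: insert_last_def subseq_Cons_append_notin del: set_replicate)
      hence "count (mset [y, k, k]) k \<le> count (mset (take i w @ k # drop i w)) k" by (rule subseq_count_le)
      moreover have "count (mset (take i w)) k = 0" "count (mset (drop i w)) k = 0"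
        unfolding count_eq_zero_iff using wk by (auto dest!: in_set_takeD in_set_dropD)
      ultimately show False using that True by simp
    next
      case False
      have "x \<in> set (insert_last k a w i)" using subseq_set[OF s] by simp
      hence "x < k" using wk False by (auto simp: insert_last_def dest: in_set_takeD in_set_dropD)
      hence "subseq [y, x, x] (filter (\<lambda>x. x \<noteq> k) (insert_last k a w i))"
        using s that by (simp add: subseq_filter_iff)
      moreover have "filter (\<lambda>x. x \<noteq> k) (insert_last k a w i) = w"
        using filter_take_drop[OF wk', of i] by (simp add: insert_last_def)
      ultimately show False using w(2) that by (auto simp: no_122_def)
    qed
  qed
  ultimately show "mset (insert_last k a w i) = S + replicate_mset a k \<and> no_122 (insert_last k a w i)"
    by (auto simp: no_122_def)
next
  fix W assume W: "mset W = S + replicate_mset a k" "no_122 W"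
  have Wk: "x \<le> k" if "x \<in> set W" for x
  proof -
    have "x \<in># S + replicate_mset a k" using that W(1) by (metis set_mset_mset)
    thus ?thesis using k by (auto split: if_splits)
  qed
  have cnt: "count (mset W) k = a" using W(1) k by (auto simp: not_in_iff)
  define r where "r = dropWhile (\<lambda>x. x = k) W"
  define b where "b = length (takeWhile (\<lambda>x. x = k) W)"
  have Wr: "W = replicate b k @ r"
    unfolding r_def b_def by (metis takeWhile_eq_replicate takeWhile_dropWhile_id)
  show "\<exists>i\<le>size S. W = insert_last k a (filter (\<lambda>x. x \<noteq> k) W) i"
  proof (cases "k \<in> set r")
    case False
    have "a = b" using cnt Wr False by (simp add: count_eq_zero_iff[THEN iffD2])
    moreover have "filter (\<lambda>x. x \<noteq> k) r = r" using False by (auto simp: filter_id_conv)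
    hence "filter (\<lambda>x. x \<noteq> k) W = r" unfolding Wr by simp
    moreover have "replicate b k = replicate (a - 1) k @ [k]"
      using a \<open>a = b\<close> by (cases b) (auto simp: replicate_append_same)
    ultimately have "W = insert_last k a (filter (\<lambda>x. x \<noteq> k) W) 0"
      using Wr by (simp add: insert_last_def)
    thus ?thesis by blast
  next
    case True
    then obtain y r' where y: "r = y # r'" by (cases r) auto
    have yk: "y \<noteq> k" using y unfolding r_def by (simp add: dropWhile_eq_Cons_conv)
    hence "y < k" using Wk[of y] Wr y by auto
    obtain u v where uv: "r = u @ k # v" "k \<notin> set u" using True by (metis split_list_first)
    then obtain u' where u': "u = y # u'" using y yk by (cases u) auto
    have "k \<notin> set v"
    proof
      assume kv: "k \<in> set v"
      have "subseq [y, k, k] r" unfolding uv(1) u'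
        using kv by (simp add: subseq_singleton_left subseq_drop_many)
      hence "subseq [y, k, k] W" unfolding Wr by (rule subseq_drop_many)
      thus False using W(2) \<open>y < k\<close> by (auto simp: no_122_def)
    qed
    have "a = Suc b" using cnt Wr uv \<open>k \<notin> set v\<close> by (simp add: count_eq_zero_iff[THEN iffD2])
    moreover have "filter (\<lambda>x. x \<noteq> k) W = u @ v"
    proof -
      have "filter (\<lambda>x. x \<noteq> k) u = u" "filter (\<lambda>x. x \<noteq> k) v = v"
        using uv(2) \<open>k \<notin> set v\<close> by (auto simp: filter_id_conv)
      thus ?thesis unfolding Wr uv(1) by simp
    qed
    ultimately have "W = insert_last k a (filter (\<lambda>x. x \<noteq> k) W) (length u)"
      using Wr uv(1) by (simp add: insert_last_def)
    moreover have "length u \<le> size S"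
      using arg_cong[OF W(1), of size] Wr uv \<open>a = Suc b\<close> by simp
    ultimately show ?thesis by blast
  qed
next
  fix W :: "nat list" assume "no_122 W"
  thus "no_122 (filter (\<lambda>x. x \<noteq> k) W)"
    by (auto simp: no_122_def subseq_filter_iff)
qed

lemma av_alt: "av S {r} = card {w. mset w = S \<and> \<not> contains_pattern w r}"
  by (simp add: av_def permutations_of_multiset_def)

text \<open>
  Both counts satisfy the same recursion, since a block of copies and a last copy can be put into the
  same number of gaps.
\<close>
theorem av_122_eq_av_212: "av S {[1, 2, 2]} = av S {[2, 1, 2]}"
proof (induction S rule: multiset_top_letter_induct)
  case empty
  show ?case by (simp add: av_def cong: conj_cong)
next
  case (top S k a)
  thus ?case unfolding av_alt contains_122_iff contains_212_iff no_122_def[symmetric] no_212_def[symmetric]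
    by (simp only: card_avoiding_122_step card_avoiding_212_step)
qed

section \<open>One smallest letter, one largest letter and two copies of a middle letter\<close>

text \<open>
  A pattern with one letter 1, one letter 3 and further letters 2 is cut at its 3 into two lists, in
  which \<open>True\<close> stands for 2 and \<open>False\<close> for 1.  In an occurrence the letters 1 and 2 become \<open>y < x\<close>.
\<close>
type_synonym template = "bool list \<times> bool list"

definition inst :: "nat \<Rightarrow> nat \<Rightarrow> bool list \<Rightarrow> nat list" where
  "inst y x P = map (\<lambda>b. if b then x else y) P"

definition occurs :: "nat \<Rightarrow> nat \<Rightarrow> template \<Rightarrow> nat list \<Rightarrow> nat list \<Rightarrow> bool" where
  "occurs y x T u v \<longleftrightarrow> subseq (inst y x (fst T)) u \<and> subseq (inst y x (snd T)) v"

text \<open>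
  In the gap between \<open>u\<close> and \<open>v\<close> a letter \<open>k\<close> would play the role of the 3.
\<close>
definition blocked :: "template \<Rightarrow> nat \<Rightarrow> nat list \<Rightarrow> nat list \<Rightarrow> bool" where
  "blocked T k u v \<longleftrightarrow> (\<exists>y x. y < x \<and> x < k \<and> occurs y x T u v)"

text \<open>
  The limit case of \<open>blocked\<close> for a letter \<open>k\<close> above all others.
\<close>
definition jammed :: "template \<Rightarrow> nat list \<Rightarrow> nat list \<Rightarrow> bool" where
  "jammed T u v \<longleftrightarrow> (\<exists>y x. y < x \<and> occurs y x T u v)"

definition good :: "template \<Rightarrow> nat list \<Rightarrow> bool" where
  "good T w \<longleftrightarrow> (\<forall>u z v. w = u @ z # v \<longrightarrow> \<not> blocked T z u v)"

definition active :: "template \<Rightarrow> nat list \<Rightarrow> nat set" where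
  "active T w = {g. g \<le> length w \<and> \<not> jammed T (take g w) (drop g w)}"

lemma set_inst: "set (inst y x P) \<subseteq> {y, x}"
  by (auto simp: inst_def)

lemma occurs_mono: "occurs y x T u v \<Longrightarrow> subseq u u' \<Longrightarrow> subseq v v' \<Longrightarrow> occurs y x T u' v'"
  unfolding occurs_def using subseq_order.order_trans by blast

lemma subseq_remove1:
  assumes "subseq s (t @ k # v)" "k \<notin> set s"
  shows "subseq s (t @ v)"
proof -
  obtain s1 s2 where s: "s = s1 @ s2" "subseq s1 t" "subseq s2 (k # v)"
    using assms(1) by (rule subseq_appendE)
  hence "subseq s2 v" using assms(2) by (cases s2) (auto split: if_splits)
  thus ?thesis using s by (auto intro: list_emb_append_mono)
qed

lemma occurs_remove1:
  assumes "y \<noteq> k" "x \<noteq> k"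
  shows "occurs y x T (t @ k # t') v \<longleftrightarrow> occurs y x T (t @ t') v"
    and "occurs y x T u (t @ k # t') \<longleftrightarrow> occurs y x T u (t @ t')"
proof -
  have k: "k \<notin> set (inst y x P)" for P using set_inst[of y x P] assms by auto
  have "subseq (t @ t') (t @ k # t')" by (simp add: subseq_append' list_emb_Cons)
  thus "occurs y x T (t @ k # t') v \<longleftrightarrow> occurs y x T (t @ t') v"
    and "occurs y x T u (t @ k # t') \<longleftrightarrow> occurs y x T u (t @ t')"
    using subseq_remove1[OF _ k] subseq_order.order_trans unfolding occurs_def by blast+
qed

text \<open>
  An occurrence in the longer word either uses the new letter \<open>k\<close> as its 3, or it has another 3;
  that one is at most \<open>k\<close>, so all other letters of the occurrence are smaller than \<open>k\<close> and the
  occurrence survives the removal of \<open>k\<close>.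
\<close>
lemma good_insert:
  assumes k: "\<forall>x\<in>set (u0 @ v0). x \<le> k"
  shows "good T (u0 @ k # v0) \<longleftrightarrow> good T (u0 @ v0) \<and> \<not> blocked T k u0 v0"
proof
  assume g: "good T (u0 @ k # v0)"
  have "\<not> blocked T z u v" if "u0 @ v0 = u @ z # v" for u z v
  proof
    assume "blocked T z u v"
    then obtain y x where yx: "y < x" "x < z" "occurs y x T u v" unfolding blocked_def by blast
    have sub: "subseq (a @ b) (a @ k # b)" for a b :: "nat list" by (simp add: subseq_append' list_emb_Cons)
    from that consider t where "u0 = u @ z # t" "v = t @ v0" | t where "u = u0 @ t" "v0 = t @ z # v"
      by (auto simp: append_eq_append_conv2 append_eq_Cons_conv Cons_eq_append_conv)
    thus False
    proof cases
      case 1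
      have "\<not> blocked T z u (t @ k # v0)" using g 1 unfolding good_def by simp
      moreover have "occurs y x T u (t @ k # v0)"
        using occurs_mono[OF yx(3) subseq_order.order_refl] sub[of t v0] 1 by simp
      ultimately show False using yx unfolding blocked_def by blast
    next
      case 2
      have "\<not> blocked T z (u0 @ k # t) v" using g 2 unfolding good_def by (metis append_Cons append_assoc)
      moreover have "occurs y x T (u0 @ k # t) v"
        using occurs_mono[OF yx(3) _ subseq_order.order_refl] sub[of u0 t] 2 by simp
      ultimately show False using yx unfolding blocked_def by blast
    qed
  qed
  thus "good T (u0 @ v0) \<and> \<not> blocked T k u0 v0" using g unfolding good_def by blast
next
  assume g: "good T (u0 @ v0) \<and> \<not> blocked T k u0 v0"
  show "good T (u0 @ k # v0)" unfolding good_def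
  proof (intro allI impI notI)
    fix u z v assume eq: "u0 @ k # v0 = u @ z # v" and "blocked T z u v"
    then obtain y x where yx: "y < x" "x < z" "occurs y x T u v" unfolding blocked_def by blast
    have "z \<in> set (u0 @ k # v0)" unfolding eq by simp
    hence "z \<le> k" using k by auto
    hence ne: "y \<noteq> k" "x \<noteq> k" using yx by auto
    from eq consider t where "u0 = u @ z # t" "v = t @ k # v0" | "u = u0" "z = k" "v = v0"
        | t where "u = u0 @ k # t" "v0 = t @ z # v"
      by (auto simp: append_eq_append_conv2 append_eq_Cons_conv Cons_eq_append_conv)
    thus False
    proof cases
      case 1
      have "occurs y x T u (t @ v0)" using yx(3) 1 occurs_remove1[OF ne] by simp
      moreover have "u0 @ v0 = u @ z # (t @ v0)" using 1 by simp
      ultimately show False using g yx unfolding good_def blocked_def by blast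
    next
      case 2
      thus False using g yx unfolding blocked_def by blast
    next
      case 3
      have "occurs y x T (u0 @ t) v" using yx(3) 3 occurs_remove1[OF ne] by simp
      moreover have "u0 @ v0 = (u0 @ t) @ z # v" using 3 by simp
      ultimately show False using g yx unfolding good_def blocked_def by blast
    qed
  qed
qed

lemma occurs_filter:
  assumes "y \<noteq> k" "x \<noteq> k"
  shows "occurs y x T u v \<longleftrightarrow> occurs y x T (filter (\<lambda>z. z \<noteq> k) u) (filter (\<lambda>z. z \<noteq> k) v)"
proof -
  have "\<forall>z\<in>set (inst y x P). z \<noteq> k" for P using set_inst[of y x P] assms by auto
  thus ?thesis by (simp add: occurs_def subseq_filter_iff)
qed

lemma blocked_filter: "blocked T k u v \<longleftrightarrow> blocked T k (filter (\<lambda>z. z \<noteq> k) u) (filter (\<lambda>z. z \<noteq> k) v)"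
proof -
  have "occurs y x T u v \<longleftrightarrow> occurs y x T (filter (\<lambda>z. z \<noteq> k) u) (filter (\<lambda>z. z \<noteq> k) v)" if "y < x" "x < k" for y x
    by (rule occurs_filter) (use that in auto)
  thus ?thesis unfolding blocked_def by blast
qed

definition nontrivial :: "template \<Rightarrow> bool" where
  "nontrivial T \<longleftrightarrow> True \<in> set (fst T) \<union> set (snd T) \<and> fst T \<noteq> []"

lemma occurs_in_set:
  assumes "nontrivial T" "occurs y x T u v"
  shows "x \<in> set u \<union> set v"
proof -
  have "x \<in> set (inst y x (fst T)) \<union> set (inst y x (snd T))"
    using assms(1) by (auto simp: nontrivial_def inst_def image_iff)
  moreover have "set (inst y x (fst T)) \<subseteq> set u" "set (inst y x (snd T)) \<subseteq> set v"
    using assms(2) subseq_set unfolding occurs_def by blast+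
  ultimately show ?thesis by auto
qed

lemma blocked_iff_jammed:
  assumes "nontrivial T" "\<forall>x\<in>set u \<union> set v. x < k"
  shows "blocked T k u v \<longleftrightarrow> jammed T u v"
proof
  assume "jammed T u v"
  then obtain y x where yx: "y < x" "occurs y x T u v" unfolding jammed_def by blast
  hence "x < k" using occurs_in_set[OF assms(1) yx(2)] assms(2) by blast
  thus "blocked T k u v" using yx unfolding blocked_def by blast
qed (auto simp: blocked_def jammed_def)

text \<open>
  A gap is closed to larger letters either already without the copies of the largest letter \<open>k\<close>, or
  because \<open>k\<close> plays the role of the 2; the largest letter cannot play the role of the 1.
\<close>
lemma jammed_with_top:
  assumes "nontrivial T" "\<forall>x\<in>set u \<union> set v. x \<le> k"
  shows "jammed T u v \<longleftrightarrow> jammed T (filter (\<lambda>z. z \<noteq> k) u) (filter (\<lambda>z. z \<noteq> k) v) \<or>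
     (\<exists>y<k. occurs y k T u v)"
proof -
  have "jammed T u v \<longleftrightarrow> blocked T k u v \<or> (\<exists>y<k. occurs y k T u v)"
    using occurs_in_set[OF assms(1)] assms(2) unfolding blocked_def jammed_def
    by (metis order_le_less)
  moreover have "blocked T k (filter (\<lambda>z. z \<noteq> k) u) (filter (\<lambda>z. z \<noteq> k) v) \<longleftrightarrow>
      jammed T (filter (\<lambda>z. z \<noteq> k) u) (filter (\<lambda>z. z \<noteq> k) v)"
    by (rule blocked_iff_jammed[OF assms(1)]) (use assms(2) in \<open>auto simp: order_le_less\<close>)
  ultimately show ?thesis using blocked_filter by blast
qed

definition insert1 :: "nat \<Rightarrow> nat list \<Rightarrow> nat \<Rightarrow> nat list" where
  "insert1 k w i = take i w @ k # drop i w"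

definition insert2 :: "nat \<Rightarrow> nat list \<Rightarrow> nat \<Rightarrow> nat \<Rightarrow> nat list" where
  "insert2 k w i j = take i w @ k # drop i (take j w) @ k # drop j w"

lemma drop_split: "i \<le> j \<Longrightarrow> drop i (take j w) @ drop j w = drop i w"
  using append_take_drop_id[of "j - i" "drop i w"] by (simp add: drop_take)

lemma filter_take_drop_positions:
  assumes f: "filter (\<lambda>z. z \<noteq> k) W = w" and g: "g \<le> length W"
    and K: "{q. q < length W \<and> W ! q = k} = K"
  shows "filter (\<lambda>z. z \<noteq> k) (take g W) = take (g - card (K \<inter> {..<g})) w"
    and "filter (\<lambda>z. z \<noteq> k) (drop g W) = drop (g - card (K \<inter> {..<g})) w"
proof -
  let ?p = "length (filter (\<lambda>z. z \<noteq> k) (take g W))"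
  have "?p = card {q. q < g \<and> W ! q \<noteq> k}"
    unfolding length_filter_conv_card using g by (intro arg_cong[of _ _ card]) auto
  also have "{q. q < g \<and> W ! q \<noteq> k} = {..<g} - K \<inter> {..<g}" using K g by auto
  also have "card \<dots> = g - card (K \<inter> {..<g})" by (subst card_Diff_subset) auto
  finally have p: "?p = g - card (K \<inter> {..<g})" .
  have "filter (\<lambda>z. z \<noteq> k) (take g W) @ filter (\<lambda>z. z \<noteq> k) (drop g W) = w"
    using f by (metis append_take_drop_id filter_append)
  thus "filter (\<lambda>z. z \<noteq> k) (take g W) = take (g - card (K \<inter> {..<g})) w"
    and "filter (\<lambda>z. z \<noteq> k) (drop g W) = drop (g - card (K \<inter> {..<g})) w"
    unfolding p[symmetric] by auto
qed

text \<open>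
  The gap \<open>g\<close> of \<open>W\<close> arises from the gap \<open>g - card (K \<inter> {..<g})\<close> of \<open>w\<close>, where \<open>K\<close> is the set of
  positions of the new letters.  It is active unless that gap is closed or the new letters close it.
\<close>
lemma active_insert:
  assumes T: "nontrivial T" and wk: "\<forall>x\<in>set w. x < k" and f: "filter (\<lambda>z. z \<noteq> k) W = w"
    and K: "{q. q < length W \<and> W ! q = k} = K"
  shows "active T W = {g. g \<le> length W \<and> g - card (K \<inter> {..<g}) \<in> active T w \<and>
     \<not> (\<exists>y<k. occurs y k T (take g W) (drop g W))}"
proof -
  have Wk: "x \<le> k" if "x \<in> set W" for x
    using that wk f by (cases "x = k") (auto simp: order_le_less)
  have "g \<in> active T W \<longleftrightarrow> g - card (K \<inter> {..<g}) \<in> active T w \<and>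
     \<not> (\<exists>y<k. occurs y k T (take g W) (drop g W))" if g: "g \<le> length W" for g
  proof -
    have "\<forall>x\<in>set (take g W) \<union> set (drop g W). x \<le> k"
      using Wk by (auto dest!: in_set_takeD in_set_dropD)
    from jammed_with_top[OF T this] have "jammed T (take g W) (drop g W) \<longleftrightarrow>
       jammed T (take (g - card (K \<inter> {..<g})) w) (drop (g - card (K \<inter> {..<g})) w) \<or>
       (\<exists>y<k. occurs y k T (take g W) (drop g W))"
      unfolding filter_take_drop_positions[OF f g K] .
    moreover have "g - card (K \<inter> {..<g}) \<le> length w"
      using arg_cong[OF filter_take_drop_positions(1)[OF f g K], of length] f
        length_filter_le filter_take_drop_positions[OF f g K]
    proof -
      have "length W = length w + card K"
        unfolding K[symmetric] f[symmetric] length_filter_conv_card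
      proof -
        have "card ({q. q < length W \<and> W ! q \<noteq> k} \<union> {q. q < length W \<and> W ! q = k}) =
           card {q. q < length W \<and> W ! q \<noteq> k} + card {q. q < length W \<and> W ! q = k}"
          by (rule card_Un_disjoint) auto
        moreover have "{q. q < length W \<and> W ! q \<noteq> k} \<union> {q. q < length W \<and> W ! q = k} = {..<length W}" by auto
        ultimately show "length W = card {q. q < length W \<and> W ! q \<noteq> k} + card {q. q < length W \<and> W ! q = k}" by simp
      qed
      moreover have "card K \<le> card (K \<inter> {..<g}) + (length W - g)"
      proof -
        have "finite K" unfolding K[symmetric] by simp
        have "card K \<le> card (K \<inter> {..<g} \<union> {g..<length W})"
          unfolding K[symmetric] by (rule card_mono) auto
        also have "\<dots> \<le> card (K \<inter> {..<g}) + card {g..<length W}" by (rule card_Un_le)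
        finally show ?thesis by simp
      qed
      ultimately show ?thesis using g by linarith
    qed
    ultimately show ?thesis using g by (simp add: active_def)
  qed
  moreover have "g \<le> length W" if "g \<in> active T W" for g using that by (simp add: active_def)
  ultimately show ?thesis by blast
qed

context
  fixes w :: "nat list" and k :: nat
  assumes wk: "\<forall>x\<in>set w. x < k"
begin

lemma filter_sub: "filter (\<lambda>z. z \<noteq> k) (take g w) = take g w" "filter (\<lambda>z. z \<noteq> k) (drop g w) = drop g w"
  "filter (\<lambda>z. z \<noteq> k) (drop i (take j w)) = drop i (take j w)" "filter (\<lambda>z. z \<noteq> k) w = w"
  using wk by (auto simp: filter_id_conv dest!: in_set_takeD in_set_dropD)

lemma good_insert1:
  assumes "nontrivial T" "i \<le> length w"
  shows "good T (insert1 k w i) \<longleftrightarrow> good T w \<and> i \<in> active T w"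
proof -
  have "blocked T k (take i w) (drop i w) \<longleftrightarrow> jammed T (take i w) (drop i w)"
    by (rule blocked_iff_jammed[OF assms(1)]) (use wk in \<open>auto dest: in_set_takeD in_set_dropD\<close>)
  thus ?thesis using good_insert[of "take i w" "drop i w" k T] wk assms(2)
    by (auto simp: insert1_def active_def order_le_less)
qed

lemma good_insert2:
  assumes "nontrivial T" "i \<le> j" "j \<le> length w"
  shows "good T (insert2 k w i j) \<longleftrightarrow> good T w \<and> i \<in> active T w \<and> j \<in> active T w"
proof -
  have jw: "take i w @ drop i (take j w) = take j w"
    using assms(2) by (metis append_take_drop_id min.absorb1 take_take)
  have iw: "drop i (take j w) @ drop j w = drop i w"
    using assms(2,3) by (metis append_take_drop_id drop_append diff_is_0_eq drop0 length_take min.absorb2)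
  have wk': "x \<le> k" if "x \<in> set w" for x using wk that by auto
  have "good T (insert2 k w i j) \<longleftrightarrow> good T (take i w @ (drop i (take j w) @ k # drop j w)) \<and>
      \<not> blocked T k (take i w) (drop i (take j w) @ k # drop j w)"
    unfolding insert2_def
    by (rule good_insert) (auto dest!: in_set_takeD in_set_dropD intro: wk')
  also have "take i w @ (drop i (take j w) @ k # drop j w) = take j w @ k # drop j w"
    using jw by (metis append_assoc)
  also have "good T (take j w @ k # drop j w) \<longleftrightarrow> good T (insert1 k w j)" by (simp add: insert1_def)
  also have "blocked T k (take i w) (drop i (take j w) @ k # drop j w) \<longleftrightarrow> blocked T k (take i w) (drop i w)"
    unfolding blocked_filter[of T k "take i w" "drop i (take j w) @ k # drop j w"]
    by (simp add: filter_sub iw)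
  also have "\<dots> \<longleftrightarrow> jammed T (take i w) (drop i w)"
    by (rule blocked_iff_jammed[OF assms(1)]) (use wk in \<open>auto dest: in_set_takeD in_set_dropD\<close>)
  finally show ?thesis using good_insert1[OF assms(1,3)] assms by (auto simp: active_def)
qed

lemma positions_insert1:
  assumes "i \<le> length w"
  shows "{q. q < length (insert1 k w i) \<and> insert1 k w i ! q = k} = {i}"
    and "length (insert1 k w i) = Suc (length w)" and "filter (\<lambda>z. z \<noteq> k) (insert1 k w i) = w"
proof -
  show len: "length (insert1 k w i) = Suc (length w)" using assms by (simp add: insert1_def)
  show "filter (\<lambda>z. z \<noteq> k) (insert1 k w i) = w" by (simp add: insert1_def filter_sub)
  have "insert1 k w i ! q = k \<longleftrightarrow> q = i" if "q < Suc (length w)" for q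
  proof -
    consider "q < i" | "q = i" | "i < q" by linarith
    thus ?thesis
    proof cases
      case 1
      thus ?thesis using wk assms nth_mem[of q w] by (auto simp: insert1_def nth_append)
    next
      case 2
      thus ?thesis using assms by (simp add: insert1_def nth_append)
    next
      case 3
      hence "insert1 k w i ! q = w ! (q - 1)" using assms that by (simp add: insert1_def nth_append)
      thus ?thesis using wk 3 that nth_mem[of "q - 1" w] by auto
    qed
  qed
  thus "{q. q < length (insert1 k w i) \<and> insert1 k w i ! q = k} = {i}" using len assms by auto
qed

lemma positions_insert2:
  assumes "i \<le> j" "j \<le> length w"
  shows "{q. q < length (insert2 k w i j) \<and> insert2 k w i j ! q = k} = {i, Suc j}"
    and "length (insert2 k w i j) = Suc (Suc (length w))" and "filter (\<lambda>z. z \<noteq> k) (insert2 k w i j) = w"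
proof -
  show len: "length (insert2 k w i j) = Suc (Suc (length w))" using assms by (simp add: insert2_def)
  show "filter (\<lambda>z. z \<noteq> k) (insert2 k w i j) = w"
    using assms by (simp add: insert2_def filter_sub drop_split)
  have "insert2 k w i j ! q = k \<longleftrightarrow> q = i \<or> q = Suc j" if "q < Suc (Suc (length w))" for q
  proof -
    consider "q < i" | "q = i" | "i < q" "q < Suc j" | "q = Suc j" | "Suc j < q" by linarith
    thus ?thesis
    proof cases
      case 1
      thus ?thesis using wk assms nth_mem[of q w] by (auto simp: insert2_def nth_append)
    next
      case 2
      thus ?thesis using assms by (simp add: insert2_def nth_append)
    next
      case 3
      hence "insert2 k w i j ! q = w ! (q - 1)" using assms that by (auto simp: insert2_def nth_append nth_Cons')
      thus ?thesis using wk 3 assms nth_mem[of "q - 1" w] by auto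
    next
      case 4
      thus ?thesis using assms by (simp add: insert2_def nth_append nth_Cons')
    next
      case 5
      hence "insert2 k w i j ! q = w ! (q - 2)" using assms that by (auto simp: insert2_def nth_append nth_Cons')
      thus ?thesis using wk 5 that assms nth_mem[of "q - 2" w] by auto
    qed
  qed
  thus "{q. q < length (insert2 k w i j) \<and> insert2 k w i j ! q = k} = {i, Suc j}" using len assms by auto
qed

lemma set_insert2: "i \<le> j \<Longrightarrow> set (insert2 k w i j) = insert k (set w)"
  using drop_split[of i j w] append_take_drop_id[of i w] unfolding insert2_def
  by (metis (no_types, lifting) Un_insert_right list.simps(15) set_append insert_absorb2)

end

lemma subseq2_nth: "subseq [a, b] l \<longleftrightarrow> (\<exists>p q. p < q \<and> q < length l \<and> l ! p = a \<and> l ! q = b)"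
proof
  assume "subseq [a, b] l"
  then obtain i where i: "strict_mono_on {..<length [a, b]} i" "\<forall>c<length [a, b]. i c < length l \<and> l ! i c = [a, b] ! c"
    unfolding subseq_iff_embedding by blast
  have "i 0 < i 1" using strict_mono_onD[OF i(1), of 0 1] by simp
  moreover have "i 1 < length l" "l ! i 0 = a" "l ! i 1 = b"
    using i(2)[rule_format, of 0] i(2)[rule_format, of 1] by auto
  ultimately show "\<exists>p q. p < q \<and> q < length l \<and> l ! p = a \<and> l ! q = b" by blast
next
  assume "\<exists>p q. p < q \<and> q < length l \<and> l ! p = a \<and> l ! q = b"
  then obtain p q where "p < q" "q < length l" "l ! p = a" "l ! q = b" by blast
  thus "subseq [a, b] l" unfolding subseq_iff_embedding
    by (intro exI[of _ "\<lambda>n. if n = 0 then p else q"])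
       (auto simp: strict_mono_on_def less_Suc_eq)
qed

lemma subseq3_nth: "subseq [a, b, c] l \<longleftrightarrow>
   (\<exists>p q r. p < q \<and> q < r \<and> r < length l \<and> l ! p = a \<and> l ! q = b \<and> l ! r = c)"
proof
  assume "subseq [a, b, c] l"
  then obtain i where i: "strict_mono_on {..<length [a, b, c]} i" "\<forall>d<length [a, b, c]. i d < length l \<and> l ! i d = [a, b, c] ! d"
    unfolding subseq_iff_embedding by blast
  have "i 0 < i 1" "i 1 < i 2" using strict_mono_onD[OF i(1), of 0 1] strict_mono_onD[OF i(1), of 1 2] by auto
  moreover have "i 2 < length l" "l ! i 0 = a" "l ! i 1 = b" "l ! i 2 = c"
    using i(2)[rule_format, of 0] i(2)[rule_format, of 1] i(2)[rule_format, of 2] by auto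
  ultimately show "\<exists>p q r. p < q \<and> q < r \<and> r < length l \<and> l ! p = a \<and> l ! q = b \<and> l ! r = c" by blast
next
  assume "\<exists>p q r. p < q \<and> q < r \<and> r < length l \<and> l ! p = a \<and> l ! q = b \<and> l ! r = c"
  then obtain p q r where "p < q" "q < r" "r < length l" "l ! p = a" "l ! q = b" "l ! r = c" by blast
  thus "subseq [a, b, c] l" unfolding subseq_iff_embedding
    by (intro exI[of _ "\<lambda>n. if n = 0 then p else if n = 1 then q else r"])
       (auto simp: strict_mono_on_def less_Suc_eq)
qed

definition t2132 :: template where "t2132 = ([True, False], [True])"
definition t2123 :: template where "t2123 = ([True, False, True], [])"
definition t1223 :: template where "t1223 = ([False, True, True], [])"
definition t2213 :: template where "t2213 = ([True, True, False], [])"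

text \<open>
  When the two copies of the largest letter \<open>k\<close> stand at the positions \<open>i\<close> and \<open>Suc j\<close>, the gaps that
  they close form an interval, possibly empty, for each of the four templates.
\<close>
context
  fixes W :: "nat list" and k i j g :: nat
  assumes K: "{q. q < length W \<and> W ! q = k} = {i, Suc j}" and ij: "i \<le> j"
    and Wk: "\<forall>x\<in>set W. x \<le> k" and g: "g \<le> length W"
begin

lemma at_top: "q < length W \<Longrightarrow> W ! q = k \<longleftrightarrow> q = i \<or> q = Suc j"
  using K by auto

lemma not_top: "q < length W \<Longrightarrow> q \<noteq> i \<Longrightarrow> q \<noteq> Suc j \<Longrightarrow> W ! q < k"
  using at_top Wk nth_mem by (metis order_le_less)

lemma Suc_j_less: "Suc j < length W" "W ! i = k" "W ! Suc j = k" 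
  using K by auto

lemma mask_2132: "(\<exists>y<k. occurs y k t2132 (take g W) (drop g W)) \<longleftrightarrow> i + 2 \<le> g \<and> g \<le> j + 1"
proof
  assume "\<exists>y<k. occurs y k t2132 (take g W) (drop g W)"
  then obtain y where y: "y < k" "subseq [k, y] (take g W)" "k \<in> set (drop g W)"
    by (auto simp: occurs_def t2132_def inst_def subseq_singleton_left)
  then obtain p q where pq: "p < q" "q < g" "W ! p = k" "W ! q = y" unfolding subseq2_nth using g by auto
  obtain r where "r < length (drop g W)" "drop g W ! r = k" using y(3) unfolding in_set_conv_nth by blast
  hence r: "g + r < length W" "W ! (g + r) = k" by auto
  have "p = i \<or> p = Suc j" "g + r = i \<or> g + r = Suc j" using at_top pq r g by auto
  hence "p = i" "g + r = Suc j" using pq ij by auto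
  thus "i + 2 \<le> g \<and> g \<le> j + 1" using pq by auto
next
  assume gg: "i + 2 \<le> g \<and> g \<le> j + 1"
  have "W ! Suc i < k" using gg Suc_j_less by (intro not_top) auto
  moreover have "subseq [k, W ! Suc i] (take g W)" unfolding subseq2_nth
    using gg g Suc_j_less by (intro exI[of _ i] exI[of _ "Suc i"]) auto
  moreover have "k \<in> set (drop g W)"
    using gg Suc_j_less unfolding in_set_conv_nth by (intro exI[of _ "Suc j - g"]) auto
  ultimately show "\<exists>y<k. occurs y k t2132 (take g W) (drop g W)"
    by (auto simp: occurs_def t2132_def inst_def subseq_singleton_left)
qed

lemma mask_2123: "(\<exists>y<k. occurs y k t2123 (take g W) (drop g W)) \<longleftrightarrow> i < j \<and> j + 2 \<le> g"
proof
  assume "\<exists>y<k. occurs y k t2123 (take g W) (drop g W)"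
  then obtain y where y: "y < k" "subseq [k, y, k] (take g W)"
    by (auto simp: occurs_def t2123_def inst_def)
  then obtain p q r where pq: "p < q" "q < r" "r < g" "W ! p = k" "W ! q = y" "W ! r = k" unfolding subseq3_nth using g by auto
  have "p = i \<or> p = Suc j" "r = i \<or> r = Suc j" using at_top pq g by auto
  thus "i < j \<and> j + 2 \<le> g" using pq ij by auto
next
  assume gg: "i < j \<and> j + 2 \<le> g"
  have "W ! Suc i < k" using gg Suc_j_less by (intro not_top) auto
  moreover have "subseq [k, W ! Suc i, k] (take g W)" unfolding subseq3_nth
    using gg g Suc_j_less by (intro exI[of _ i] exI[of _ "Suc i"] exI[of _ "Suc j"]) auto
  ultimately show "\<exists>y<k. occurs y k t2123 (take g W) (drop g W)"
    by (auto simp: occurs_def t2123_def inst_def)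
qed

lemma mask_1223: "(\<exists>y<k. occurs y k t1223 (take g W) (drop g W)) \<longleftrightarrow> 1 \<le> i \<and> j + 2 \<le> g"
proof
  assume "\<exists>y<k. occurs y k t1223 (take g W) (drop g W)"
  then obtain y where y: "y < k" "subseq [y, k, k] (take g W)"
    by (auto simp: occurs_def t1223_def inst_def)
  then obtain p q r where pq: "p < q" "q < r" "r < g" "W ! p = y" "W ! q = k" "W ! r = k" unfolding subseq3_nth using g by auto
  have "q = i \<or> q = Suc j" "r = i \<or> r = Suc j" using at_top pq g by auto
  thus "1 \<le> i \<and> j + 2 \<le> g" using pq ij by auto
next
  assume gg: "1 \<le> i \<and> j + 2 \<le> g"
  have "W ! 0 < k" using gg Suc_j_less by (intro not_top) auto
  moreover have "subseq [W ! 0, k, k] (take g W)" unfolding subseq3_nth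
    using gg g ij Suc_j_less by (intro exI[of _ 0] exI[of _ i] exI[of _ "Suc j"]) auto
  ultimately show "\<exists>y<k. occurs y k t1223 (take g W) (drop g W)"
    by (auto simp: occurs_def t1223_def inst_def)
qed

lemma mask_2213: "(\<exists>y<k. occurs y k t2213 (take g W) (drop g W)) \<longleftrightarrow> j + 3 \<le> g"
proof
  assume "\<exists>y<k. occurs y k t2213 (take g W) (drop g W)"
  then obtain y where y: "y < k" "subseq [k, k, y] (take g W)"
    by (auto simp: occurs_def t2213_def inst_def)
  then obtain p q r where pq: "p < q" "q < r" "r < g" "W ! p = k" "W ! q = k" "W ! r = y" unfolding subseq3_nth using g by auto
  have "q = i \<or> q = Suc j" "p = i \<or> p = Suc j" using at_top pq g by auto
  thus "j + 3 \<le> g" using pq ij by auto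
next
  assume gg: "j + 3 \<le> g"
  have "W ! Suc (Suc j) < k" using gg g ij by (intro not_top) auto
  moreover have "subseq [k, k, W ! Suc (Suc j)] (take g W)" unfolding subseq3_nth
    using gg g ij Suc_j_less by (intro exI[of _ i] exI[of _ "Suc j"] exI[of _ "Suc (Suc j)"]) auto
  ultimately show "\<exists>y<k. occurs y k t2213 (take g W) (drop g W)"
    by (auto simp: occurs_def t2213_def inst_def)
qed

end

lemma card_shifted: "card {g. d \<le> g \<and> a \<le> g - d \<and> g - d \<le> b \<and> g - d \<in> A} = card (A \<inter> {a..b})" for A :: "nat set"
proof -
  have "{g. d \<le> g \<and> a \<le> g - d \<and> g - d \<le> b \<and> g - d \<in> A} = (\<lambda>x. x + d) ` (A \<inter> {a..b})"
    by (auto intro!: image_eqI[of _ _ "_ - d"])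
  thus ?thesis by (simp add: card_image)
qed

text \<open>
  Only the ranks of the chosen gaps among the active ones enter the number of gaps that stay active.
\<close>
definition rank :: "nat set \<Rightarrow> nat \<Rightarrow> nat" where
  "rank A i = card (A \<inter> {..<i})"

lemma rank_less_iff:
  assumes "finite A" "i \<in> A" "j \<in> A"
  shows "rank A i < rank A j \<longleftrightarrow> i < j"
proof -
  have "rank A i < rank A j" if "i < j" "i \<in> A" for i j
    unfolding rank_def using assms(1) that by (intro psubset_card_mono) auto
  thus ?thesis using assms(2,3) by (metis linorder_neqE_nat less_asym less_irrefl)
qed

lemma bij_betw_rank:
  assumes "finite A"
  shows "bij_betw (rank A) A {..<card A}"
proof -
  have inj: "inj_on (rank A) A"
    using rank_less_iff[OF assms] by (intro inj_onI) (metis linorder_neqE_nat less_irrefl)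
  moreover have "rank A ` A \<subseteq> {..<card A}"
  proof
    fix x assume "x \<in> rank A ` A"
    then obtain i where i: "i \<in> A" "x = rank A i" by blast
    have "rank A i < card A" unfolding rank_def using i(1) assms by (intro psubset_card_mono) auto
    thus "x \<in> {..<card A}" using i by simp
  qed
  ultimately show ?thesis unfolding bij_betw_def using card_image[OF inj]
    by (simp add: card_subset_eq)
qed

lemma card_segments:
  assumes A: "A \<subseteq> {..n}" and ij: "i \<in> A" "j \<in> A" "i \<le> j"
  shows "card (A \<inter> {0..i}) = rank A i + 1"
    and "card (A \<inter> {i..j}) = rank A j + 1 - rank A i"
    and "card (A \<inter> {j..n}) = card A - rank A j"
    and "rank A i \<le> rank A j" and "rank A j < card A"
proof -
  have fin: "finite A" using A finite_subset by blast
  have up: "card (A \<inter> {0..i}) = rank A i + 1" if "i \<in> A" for i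
  proof -
    have "A \<inter> {0..i} = insert i (A \<inter> {..<i})" using that by auto
    thus ?thesis using fin by (simp add: rank_def)
  qed
  show "card (A \<inter> {0..i}) = rank A i + 1" using up ij by simp
  have "A \<inter> {i..j} = A \<inter> {0..j} - A \<inter> {..<i}" by auto
  moreover have "card (A \<inter> {0..j} - A \<inter> {..<i}) = card (A \<inter> {0..j}) - card (A \<inter> {..<i})"
    using fin ij by (intro card_Diff_subset) auto
  ultimately show "card (A \<inter> {i..j}) = rank A j + 1 - rank A i" using up[OF ij(2)] by (simp add: rank_def)
  have "A \<inter> {j..n} = A - A \<inter> {..<j}" using A by auto
  moreover have "card (A - A \<inter> {..<j}) = card A - card (A \<inter> {..<j})"
    using fin by (intro card_Diff_subset) auto
  ultimately show "card (A \<inter> {j..n}) = card A - rank A j" by (simp add: rank_def)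
  show "rank A i \<le> rank A j" unfolding rank_def using fin ij by (intro card_mono) auto
  show "rank A j < card A" using bij_betw_rank[OF fin] ij(2) by (auto simp: bij_betw_def)
qed

text \<open>
  The number of active gaps after two copies of a new largest letter have been put into the \<open>a\<close>-th
  and the \<open>b\<close>-th of \<open>m\<close> active gaps, where \<open>a \<le> b\<close> and counting starts at 0.  The last case is that
  of 2213.
\<close>
fun child_label :: "template \<Rightarrow> nat \<Rightarrow> nat \<Rightarrow> nat \<Rightarrow> nat" where
  "child_label T m a b =
    (if T = t2132 then m + 2 - (b - a)
     else if T = t2123 then (if a < b then b + 2 else m + 2)
     else if T = t1223 then (if a = 0 then m + 2 else b + 2)
     else b + 3)"

lemma nontrivial_templates: "T \<in> {t2132, t2123, t1223, t2213} \<Longrightarrow> nontrivial T"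
  by (auto simp: nontrivial_def t2132_def t2123_def t1223_def t2213_def)

lemma templates_distinct:
  "t2123 \<noteq> t2132" "t1223 \<noteq> t2132" "t1223 \<noteq> t2123" "t2213 \<noteq> t2132" "t2213 \<noteq> t2123" "t2213 \<noteq> t1223"
  by (simp_all add: t2132_def t2123_def t1223_def t2213_def)

text \<open>
  The two insertions triple or double the chosen gaps, which makes \<open>m + 2\<close> gaps; the closed interval
  of gaps is then subtracted.  The three parts of the proof are the gaps up to the first new letter,
  between the new letters, and after the second.
\<close>
lemma card_active_insert2:
  assumes T: "T \<in> {t2132, t2123, t1223, t2213}" and wk: "\<forall>x\<in>set w. x < k"
    and ij: "i \<in> active T w" "j \<in> active T w" "i \<le> j"
  shows "card (active T (insert2 k w i j)) = child_label T (card (active T w)) (rank (active T w) i) (rank (active T w) j)"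
proof -
  let ?A = "active T w" and ?n = "length w" and ?W = "insert2 k w i j"
  define old where "old g = (if g \<le> i then g else if g \<le> Suc j then g - 1 else g - 2)" for g
  define mask where "mask g \<longleftrightarrow> (\<exists>y<k. occurs y k T (take g ?W) (drop g ?W))" for g
  have jn: "j \<le> ?n" using ij by (simp add: active_def)
  have A: "?A \<subseteq> {..?n}" by (auto simp: active_def)
  note pos = positions_insert2[OF wk ij(3) jn]
  have Wk: "\<forall>x\<in>set ?W. x \<le> k" using wk set_insert2[OF wk ij(3)] by (auto simp: order_le_less)
  have old: "g - card ({i, Suc j} \<inter> {..<g}) = old g" for g
  proof -
    have "{i, Suc j} \<inter> {..<g} = (if g \<le> i then {} else if g \<le> Suc j then {i} else {i, Suc j})"
      using ij(3) by auto
    thus ?thesis using ij(3) by (simp add: old_def numeral_2_eq_2)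
  qed
  have act: "active T ?W = {g. g \<le> ?n + 2 \<and> old g \<in> ?A \<and> \<not> mask g}"
    using active_insert[OF nontrivial_templates[OF T] wk pos(3) pos(1)] pos(2) by (simp add: old mask_def)
  have parts: "{g. g \<le> ?n + 2 \<and> old g \<in> ?A \<and> \<not> mask g} =
      {g. 0 \<le> g \<and> 0 \<le> g - 0 \<and> g - 0 \<le> i \<and> g - 0 \<in> {a\<in>?A. \<not> mask a}} \<union>
      ({g. 1 \<le> g \<and> i \<le> g - 1 \<and> g - 1 \<le> j \<and> g - 1 \<in> {a\<in>?A. \<not> mask (a + 1)}} \<union>
       {g. 2 \<le> g \<and> j \<le> g - 2 \<and> g - 2 \<le> ?n \<and> g - 2 \<in> {a\<in>?A. \<not> mask (a + 2)}})"
    (is "_ = ?G1 \<union> (?G2 \<union> ?G3)")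
  proof (rule set_eqI)
    fix g
    consider "g \<le> i" | "i < g" "g \<le> Suc j" | "Suc j < g" by linarith
    thus "g \<in> {g. g \<le> ?n + 2 \<and> old g \<in> ?A \<and> \<not> mask g} \<longleftrightarrow> g \<in> ?G1 \<union> (?G2 \<union> ?G3)"
    proof cases
      case 1
      thus ?thesis using ij(3) jn by (auto simp: old_def)
    next
      case 2
      thus ?thesis using ij(3) jn by (cases g) (auto simp: old_def)
    next
      case 3
      define h where "h = g - 2"
      have "g = Suc (Suc h)" using 3 by (simp add: h_def)
      thus ?thesis using 3 ij(3) A by (auto simp: old_def)
    qed
  qed
  have fin: "finite ?G1" "finite ?G2" "finite ?G3"
    by (rule finite_subset[of _ "{..?n + j + i + 2}"]; auto)+
  have "card (active T ?W) = card ?G1 + card (?G2 \<union> ?G3)"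
    unfolding act parts using fin by (intro card_Un_disjoint) (use ij(3) in auto)
  also have "card (?G2 \<union> ?G3) = card ?G2 + card ?G3"
    using fin by (intro card_Un_disjoint) auto
  finally have total: "card (active T ?W) = card ({a\<in>?A. \<not> mask a} \<inter> {0..i}) +
     (card ({a\<in>?A. \<not> mask (a + 1)} \<inter> {i..j}) + card ({a\<in>?A. \<not> mask (a + 2)} \<inter> {j..?n}))"
    unfolding card_shifted .
  note seg = card_segments[OF A ij]
  note fm = pos(1) ij(3) Wk
  have le: "a \<le> length ?W" "a + 1 \<le> length ?W" "a + 2 \<le> length ?W" if "a \<in> ?A" for a
    using that A pos(2) by auto
  consider "T = t2132" | "T = t2123" | "T = t1223" | "T = t2213" using T by blast
  thus ?thesis
  proof cases
    case 1
    have m: "mask g \<longleftrightarrow> i + 2 \<le> g \<and> g \<le> j + 1" if "g \<le> length ?W" for g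
      unfolding mask_def 1 by (rule mask_2132) (use fm that 1 in auto)
    have "{a\<in>?A. \<not> mask a} \<inter> {0..i} = ?A \<inter> {0..i}" using m le by auto
    moreover have "{a\<in>?A. \<not> mask (a + 1)} \<inter> {i..j} = {i}" using m le ij by auto
    moreover have "{a\<in>?A. \<not> mask (a + 2)} \<inter> {j..?n} = ?A \<inter> {j..?n}" using m le by auto
    ultimately show ?thesis using total seg 1 by simp
  next
    case 2
    have m: "mask g \<longleftrightarrow> i < j \<and> j + 2 \<le> g" if "g \<le> length ?W" for g
      unfolding mask_def 2 by (rule mask_2123) (use fm that 2 in auto)
    have "{a\<in>?A. \<not> mask a} \<inter> {0..i} = ?A \<inter> {0..i}" using m le ij by auto
    moreover have "{a\<in>?A. \<not> mask (a + 1)} \<inter> {i..j} = ?A \<inter> {i..j}" using m le by auto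
    moreover have "{a\<in>?A. \<not> mask (a + 2)} \<inter> {j..?n} = (if i < j then {} else ?A \<inter> {j..?n})" using m le by auto
    moreover have "rank ?A i < rank ?A j \<longleftrightarrow> i < j" using rank_less_iff[OF _ ij(1,2)] A finite_subset by blast
    ultimately show ?thesis using total seg 2 ij(3) by (simp add: templates_distinct)
  next
    case 3
    have m: "mask g \<longleftrightarrow> 1 \<le> i \<and> j + 2 \<le> g" if "g \<le> length ?W" for g
      unfolding mask_def 3 by (rule mask_1223) (use fm that 3 in auto)
    have "{a\<in>?A. \<not> mask a} \<inter> {0..i} = ?A \<inter> {0..i}" using m le ij by auto
    moreover have "{a\<in>?A. \<not> mask (a + 1)} \<inter> {i..j} = ?A \<inter> {i..j}" using m le by auto
    moreover have "{a\<in>?A. \<not> mask (a + 2)} \<inter> {j..?n} = (if 1 \<le> i then {} else ?A \<inter> {j..?n})" using m le by auto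
    moreover have "rank ?A i = 0 \<longleftrightarrow> i = 0"
    proof -
      have "\<not> jammed T [] w" using nontrivial_templates[OF T] by (auto simp: jammed_def occurs_def nontrivial_def inst_def)
      hence "0 \<in> ?A" by (simp add: active_def)
      thus ?thesis using A finite_subset[OF A] by (auto simp: rank_def card_eq_0_iff)
    qed
    ultimately show ?thesis using total seg 3 ij(3) by (simp add: templates_distinct)
  next
    case 4
    have m: "mask g \<longleftrightarrow> j + 3 \<le> g" if "g \<le> length ?W" for g
      unfolding mask_def 4 by (rule mask_2213) (use fm that 4 in auto)
    have "{a\<in>?A. \<not> mask a} \<inter> {0..i} = ?A \<inter> {0..i}" using m le ij by auto
    moreover have "{a\<in>?A. \<not> mask (a + 1)} \<inter> {i..j} = ?A \<inter> {i..j}" using m le by auto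
    moreover have "{a\<in>?A. \<not> mask (a + 2)} \<inter> {j..?n} = {j}" using m le ij jn by auto
    ultimately show ?thesis using total seg 4 ij(3) by (simp add: templates_distinct)
  qed
qed

text \<open>
  Whatever the template is, the label \<open>j + 3\<close> arises from exactly \<open>j + 1\<close> of the pairs \<open>a \<le> b < m\<close>,
  for every \<open>j < m\<close>.
\<close>
definition spread :: "(nat \<Rightarrow> nat) \<Rightarrow> nat \<Rightarrow> nat" where
  "spread f m = (\<Sum>j<m. (j + 1) * f (j + 3))"

lemma sum_triangle: "(\<Sum>b<m. \<Sum>d\<le>b. h d) = (\<Sum>d<m. (m - d) * h d)" for h :: "nat \<Rightarrow> nat"
proof (induction m)
  case (Suc m)
  have "(\<Sum>d<m. (Suc m - d) * h d) = (\<Sum>d<m. (m - d) * h d + h d)"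
    by (rule sum.cong[OF refl]) (simp add: Suc_diff_le)
  thus ?case using Suc by (simp add: sum.distrib lessThan_Suc_atMost[symmetric])
qed simp

lemma sum_child_label:
  assumes T: "T \<in> {t2132, t2123, t1223, t2213}"
  shows "(\<Sum>b<m. \<Sum>a\<le>b. f (child_label T m a b)) = spread f m"
proof -
  have shift: "(\<Sum>b<m. b * f (b + 2)) + m * f (m + 2) = spread f m"
  proof -
    have "(\<Sum>b<m. b * f (b + 2)) + m * f (m + 2) = (\<Sum>b<Suc m. b * f (b + 2))" by simp
    also have "\<dots> = spread f m" unfolding spread_def sum.lessThan_Suc_shift by (simp add: numeral_3_eq_3)
    finally show ?thesis .
  qed
  consider "T = t2132" | "T = t2123" | "T = t1223" | "T = t2213" using T by blast
  thus ?thesis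
  proof cases
    case 1
    have "(\<Sum>a\<le>b. f (m + 2 - (b - a))) = (\<Sum>d\<le>b. f (m + 2 - d))" for b
      by (rule sum.reindex_bij_witness[of _ "\<lambda>d. b - d" "\<lambda>a. b - a"]) auto
    hence "(\<Sum>b<m. \<Sum>a\<le>b. f (child_label T m a b)) = (\<Sum>b<m. \<Sum>d\<le>b. f (m + 2 - d))" by (simp add: 1)
    also have "\<dots> = (\<Sum>d<m. (m - d) * f (m + 2 - d))" by (rule sum_triangle)
    also have "\<dots> = spread f m" unfolding spread_def
      by (rule sum.reindex_bij_witness[of _ "\<lambda>j. m - 1 - j" "\<lambda>d. m - 1 - d"]) (auto simp: Suc_diff_Suc)
    finally show ?thesis .
  next
    case 2
    have "(\<Sum>a\<le>b. f (child_label T m a b)) = b * f (b + 2) + f (m + 2)" for b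
    proof -
      have "(\<Sum>a\<le>b. f (child_label T m a b)) = (\<Sum>a<b. f (b + 2)) + f (m + 2)"
        unfolding lessThan_Suc_atMost[symmetric] by (simp add: 2 templates_distinct)
      thus ?thesis by simp
    qed
    thus ?thesis using shift by (simp add: sum.distrib)
  next
    case 3
    have "(\<Sum>a\<le>b. f (child_label T m a b)) = b * f (b + 2) + f (m + 2)" for b
      unfolding lessThan_Suc_atMost[symmetric] sum.lessThan_Suc_shift by (simp add: 3 templates_distinct)
    thus ?thesis using shift by (simp add: sum.distrib)
  next
    case 4
    thus ?thesis by (simp add: spread_def templates_distinct)
  qed
qed

lemma sum_pairs_rank:
  fixes f :: "nat \<Rightarrow> nat \<Rightarrow> nat"
  assumes "finite A"
  shows "(\<Sum>(i, j)\<in>{(i, j). i \<in> A \<and> j \<in> A \<and> i \<le> j}. f (rank A i) (rank A j)) = (\<Sum>b<card A. \<Sum>a\<le>b. f a b)"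
proof -
  let ?P = "{(i, j). i \<in> A \<and> j \<in> A \<and> i \<le> j}"
  note bij = bij_betw_rank[OF assms]
  have le: "rank A i \<le> rank A j \<longleftrightarrow> i \<le> j" if "i \<in> A" "j \<in> A" for i j
    using rank_less_iff[OF assms that(2,1)] by (simp add: not_less[symmetric])
  have "bij_betw (\<lambda>(i, j). (rank A j, rank A i)) ?P (SIGMA b:{..<card A}. {..b})"
  proof (rule bij_betw_imageI)
    show "inj_on (\<lambda>(i, j). (rank A j, rank A i)) ?P"
      using bij by (auto simp: inj_on_def bij_betw_def)
    show "(\<lambda>(i, j). (rank A j, rank A i)) ` ?P = (SIGMA b:{..<card A}. {..b})"
    proof (intro equalityI subsetI)
      fix x assume "x \<in> (SIGMA b:{..<card A}. {..b})"
      then obtain a b where x: "x = (b, a)" "a \<le> b" "b < card A" by auto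
      have "b \<in> rank A ` A" "a \<in> rank A ` A" using bij x by (auto simp: bij_betw_def)
      then obtain i j where ij: "j \<in> A" "b = rank A j" "i \<in> A" "a = rank A i" by blast
      moreover have "i \<le> j" using le[of i j] ij x by simp
      ultimately show "x \<in> (\<lambda>(i, j). (rank A j, rank A i)) ` ?P" using x by (auto intro!: image_eqI[of _ _ "(i, j)"])
    next
      fix x assume "x \<in> (\<lambda>(i, j). (rank A j, rank A i)) ` ?P"
      then obtain i j where "x = (rank A j, rank A i)" "i \<in> A" "j \<in> A" "i \<le> j" by auto
      thus "x \<in> (SIGMA b:{..<card A}. {..b})" using le bij by (auto simp: bij_betw_def)
    qed
  qed
  hence "(\<Sum>x\<in>?P. (case (\<lambda>(i, j). (rank A j, rank A i)) x of (b, a) \<Rightarrow> f a b)) = (\<Sum>(b, a)\<in>(SIGMA b:{..<card A}. {..b}). f a b)"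
    by (rule sum.reindex_bij_betw)
  also have "\<dots> = (\<Sum>b<card A. \<Sum>a\<le>b. f a b)" by (rule sum.Sigma[symmetric]) auto
  finally show ?thesis by (simp add: case_prod_beta)
qed

definition good_words :: "template \<Rightarrow> nat multiset \<Rightarrow> nat list set" where
  "good_words T S = {w. mset w = S \<and> good T w}"

lemma finite_good_words: "finite (good_words T S)"
  using finite_permutations_of_multiset[of S]
  by (rule rev_finite_subset) (auto simp: permutations_of_multiset_def good_words_def)

lemma finite_active: "finite (active T w)"
  by (rule finite_subset[of _ "{..length w}"]) (auto simp: active_def)

lemma sum_good_words_double:
  assumes T: "T \<in> {t2132, t2123, t1223, t2213}" and k: "\<forall>x\<in>#S. x < k"
  shows "(\<Sum>W\<in>good_words T (S + replicate_mset 2 k). f (card (active T W)))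
       = (\<Sum>w\<in>good_words T S. spread f (card (active T w)))"
proof -
  note nt = nontrivial_templates[OF T]
  let ?P = "\<lambda>w. {(i, j). i \<in> active T w \<and> j \<in> active T w \<and> i \<le> j}"
  let ?J = "\<lambda>(w, i, j). insert2 k w i j"
  let ?D = "SIGMA w:good_words T S. ?P w"
  have wk: "\<forall>x\<in>set w. x < k" if "mset w = S" for w using k that by auto
  have len: "j \<le> length w" if "j \<in> active T w" for j w using that by (simp add: active_def)
  have bij: "bij_betw ?J ?D (good_words T (S + replicate_mset 2 k))"
  proof (rule bij_betw_imageI)
    show "inj_on ?J ?D"
    proof (rule inj_onI)
      fix p q assume p: "p \<in> ?D" and q: "q \<in> ?D" and eq: "?J p = ?J q"
      obtain w i j w' i' j' where pq: "p = (w, i, j)" "q = (w', i', j')" by (metis prod_cases3)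
      have m: "mset w = S" "mset w' = S" "i \<le> j" "j \<le> length w" "i' \<le> j'" "j' \<le> length w'"
        using p q pq len by (auto simp: good_words_def)
      note pos = positions_insert2[OF wk[OF m(1)] m(3,4)] and pos' = positions_insert2[OF wk[OF m(2)] m(5,6)]
      have e: "insert2 k w i j = insert2 k w' i' j'" using eq pq by simp
      have "w = w'" using pos(3) pos'(3) e by simp
      moreover have "{i, Suc j} = {i', Suc j'}" using pos(1) pos'(1) e by simp
      hence "i = i' \<and> j = j'" using m by (auto simp: doubleton_eq_iff)
      ultimately show "p = q" using pq by simp
    qed
    show "?J ` ?D = good_words T (S + replicate_mset 2 k)"
    proof (intro equalityI subsetI)
      fix W assume "W \<in> ?J ` ?D"
      then obtain w i j where w: "W = insert2 k w i j" "mset w = S" "good T w" "i \<in> active T w" "j \<in> active T w" "i \<le> j"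
        by (auto simp: good_words_def)
      have "mset (take i w) + (mset (drop i (take j w)) + mset (drop j w)) = S"
        using w(2) drop_split[OF w(6), of w] by (metis append_take_drop_id mset_append)
      hence "mset W = S + replicate_mset 2 k" unfolding w(1) insert2_def by (simp add: numeral_2_eq_2 ac_simps)
      thus "W \<in> good_words T (S + replicate_mset 2 k)"
        using good_insert2[OF wk[OF w(2)] nt w(6) len[OF w(5)]] w by (simp add: good_words_def)
    next
      fix W assume "W \<in> good_words T (S + replicate_mset 2 k)"
      hence W: "mset W = S + replicate_mset 2 k" "good T W" by (auto simp: good_words_def)
      have k0: "count S k = 0" using k by (auto simp: count_eq_zero_iff)
      have cnt: "count (mset W) k = 2" using W(1) k0 by simp
      have "k \<in># mset W" using W(1) by simp
      then obtain u r where u: "W = u @ k # r" "k \<notin> set u" by (metis set_mset_mset split_list_first)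
      have "count (mset r) k = 1" using cnt u by (simp add: count_eq_zero_iff[THEN iffD2])
      hence "k \<in># mset r" by (metis count_greater_zero_iff zero_less_one)
      then obtain m v where m: "r = m @ k # v" by (metis set_mset_mset split_list)
      define w where "w = u @ m @ v"
      have "mset w = S" using W(1) u m by (simp add: w_def numeral_2_eq_2)
      have W': "W = insert2 k w (length u) (length (u @ m))"
        by (simp add: insert2_def w_def u m)
      have "length u \<le> length (u @ m)" "length (u @ m) \<le> length w" by (simp_all add: w_def)
      hence "good T w \<and> length u \<in> active T w \<and> length (u @ m) \<in> active T w"
        using good_insert2[OF wk[OF \<open>mset w = S\<close>] nt] W(2) W' by blast
      hence "(w, length u, length (u @ m)) \<in> ?D" using \<open>mset w = S\<close> by (simp add: good_words_def)
      thus "W \<in> ?J ` ?D" using W' by (intro image_eqI[of _ _ "(w, length u, length (u @ m))"]) simp_all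
    qed
  qed
  have "(\<Sum>W\<in>good_words T (S + replicate_mset 2 k). f (card (active T W))) = (\<Sum>p\<in>?D. f (card (active T (?J p))))"
    by (rule sum.reindex_bij_betw[OF bij, symmetric])
  also have "\<dots> = (\<Sum>w\<in>good_words T S. \<Sum>(i, j)\<in>?P w. f (card (active T (insert2 k w i j))))"
  proof -
    have "finite (?P w)" for w
      by (rule finite_subset[of _ "active T w \<times> active T w"]) (auto simp: finite_active)
    hence "(\<Sum>w\<in>good_words T S. \<Sum>p\<in>?P w. f (card (active T (?J (w, p))))) = (\<Sum>(w, p)\<in>?D. f (card (active T (?J (w, p)))))"
      by (intro sum.Sigma finite_good_words) auto
    thus ?thesis by (simp add: case_prod_beta)
  qed
  also have "\<dots> = (\<Sum>w\<in>good_words T S. spread f (card (active T w)))"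
  proof (rule sum.cong[OF refl])
    fix w assume "w \<in> good_words T S"
    hence w: "mset w = S" by (simp add: good_words_def)
    let ?A = "active T w"
    have "(\<Sum>(i, j)\<in>?P w. f (card (active T (insert2 k w i j)))) = (\<Sum>(i, j)\<in>?P w. f (child_label T (card ?A) (rank ?A i) (rank ?A j)))"
      by (rule sum.cong[OF refl]) (use card_active_insert2[OF T wk[OF w]] in \<open>auto simp del: child_label.simps\<close>)
    also have "\<dots> = spread f (card ?A)"
      using sum_pairs_rank[OF finite_active, of "\<lambda>a b. f (child_label T (card ?A) a b)" T w] sum_child_label[OF T, where m = "card ?A" and f = f]
      by (simp del: child_label.simps)
    finally show "(\<Sum>(i, j)\<in>?P w. f (card (active T (insert2 k w i j)))) = spread f (card ?A)" .
  qed
  finally show ?thesis .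
qed

lemma no_top_pair:
  assumes T: "T \<in> {t2132, t2123, t1223, t2213}" and "count (mset u + mset v) k \<le> 1" "y < k"
  shows "\<not> occurs y k T u v"
proof
  assume "occurs y k T u v"
  hence "count (mset (inst y k (fst T))) k + count (mset (inst y k (snd T))) k \<le> count (mset u) k + count (mset v) k"
    unfolding occurs_def by (intro add_mono subseq_count_le) auto
  moreover have "count (mset (inst y k (fst T))) k + count (mset (inst y k (snd T))) k = 2"
    using T assms(3) by (auto simp: inst_def t2132_def t2123_def t1223_def t2213_def)
  ultimately show False using assms(2) by simp
qed

lemma card_active_insert1:
  assumes T: "T \<in> {t2132, t2123, t1223, t2213}" and wk: "\<forall>x\<in>set w. x < k"
    and i: "i \<in> active T w"
  shows "card (active T (insert1 k w i)) = Suc (card (active T w))"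
proof -
  let ?A = "active T w" and ?n = "length w" and ?W = "insert1 k w i"
  have iw: "i \<le> ?n" using i by (simp add: active_def)
  have A: "?A \<subseteq> {..?n}" by (auto simp: active_def)
  note pos = positions_insert1[OF wk iw]
  have no: "\<not> (\<exists>y<k. occurs y k T (take g ?W) (drop g ?W))" for g
  proof -
    have "mset (take g ?W) + mset (drop g ?W) = mset ?W" by (metis append_take_drop_id mset_append)
    moreover have "mset ?W = add_mset k (mset w)"
      unfolding insert1_def by (metis append_take_drop_id mset.simps(2) mset_append union_mset_add_mset_right)
    moreover have "count (mset w) k = 0" using wk by (auto simp: count_eq_zero_iff)
    ultimately show ?thesis using no_top_pair[OF T, of "take g ?W" "drop g ?W" k] by auto
  qed
  have "g - card ({i} \<inter> {..<g}) = (if g \<le> i then g else g - 1)" for g by auto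
  hence act: "active T ?W = {g. g \<le> Suc ?n \<and> (if g \<le> i then g else g - 1) \<in> ?A}"
    using active_insert[OF nontrivial_templates[OF T] wk pos(3) pos(1)] pos(2) no by simp
  have parts: "\<dots> = {g. 0 \<le> g \<and> 0 \<le> g - 0 \<and> g - 0 \<le> i \<and> g - 0 \<in> ?A} \<union>
      {g. 1 \<le> g \<and> i \<le> g - 1 \<and> g - 1 \<le> ?n \<and> g - 1 \<in> ?A}" (is "_ = ?G1 \<union> ?G2")
    using iw A by (auto split: if_splits)
  have "finite ?G1" "finite ?G2" by (rule finite_subset[of _ "{..?n + i + 1}"]; auto)+
  hence "card (active T ?W) = card ?G1 + card ?G2"
    unfolding act parts by (intro card_Un_disjoint) auto
  thus ?thesis unfolding card_shifted using card_segments[OF A i i] by simp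
qed

lemma sum_good_words_single:
  assumes T: "T \<in> {t2132, t2123, t1223, t2213}" and k: "\<forall>x\<in>#S. x < k"
  shows "(\<Sum>W\<in>good_words T (add_mset k S). f (card (active T W)))
       = (\<Sum>w\<in>good_words T S. card (active T w) * f (Suc (card (active T w))))"
proof -
  note nt = nontrivial_templates[OF T]
  let ?J = "\<lambda>(w, i). insert1 k w i"
  let ?D = "SIGMA w:good_words T S. active T w"
  have wk: "\<forall>x\<in>set w. x < k" if "mset w = S" for w using k that by auto
  have len: "j \<le> length w" if "j \<in> active T w" for j w using that by (simp add: active_def)
  have bij: "bij_betw ?J ?D (good_words T (add_mset k S))"
  proof (rule bij_betw_imageI)
    show "inj_on ?J ?D"
    proof (rule inj_onI)
      fix p q assume p: "p \<in> ?D" and q: "q \<in> ?D" and eq: "?J p = ?J q"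
      obtain w i w' i' where pq: "p = (w, i)" "q = (w', i')" by (metis surj_pair)
      have m: "mset w = S" "mset w' = S" "i \<le> length w" "i' \<le> length w'"
        using p q pq len by (auto simp: good_words_def)
      note pos = positions_insert1[OF wk[OF m(1)] m(3)] and pos' = positions_insert1[OF wk[OF m(2)] m(4)]
      have e: "insert1 k w i = insert1 k w' i'" using eq pq by simp
      have "w = w'" using pos(3) pos'(3) e by simp
      moreover have "{i} = {i'}" using pos(1) pos'(1) e by simp
      ultimately show "p = q" using pq by simp
    qed
    show "?J ` ?D = good_words T (add_mset k S)"
    proof (intro equalityI subsetI)
      fix W assume "W \<in> ?J ` ?D"
      then obtain w i where w: "W = insert1 k w i" "mset w = S" "good T w" "i \<in> active T w"
        by (auto simp: good_words_def)
      have "mset (take i w) + mset (drop i w) = S" using w(2) by (metis append_take_drop_id mset_append)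
      hence "mset W = add_mset k S" unfolding w(1) insert1_def by simp
      thus "W \<in> good_words T (add_mset k S)"
        using good_insert1[OF wk[OF w(2)] nt len[OF w(4)]] w by (simp add: good_words_def)
    next
      fix W assume "W \<in> good_words T (add_mset k S)"
      hence W: "mset W = add_mset k S" "good T W" by (auto simp: good_words_def)
      have "k \<in># mset W" using W(1) by simp
      then obtain u v where u: "W = u @ k # v" by (metis set_mset_mset split_list)
      have m: "mset (u @ v) = S" using W(1) u by simp
      have W': "W = insert1 k (u @ v) (length u)" by (simp add: insert1_def u)
      have "length u \<le> length (u @ v)" by simp
      hence "good T (u @ v) \<and> length u \<in> active T (u @ v)"
        using good_insert1[OF wk[OF m] nt] W(2) W' by blast
      hence "(u @ v, length u) \<in> ?D" using m by (simp add: good_words_def)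
      thus "W \<in> ?J ` ?D" using W' by (intro image_eqI[of _ _ "(u @ v, length u)"]) simp_all
    qed
  qed
  have "(\<Sum>W\<in>good_words T (add_mset k S). f (card (active T W))) = (\<Sum>p\<in>?D. f (card (active T (?J p))))"
    by (rule sum.reindex_bij_betw[OF bij, symmetric])
  also have "\<dots> = (\<Sum>w\<in>good_words T S. \<Sum>i\<in>active T w. f (card (active T (insert1 k w i))))"
    by (subst sum.Sigma) (auto simp: finite_good_words finite_active case_prod_beta)
  also have "\<dots> = (\<Sum>w\<in>good_words T S. card (active T w) * f (Suc (card (active T w))))"
  proof (rule sum.cong[OF refl])
    fix w assume "w \<in> good_words T S"
    hence w: "mset w = S" by (simp add: good_words_def)
    have "(\<Sum>i\<in>active T w. f (card (active T (insert1 k w i)))) = (\<Sum>i\<in>active T w. f (Suc (card (active T w))))"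
      by (rule sum.cong[OF refl]) (simp add: card_active_insert1[OF T wk[OF w]])
    thus "(\<Sum>i\<in>active T w. f (card (active T (insert1 k w i)))) = card (active T w) * f (Suc (card (active T w)))" by simp
  qed
  finally show ?thesis .
qed

text \<open>
  By the two recursions, the number of avoiding words with a given number of active gaps evolves in the
  same way for all four templates.  The weight \<open>f\<close> is arbitrary because the recursions express a sum
  with one weight by a sum with another weight.
\<close>
lemma sum_good_words_eq:
  fixes f :: "nat \<Rightarrow> nat"
  assumes "T \<in> {t2132, t2123, t1223, t2213}" "T' \<in> {t2132, t2123, t1223, t2213}" "\<forall>x. count S x \<le> 2"
  shows "(\<Sum>w\<in>good_words T S. f (card (active T w))) = (\<Sum>w\<in>good_words T' S. f (card (active T' w)))"
  using assms(3)
proof (induction S arbitrary: f rule: multiset_top_letter_induct)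
  case empty
  have "good_words T {#} = {[]} \<and> active T [] = {0}" if "T \<in> {t2132, t2123, t1223, t2213}" for T
  proof -
    have "\<not> jammed T [] []" using nontrivial_templates[OF that]
      by (auto simp: jammed_def occurs_def nontrivial_def inst_def)
    thus ?thesis by (auto simp: good_words_def active_def good_def)
  qed
  thus ?case using assms(1,2) by simp
next
  case (top S k a)
  have "count S k = 0" using top.hyps(2) by (auto simp: count_eq_zero_iff)
  hence a: "a = 1 \<or> a = 2" using top.prems top.hyps(1) by (auto dest: spec[of _ k])
  have S: "\<forall>x. count S x \<le> 2"
  proof
    fix x
    have "count S x \<le> count (S + replicate_mset a k) x" by simp
    thus "count S x \<le> 2" using top.prems le_trans by blast
  qed
  from a show ?case
  proof
    assume a: "a = 1"
    show ?thesis using sum_good_words_single[OF assms(1) top.hyps(2), of f] sum_good_words_single[OF assms(2) top.hyps(2), of f]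
      top.IH[OF S, of "\<lambda>m. m * f (Suc m)"] by (simp add: a)
  next
    assume a: "a = 2"
    show ?thesis unfolding a
      using sum_good_words_double[OF assms(1) top.hyps(2), of f] sum_good_words_double[OF assms(2) top.hyps(2), of f]
      top.IH[OF S, of "spread f"] by simp
  qed
qed

lemma length_4_iff: "length s = Suc (Suc (Suc (Suc 0))) \<longleftrightarrow> (\<exists>a b c d. s = [a, b, c, d])"
  by (auto simp: length_Suc_conv)

lemma subseq_Cons_middle: "subseq (s @ z # t) w \<longleftrightarrow> (\<exists>u v. w = u @ z # v \<and> subseq s u \<and> subseq t v)"
proof
  assume "subseq (s @ z # t) w"
  then obtain u v where uv: "w = u @ v" "subseq s u" "subseq (z # t) v" by (metis list_emb_appendD)
  then obtain v1 v2 where "v = v1 @ z # v2" "subseq t v2" by (auto dest!: list_emb_ConsD)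
  thus "\<exists>u v. w = u @ z # v \<and> subseq s u \<and> subseq t v"
    using uv by (intro exI[of _ "u @ v1"] exI[of _ v2]) (auto intro: subseq_rev_drop_many)
qed (auto intro: list_emb_append_mono)

lemma good_iff_avoids:
  "good t2132 w \<longleftrightarrow> \<not> contains_pattern w [2, 1, 3, 2]"
  "good t2123 w \<longleftrightarrow> \<not> contains_pattern w [2, 1, 2, 3]"
  "good t1223 w \<longleftrightarrow> \<not> contains_pattern w [1, 2, 2, 3]"
  "good t2213 w \<longleftrightarrow> \<not> contains_pattern w [2, 2, 1, 3]"
proof -
  have iso: "order_iso s [2, 1, 3, 2] \<longleftrightarrow> (\<exists>y x z. y < x \<and> x < z \<and> s = [x, y] @ z # [x])"
     "order_iso s [2, 1, 2, 3] \<longleftrightarrow> (\<exists>y x z. y < x \<and> x < z \<and> s = [x, y, x] @ z # [])"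
     "order_iso s [1, 2, 2, 3] \<longleftrightarrow> (\<exists>y x z. y < x \<and> x < z \<and> s = [y, x, x] @ z # [])"
     "order_iso s [2, 2, 1, 3] \<longleftrightarrow> (\<exists>y x z. y < x \<and> x < z \<and> s = [x, x, y] @ z # [])" for s
    by (cases "\<exists>a b c d. s = [a, b, c, d]"; auto simp: order_iso_def All_less_Suc length_4_iff)+
  have eq: "good T w \<longleftrightarrow> \<not> (\<exists>y x z. y < x \<and> x < z \<and> subseq (inst y x (fst T) @ z # inst y x (snd T)) w)" for T
    unfolding good_def blocked_def occurs_def subseq_Cons_middle by blast
  show "good t2132 w \<longleftrightarrow> \<not> contains_pattern w [2, 1, 3, 2]"
    unfolding contains_pattern_iff iso eq by (auto simp: t2132_def inst_def)
  show "good t2123 w \<longleftrightarrow> \<not> contains_pattern w [2, 1, 2, 3]"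
    unfolding contains_pattern_iff iso eq by (auto simp: t2123_def inst_def)
  show "good t1223 w \<longleftrightarrow> \<not> contains_pattern w [1, 2, 2, 3]"
    unfolding contains_pattern_iff iso eq by (auto simp: t1223_def inst_def)
  show "good t2213 w \<longleftrightarrow> \<not> contains_pattern w [2, 2, 1, 3]"
    unfolding contains_pattern_iff iso eq by (auto simp: t2213_def inst_def)
qed

theorem equiv_below_3_one_before_three:
  "equiv_below 3 [2, 1, 3, 2] [2, 1, 2, 3]"
  "equiv_below 3 [2, 1, 3, 2] [1, 2, 2, 3]"
  "equiv_below 3 [2, 1, 3, 2] [2, 2, 1, 3]"
proof -
  have av: "av S {[2, 1, 3, 2]} = card (good_words t2132 S)" "av S {[2, 1, 2, 3]} = card (good_words t2123 S)"
    "av S {[1, 2, 2, 3]} = card (good_words t1223 S)" "av S {[2, 2, 1, 3]} = card (good_words t2213 S)" for S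
    unfolding av_alt good_words_def good_iff_avoids by simp_all
  have "card (good_words t2132 S) = card (good_words T S)"
    if "T \<in> {t2132, t2123, t1223, t2213}" "\<forall>x. count S x < 3" for T S
  proof -
    have "\<forall>x. count S x \<le> 2" using that(2) by (simp add: less_Suc_eq_le numeral_3_eq_3 numeral_2_eq_2)
    from sum_good_words_eq[OF _ that(1) this, of t2132 "\<lambda>_. 1"] show ?thesis by simp
  qed
  hence cards: "card (good_words t2132 S) = card (good_words t2123 S)"
    "card (good_words t2132 S) = card (good_words t1223 S)"
    "card (good_words t2132 S) = card (good_words t2213 S)" if "\<forall>x. count S x < 3" for S
    using that by blast+
  show "equiv_below 3 [2, 1, 3, 2] [2, 1, 2, 3]" "equiv_below 3 [2, 1, 3, 2] [1, 2, 2, 3]"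
    "equiv_below 3 [2, 1, 3, 2] [2, 2, 1, 3]"
    by (rule equiv_belowI, unfold av, erule cards)+
qed

section \<open>Fillings of Ferrers boards, and the patterns 12 and 21\<close>

text \<open>
  A filling of a Ferrers board, read column by column: the \<open>i\<close>-th column has height \<open>ts ! i\<close> and one
  entry, in row \<open>v ! i\<close>.  When the heights increase, the part of the board to the right of a column
  and below its top is a rectangle, and the condition \<open>P\<close> is imposed on the entries in each of these
  rectangles.  This is avoidance of a pattern whose bounding box lies in the board.
\<close>
fun fits :: "(nat list \<Rightarrow> bool) \<Rightarrow> nat list \<Rightarrow> nat list \<Rightarrow> bool" where
  "fits P [] v \<longleftrightarrow> v = []"
| "fits P (t # ts) [] \<longleftrightarrow> False"
| "fits P (t # ts) (x # v) \<longleftrightarrow> x < t \<and> P (filter (\<lambda>y. y < t) (x # v)) \<and> fits P ts v"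

definition hereditary :: "(nat list \<Rightarrow> bool) \<Rightarrow> bool" where
  "hereditary P \<longleftrightarrow> P [] \<and> (\<forall>u v. P v \<longrightarrow> subseq u v \<longrightarrow> P u)"

lemma fits_filter:
  assumes "hereditary P" "fits P ts v" "sorted (t # ts)"
  shows "P (filter (\<lambda>y. y < t) v)"
proof (cases ts)
  case Nil
  thus ?thesis using assms by (simp add: hereditary_def)
next
  case (Cons t' ts')
  then obtain x v' where v: "v = x # v'" using assms(2) by (cases v) auto
  have "P (filter (\<lambda>y. y < t') v)" using assms(2) Cons v by auto
  moreover have "filter (\<lambda>y. y < t) v = filter (\<lambda>y. y < t) (filter (\<lambda>y. y < t') v)"
    using assms(3) Cons by (auto intro!: filter_cong)
  hence "subseq (filter (\<lambda>y. y < t) v) (filter (\<lambda>y. y < t') v)" by (metis subseq_filter_left)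
  ultimately show ?thesis using assms(1) unfolding hereditary_def by blast
qed

text \<open>
  For hereditary \<open>P\<close> the later, higher rectangles contain the current one without its first column,
  so only the part of \<open>P\<close> that concerns the first entry is new.
\<close>
lemma fits_Cons_iff:
  assumes "sorted (t # ts)"
    and P: "\<And>u. P (x # u) \<longleftrightarrow> A u \<and> P u" and her: "hereditary P"
  shows "fits P (t # ts) (x # v) \<longleftrightarrow> x < t \<and> A (filter (\<lambda>y. y < t) v) \<and> fits P ts v"
  using fits_filter[OF her _ assms(1)] by (auto simp: P)

lemma hereditary_sorted_wrt: "hereditary (sorted_wrt R)"
proof -
  have "sorted_wrt R v \<longrightarrow> sorted_wrt R u" if "subseq u v" for u v
    using that
  proof (induction rule: list_emb.induct)
    case (list_emb_Cons2 x y xs ys)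
    thus ?case using list_emb_set by (fastforce)
  qed auto
  thus ?thesis by (auto simp: hereditary_def)
qed

lemma finite_mset_fits [simp]: "finite {v. mset v = V \<and> Q v}"
  using finite_permutations_of_multiset[of V]
  by (rule rev_finite_subset) (auto simp: permutations_of_multiset_def)

text \<open>
  If the entries of every rectangle are sorted, the entry of the first column must be the extreme one
  among all entries below its top.
\<close>
lemma card_fits_sorted_step:
  assumes "sorted (t # ts)" "x \<in># filter_mset (\<lambda>y. y < t) V"
    and first: "\<forall>y\<in>#filter_mset (\<lambda>y. y < t) V. R x y"
    and anti: "\<And>x y. R x y \<Longrightarrow> R y x \<Longrightarrow> x = y"
  shows "card {v. mset v = V \<and> fits (sorted_wrt R) (t # ts) v}
       = card {v. mset v = V - {#x#} \<and> fits (sorted_wrt R) ts v}" (is "card ?A = card ?B")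
proof -
  have step: "fits (sorted_wrt R) (t # ts) (y # v) \<longleftrightarrow>
      y < t \<and> (\<forall>z\<in>set (filter (\<lambda>y. y < t) v). R y z) \<and> fits (sorted_wrt R) ts v" for y v
    using fits_Cons_iff[OF assms(1), of "sorted_wrt R" y "\<lambda>u. \<forall>z\<in>set u. R y z"]
      hereditary_sorted_wrt by auto
  have "?A = (#) x ` ?B"
  proof (intro equalityI subsetI)
    fix w assume "w \<in> ?A"
    then obtain y v where w: "w = y # v" "mset (y # v) = V" "fits (sorted_wrt R) (t # ts) (y # v)"
      by (cases w) auto
    have y: "y \<in># V" using w(2) by auto
    have "y = x"
    proof (rule ccontr)
      assume "y \<noteq> x"
      hence "x \<in> set v" using assms(2) w(2) by auto
      hence "R y x" "R x y" using w(3) y first assms(2) unfolding step by auto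
      thus False using anti \<open>y \<noteq> x\<close> by blast
    qed
    thus "w \<in> (#) x ` ?B" using w step by auto
  next
    fix w assume "w \<in> (#) x ` ?B"
    then obtain v where v: "w = x # v" "mset v = V - {#x#}" "fits (sorted_wrt R) ts v" by auto
    have "mset w = V" using v assms(2) by simp
    moreover have "z \<in># V" if "z \<in> set v" for z
      using that v(2) by (metis in_diffD set_mset_mset)
    ultimately have "fits (sorted_wrt R) (t # ts) (x # v)"
      unfolding step using v assms(2) first by auto
    thus "w \<in> ?A" unfolding mem_Collect_eq v(1) using \<open>mset w = V\<close> v(1) by blast
  qed
  moreover have "card ((#) x ` ?B) = card ?B" by (rule card_image) simp
  ultimately show ?thesis by simp
qed

lemma card_fits_sorted_empty:
  assumes "filter_mset (\<lambda>y. y < t) V = {#}"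
  shows "{v. mset v = V \<and> fits P (t # ts) v} = {}"
proof -
  have "\<not> fits P (t # ts) v" if "mset v = V" for v
    using that assms by (cases v) (auto simp: filter_mset_eq_conv)
  thus ?thesis by auto
qed

text \<open>
  Each column has a forced entry: the least or the greatest row available.  The number of rows
  available later does not depend on which of them has been used up, since later columns are at
  least as high.
\<close>
lemma card_fits_sorted_eq:
  assumes "sorted ts" "size V = size V'"
    and "\<forall>t\<in>set ts. size (filter_mset (\<lambda>y. y < t) V) = size (filter_mset (\<lambda>y. y < t) V')"
  shows "card {v. mset v = V \<and> fits (sorted_wrt (\<le>)) ts v} = card {v. mset v = V' \<and> fits (sorted_wrt (\<ge>)) ts v}"
  using assms
proof (induction ts arbitrary: V V')
  case Nil
  thus ?case by (cases "V = {#}"; cases "V' = {#}") (auto simp: conj_commute cong: conj_cong)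
next
  case (Cons t ts)
  let ?W = "filter_mset (\<lambda>y. y < t) V" and ?W' = "filter_mset (\<lambda>y. y < t) V'"
  have sz: "size ?W = size ?W'" using Cons.prems by simp
  show ?case
  proof (cases "?W = {#}")
    case True
    hence "?W' = {#}" using sz by (metis size_eq_0_iff_empty)
    thus ?thesis by (simp only: card_fits_sorted_empty[OF True] card_fits_sorted_empty[OF \<open>?W' = {#}\<close>])
  next
    case False
    hence ne': "?W' \<noteq> {#}" using sz by (metis size_eq_0_iff_empty)
    define x where "x = Min_mset ?W"
    define x' where "x' = Max_mset ?W'"
    have x: "x \<in># ?W" "\<forall>y\<in>#?W. x \<le> y" unfolding x_def using False by (auto simp del: set_mset_filter)
    have x': "x' \<in># ?W'" "\<forall>y\<in>#?W'. x' \<ge> y" unfolding x'_def using ne' by (auto simp del: set_mset_filter)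
    have "card {v. mset v = V \<and> fits (sorted_wrt (\<le>)) (t # ts) v}
        = card {v. mset v = V - {#x#} \<and> fits (sorted_wrt (\<le>)) ts v}"
      by (rule card_fits_sorted_step) (use Cons.prems x in auto)
    also have "\<dots> = card {v. mset v = V' - {#x'#} \<and> fits (sorted_wrt (\<ge>)) ts v}"
    proof (rule Cons.IH)
      show "sorted ts" using Cons.prems by simp
      show "size (V - {#x#}) = size (V' - {#x'#})" using x x' Cons.prems by (simp add: size_Diff_singleton)
      show "\<forall>s\<in>set ts. size (filter_mset (\<lambda>y. y < s) (V - {#x#})) = size (filter_mset (\<lambda>y. y < s) (V' - {#x'#}))"
      proof
        fix s assume s: "s \<in> set ts"
        hence "x < s" "x' < s" using Cons.prems x x' by auto
        thus "size (filter_mset (\<lambda>y. y < s) (V - {#x#})) = size (filter_mset (\<lambda>y. y < s) (V' - {#x'#}))"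
          using Cons.prems s x x' by (simp add: size_Diff_singleton)
      qed
    qed
    also have "\<dots> = card {v. mset v = V' \<and> fits (sorted_wrt (\<ge>)) (t # ts) v}"
      by (rule card_fits_sorted_step[symmetric]) (use Cons.prems x' in auto)
    finally show ?thesis .
  qed
qed

section \<open>Words as outer letters together with a filling\<close>

text \<open>
  A letter lies below some occurrence of \<open>X\<close> in the prefix \<open>u\<close> exactly if it is smaller than this
  number.  The value 0 stands for a prefix without \<open>X\<close>.
\<close>
definition threshold :: "nat list \<Rightarrow> nat list \<Rightarrow> nat" where
  "threshold X u = Max ({0} \<union> {m. contains_pattern (filter (\<lambda>y. m \<le> y) u) X})"

lemma less_threshold_iff:
  assumes "X \<noteq> []"
  shows "y < threshold X u \<longleftrightarrow> contains_pattern (filter (\<lambda>z. y < z) u) X"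
proof -
  let ?A = "{m. contains_pattern (filter (\<lambda>y. m \<le> y) u) X}"
  have "m \<le> Max (set u)" if "m \<in> ?A" for m
  proof -
    have "filter (\<lambda>y. m \<le> y) u \<noteq> []" using that assms by auto
    then obtain z where "z \<in> set u" "m \<le> z" by (auto simp: filter_empty_conv)
    thus ?thesis by (meson List.finite_set Max_ge le_trans)
  qed
  hence fin: "finite ?A" by (meson finite_nat_set_iff_bounded_le)
  have "y < threshold X u \<longleftrightarrow> (\<exists>m\<in>?A. y < m)"
    unfolding threshold_def using fin by (subst Max_gr_iff) auto
  also have "\<dots> \<longleftrightarrow> Suc y \<in> ?A"
  proof
    assume "\<exists>m\<in>?A. y < m"
    then obtain m where m: "m \<in> ?A" "Suc y \<le> m" by auto
    have "filter (\<lambda>y. m \<le> y) u = filter (\<lambda>y. m \<le> y) (filter (\<lambda>z. Suc y \<le> z) u)"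
      using m(2) unfolding filter_filter by (intro filter_cong) auto
    hence "subseq (filter (\<lambda>y. m \<le> y) u) (filter (\<lambda>z. Suc y \<le> z) u)" by (metis subseq_filter_left)
    thus "Suc y \<in> ?A" using m(1) contains_pattern_subseq by blast
  qed auto
  moreover have "((\<le>) (Suc y)) = ((<) y)" by (auto simp: fun_eq_iff)
  ultimately show ?thesis by simp
qed

lemma order_iso_append:
  assumes "length s = length X" "length t = length Y" and XY: "\<forall>a\<in>set X. \<forall>b\<in>set Y. b < a"
  shows "order_iso (s @ t) (X @ Y) \<longleftrightarrow> order_iso s X \<and> order_iso t Y \<and> (\<forall>a\<in>set s. \<forall>b\<in>set t. b < a)"
    (is "?L \<longleftrightarrow> ?R")
proof
  assume L: ?L
  have iso: "(s @ t) ! a < (s @ t) ! b \<longleftrightarrow> (X @ Y) ! a < (X @ Y) ! b"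
    if "a < length X + length Y" "b < length X + length Y" for a b
    using L that by (simp add: order_iso_def)
  have "order_iso s X" unfolding order_iso_def
  proof (intro conjI allI impI)
    fix a b assume "a < length X" "b < length X"
    thus "(s ! a < s ! b) = (X ! a < X ! b)"
      using iso[of a b] assms(1) by (simp add: nth_append)
  qed (rule assms)
  moreover have "order_iso t Y" unfolding order_iso_def
  proof (intro conjI allI impI)
    fix a b assume "a < length Y" "b < length Y"
    thus "(t ! a < t ! b) = (Y ! a < Y ! b)"
      using iso[of "length X + a" "length X + b"] assms(1,2) by (simp add: nth_append)
  qed (rule assms)
  moreover have "b < a" if "a \<in> set s" "b \<in> set t" for a b
  proof -
    obtain i j where "i < length s" "a = s ! i" "j < length t" "b = t ! j"
      using \<open>a \<in> set s\<close> \<open>b \<in> set t\<close> by (auto simp: in_set_conv_nth)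
    thus ?thesis using iso[of "length X + j" i] assms by (simp add: nth_append)
  qed
  ultimately show ?R by blast
next
  assume R: ?R
  show ?L unfolding order_iso_def
  proof (intro conjI allI impI)
    fix a b assume ab: "a < length (X @ Y)" "b < length (X @ Y)"
    show "((s @ t) ! a < (s @ t) ! b) = ((X @ Y) ! a < (X @ Y) ! b)"
    proof (cases "a < length X")
      case a: True
      show ?thesis
      proof (cases "b < length X")
        case True
        thus ?thesis using a R assms(1) by (simp add: nth_append order_iso_def)
      next
        case False
        hence "Y ! (b - length X) < X ! a" "t ! (b - length X) < s ! a"
          using ab a R assms by auto
        thus ?thesis using a False assms(1) by (simp add: nth_append)
      qed
    next
      case a: False
      show ?thesis
      proof (cases "b < length X")
        case True
        hence "Y ! (a - length X) < X ! b" "t ! (a - length X) < s ! b"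
          using ab a R assms by auto
        thus ?thesis using a True assms(1) by (simp add: nth_append)
      next
        case False
        hence "a - length X < length Y" "b - length X < length Y" using ab a by auto
        thus ?thesis using a False R assms(1,2) by (simp add: nth_append order_iso_def)
      qed
    qed
  qed (simp add: assms)
qed

text \<open>
  The letters of \<open>X\<close> exceed those of \<open>s\<close>, so an occurrence of \<open>X @ s\<close> consists of an occurrence of
  \<open>X\<close> followed by an occurrence of \<open>s\<close> below it.
\<close>
lemma contains_pattern_append_iff:
  assumes ne: "X \<noteq> []" "s \<noteq> []" and Xs: "\<forall>a\<in>set X. \<forall>b\<in>set s. b < a"
  shows "contains_pattern w (X @ s) \<longleftrightarrow>
     (\<exists>u v. w = u @ v \<and> contains_pattern (filter (\<lambda>y. y < threshold X u) v) s)"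
proof
  assume "contains_pattern w (X @ s)"
  then obtain q where q: "subseq q w" "order_iso q (X @ s)" unfolding contains_pattern_iff by blast
  define q1 q2 where "q1 = take (length X) q" and "q2 = drop (length X) q"
  have len: "length q = length X + length s" using q(2) by (simp add: order_iso_def)
  hence l12: "length q1 = length X" "length q2 = length s" by (auto simp: q1_def q2_def)
  have "q = q1 @ q2" by (simp add: q1_def q2_def)
  hence iso: "order_iso q1 X" "order_iso q2 s" "\<forall>a\<in>set q1. \<forall>b\<in>set q2. b < a"
    using q(2) order_iso_append[OF l12 Xs] by auto
  obtain u v where uv: "w = u @ v" "subseq q1 u" "subseq q2 v"
    using q(1) \<open>q = q1 @ q2\<close> by (metis list_emb_appendD)
  have "y < threshold X u" if "y \<in> set q2" for y
  proof -
    have "filter (\<lambda>z. y < z) q1 = q1" using iso(3) that by (simp add: filter_id_conv)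
    hence "subseq q1 (filter (\<lambda>z. y < z) u)" using uv(2) by (metis subseq_filter)
    thus ?thesis unfolding less_threshold_iff[OF ne(1)] contains_pattern_iff using iso(1) by blast
  qed
  hence "filter (\<lambda>y. y < threshold X u) q2 = q2" by (simp add: filter_id_conv)
  hence "subseq q2 (filter (\<lambda>y. y < threshold X u) v)" using uv(3) by (metis subseq_filter)
  thus "\<exists>u v. w = u @ v \<and> contains_pattern (filter (\<lambda>y. y < threshold X u) v) s"
    unfolding contains_pattern_iff using uv(1) iso(2) by blast
next
  assume "\<exists>u v. w = u @ v \<and> contains_pattern (filter (\<lambda>y. y < threshold X u) v) s"
  then obtain u v q2 where uv: "w = u @ v" "subseq q2 (filter (\<lambda>y. y < threshold X u) v)" "order_iso q2 s"
    unfolding contains_pattern_iff by blast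
  have q2: "q2 \<noteq> []" using uv(3) ne(2) by (auto simp: order_iso_def)
  have "set q2 \<subseteq> set (filter (\<lambda>y. y < threshold X u) v)"
    using uv(2) by (auto simp: subseq_conv_nths dest: in_set_nthsD)
  moreover have "Max (set q2) \<in> set q2" using q2 by (intro Max_in) auto
  ultimately have "Max (set q2) < threshold X u" by auto
  then obtain q1 where q1: "subseq q1 (filter (\<lambda>z. Max (set q2) < z) u)" "order_iso q1 X"
    unfolding less_threshold_iff[OF ne(1)] contains_pattern_iff by blast
  have "set q1 \<subseteq> set (filter (\<lambda>z. Max (set q2) < z) u)"
    using q1(1) by (auto simp: subseq_conv_nths dest: in_set_nthsD)
  hence "Max (set q2) < a" if "a \<in> set q1" for a using that by auto
  hence "b < a" if "a \<in> set q1" "b \<in> set q2" for a b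
    using that by (meson List.finite_set Max_ge le_less_trans)
  hence "order_iso (q1 @ q2) (X @ s)"
    using order_iso_append[OF _ _ Xs, of q1 q2] q1(2) uv(3) by (auto simp: order_iso_def)
  moreover have "subseq q1 u" "subseq q2 v"
    using q1(1) uv(2) subseq_filter_left subseq_order.order_trans by blast+
  hence "subseq (q1 @ q2) w" unfolding uv(1) by (rule list_emb_append_mono)
  ultimately show "contains_pattern w (X @ s)" unfolding contains_pattern_iff by blast
qed

lemma threshold_mono:
  assumes "X \<noteq> []" "subseq u u'"
  shows "threshold X u \<le> threshold X u'"
proof (rule ccontr)
  assume "\<not> ?thesis"
  hence "threshold X u' < threshold X u" by simp
  hence "contains_pattern (filter (\<lambda>z. threshold X u' < z) u) X" by (simp add: less_threshold_iff[OF assms(1)])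
  moreover have "subseq (filter (\<lambda>z. threshold X u' < z) u) (filter (\<lambda>z. threshold X u' < z) u')"
    using assms(2) by simp
  ultimately show False using less_threshold_iff[OF assms(1), of "threshold X u'" u'] contains_pattern_subseq by blast
qed

text \<open>
  A word is scanned from the left.  A letter below the current threshold is inner, any other letter is
  outer, and only outer letters are recorded in \<open>u\<close>: an inner letter cannot take part in an
  occurrence of \<open>X\<close> that would raise the threshold, as such an occurrence lies above the threshold.
\<close>
fun scan_ok :: "(nat list \<Rightarrow> bool) \<Rightarrow> nat list \<Rightarrow> nat list \<Rightarrow> nat list \<Rightarrow> bool" where
  "scan_ok P X u [] \<longleftrightarrow> True"
| "scan_ok P X u (x # w) \<longleftrightarrow> P (filter (\<lambda>y. y < threshold X u) (x # w)) \<and>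
     scan_ok P X (if x < threshold X u then u else u @ [x]) w"

text \<open>
  A word is determined by its outer letters, with a mark \<open>None\<close> at each inner position, and by the list
  of its inner letters.  The thresholds at the inner positions are determined by the skeleton alone and
  increase, so they are the column heights of a board that the inner letters fill.
\<close>
fun skeleton :: "nat list \<Rightarrow> nat list \<Rightarrow> nat list \<Rightarrow> nat option list" where
  "skeleton X u [] = []"
| "skeleton X u (x # w) =
     (if x < threshold X u then None # skeleton X u w else Some x # skeleton X (u @ [x]) w)"

fun inner :: "nat list \<Rightarrow> nat list \<Rightarrow> nat list \<Rightarrow> nat list" where
  "inner X u [] = []"
| "inner X u (x # w) = (if x < threshold X u then x # inner X u w else inner X (u @ [x]) w)"

fun thresholds :: "nat list \<Rightarrow> nat list \<Rightarrow> nat option list \<Rightarrow> nat list" where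
  "thresholds X u [] = []"
| "thresholds X u (None # s) = threshold X u # thresholds X u s"
| "thresholds X u (Some x # s) = thresholds X (u @ [x]) s"

fun fill :: "nat option list \<Rightarrow> nat list \<Rightarrow> nat list" where
  "fill [] v = []"
| "fill (None # s) v = hd v # fill s (tl v)"
| "fill (Some x # s) v = x # fill s v"

text \<open>
  The skeletons of words are those in which every recorded letter really is outer.
\<close>
fun valid :: "nat list \<Rightarrow> nat list \<Rightarrow> nat option list \<Rightarrow> bool" where
  "valid X u [] \<longleftrightarrow> True"
| "valid X u (None # s) \<longleftrightarrow> valid X u s"
| "valid X u (Some x # s) \<longleftrightarrow> threshold X u \<le> x \<and> valid X (u @ [x]) s"

fun outer :: "nat option list \<Rightarrow> nat multiset" where
  "outer [] = {#}"
| "outer (None # s) = outer s"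
| "outer (Some x # s) = add_mset x (outer s)"

lemma sorted_thresholds: "X \<noteq> [] \<Longrightarrow> sorted (threshold X u # thresholds X u s)"
proof (induction s arbitrary: u)
  case (Cons a s)
  show ?case
  proof (cases a)
    case None
    thus ?thesis using Cons by simp
  next
    case (Some x)
    have "threshold X u \<le> threshold X (u @ [x])" by (rule threshold_mono) (use Cons.prems in auto)
    thus ?thesis using Cons.IH[OF Cons.prems, of "u @ [x]"] Some by auto
  qed
qed simp

lemma filter_inner:
  "X \<noteq> [] \<Longrightarrow> t \<le> threshold X u \<Longrightarrow> filter (\<lambda>y. y < t) (inner X u w) = filter (\<lambda>y. y < t) w"
proof (induction w arbitrary: u)
  case (Cons x w)
  have "threshold X u \<le> threshold X (u @ [x])" by (rule threshold_mono) (use Cons.prems in auto)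
  thus ?case using Cons by auto
qed simp

text \<open>
  At an outer position the condition on the remaining inner letters follows from the one at the next
  inner position, where the threshold is at least as large.
\<close>
lemma scan_ok_iff_fits:
  assumes "X \<noteq> []" "hereditary P"
  shows "scan_ok P X u w \<longleftrightarrow> fits P (thresholds X u (skeleton X u w)) (inner X u w)"
proof (induction w arbitrary: u)
  case (Cons x w)
  have f: "filter (\<lambda>y. y < threshold X u) (inner X u w) = filter (\<lambda>y. y < threshold X u) w" for u
    by (rule filter_inner) (use assms in auto)
  show ?case
  proof (cases "x < threshold X u")
    case True
    thus ?thesis using Cons by (simp add: f)
  next
    case False
    let ?u = "u @ [x]"
    have le: "threshold X u \<le> threshold X ?u" by (rule threshold_mono) (use assms in auto)
    have "P (filter (\<lambda>y. y < threshold X u) w)"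
      if "fits P (thresholds X ?u (skeleton X ?u w)) (inner X ?u w)"
    proof -
      have "sorted (threshold X u # thresholds X ?u (skeleton X ?u w))"
        using sorted_thresholds[OF assms(1), of ?u "skeleton X ?u w"] le by auto
      from fits_filter[OF assms(2) that this] show ?thesis
        using filter_inner[OF assms(1) le] by simp
    qed
    thus ?thesis using Cons False by auto
  qed
qed simp

text \<open>
  The invariant compares the full prefix \<open>p\<close> with its outer letters \<open>u\<close>: they have the same letters
  above every \<open>y\<close> that is at least the threshold, hence the same threshold.
\<close>
lemma scan_ok_iff_splits_aux:
  assumes "X \<noteq> []" "P []"
    and "subseq u p" "\<forall>y\<ge>threshold X u. filter (\<lambda>z. y < z) p = filter (\<lambda>z. y < z) u"
  shows "scan_ok P X u w \<longleftrightarrow> (\<forall>a b. w = a @ b \<longrightarrow> P (filter (\<lambda>y. y < threshold X (p @ a)) b))"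
  using assms(3,4)
proof (induction w arbitrary: u p)
  case Nil
  thus ?case using assms(2) by simp
next
  case (Cons x w)
  have thr: "threshold X p = threshold X u"
  proof (rule antisym)
    show "threshold X u \<le> threshold X p" by (rule threshold_mono[OF assms(1) Cons.prems(1)])
    have "\<not> threshold X u < threshold X p"
      using less_threshold_iff[OF assms(1)] Cons.prems(2) by (metis order_refl less_irrefl)
    thus "threshold X p \<le> threshold X u" by simp
  qed
  let ?u = "if x < threshold X u then u else u @ [x]"
  have le: "threshold X u \<le> threshold X (u @ [x])" by (rule threshold_mono) (use assms in auto)
  have "scan_ok P X ?u w \<longleftrightarrow> (\<forall>a b. w = a @ b \<longrightarrow> P (filter (\<lambda>y. y < threshold X ((p @ [x]) @ a)) b))"
  proof (rule Cons.IH)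
    show "subseq ?u (p @ [x])" using Cons.prems(1) by (auto intro: subseq_rev_drop_many)
    show "\<forall>y\<ge>threshold X ?u. filter (\<lambda>z. y < z) (p @ [x]) = filter (\<lambda>z. y < z) ?u"
      using Cons.prems(2) le by auto
  qed
  moreover have "(\<forall>a b. x # w = a @ b \<longrightarrow> Q a b) \<longleftrightarrow> Q [] (x # w) \<and> (\<forall>a b. w = a @ b \<longrightarrow> Q (x # a) b)" for Q
    by (auto simp: Cons_eq_append_conv)
  ultimately show ?case by (simp add: thr)
qed

lemma avoids_append_iff_scan_ok:
  assumes "X \<noteq> []" "s \<noteq> []" "\<forall>a\<in>set X. \<forall>b\<in>set s. b < a"
  shows "\<not> contains_pattern w (X @ s) \<longleftrightarrow> scan_ok (\<lambda>v. \<not> contains_pattern v s) X [] w"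
  using scan_ok_iff_splits_aux[OF assms(1), of "\<lambda>v. \<not> contains_pattern v s" "[]" "[]" w]
    contains_pattern_append_iff[OF assms, of w] assms(2) by auto

lemma fill_inner: "fill (skeleton X u w) (inner X u w) = w"
  by (induction w arbitrary: u) auto

lemma valid_skeleton: "valid X u (skeleton X u w)"
  by (induction w arbitrary: u) auto

lemma mset_inner_outer: "mset w = mset (inner X u w) + outer (skeleton X u w)"
  by (induction w arbitrary: u) auto

lemma skeleton_fill:
  "valid X u s \<Longrightarrow> fits P (thresholds X u s) v \<Longrightarrow>
     skeleton X u (fill s v) = s \<and> inner X u (fill s v) = v \<and> mset (fill s v) = mset v + outer s"
proof (induction s arbitrary: u v)
  case (Cons a s)
  show ?case
  proof (cases a)
    case None
    then obtain x v' where "v = x # v'" using Cons.prems by (cases v) auto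
    thus ?thesis using Cons None by auto
  next
    case (Some x)
    thus ?thesis using Cons by auto
  qed
qed simp

lemma card_scan_ok_fibre:
  assumes "X \<noteq> []" "hereditary P" "s \<in> skeleton X [] ` {w. mset w = M}"
  shows "card {w. mset w = M \<and> scan_ok P X [] w \<and> C (mset (inner X [] w)) \<and> skeleton X [] w = s}
       = (if C (M - outer s) then card {v. mset v = M - outer s \<and> fits P (thresholds X [] s) v} else 0)"
proof -
  let ?A = "{w. mset w = M \<and> scan_ok P X [] w \<and> C (mset (inner X [] w)) \<and> skeleton X [] w = s}"
  let ?B = "{v. mset v = M - outer s \<and> fits P (thresholds X [] s) v \<and> C (mset v)}"
  obtain w0 where w0: "mset w0 = M" "skeleton X [] w0 = s" using assms(3) by blast
  have val: "valid X [] s" using w0 valid_skeleton by metis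
  have sub: "outer s \<subseteq># M" using mset_inner_outer[of w0 X "[]"] w0 by simp
  have "bij_betw (inner X []) ?A ?B"
  proof (rule bij_betw_byWitness[where f' = "fill s"])
    show "\<forall>w\<in>?A. fill s (inner X [] w) = w" using fill_inner by auto
    show "\<forall>v\<in>?B. inner X [] (fill s v) = v" using skeleton_fill[OF val] by blast
    show "inner X [] ` ?A \<subseteq> ?B"
    proof
      fix v assume "v \<in> inner X [] ` ?A"
      then obtain w where w: "v = inner X [] w" "w \<in> ?A" by blast
      have "mset v = M - outer s" using mset_inner_outer[of w X "[]"] w by auto
      thus "v \<in> ?B" using w scan_ok_iff_fits[OF assms(1,2), of "[]" w] by auto
    qed
    show "fill s ` ?B \<subseteq> ?A"
    proof
      fix w assume "w \<in> fill s ` ?B"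
      then obtain v where v: "w = fill s v" "v \<in> ?B" by blast
      have f: "skeleton X [] w = s" "inner X [] w = v" "mset w = mset v + outer s"
        using skeleton_fill[OF val, of P v] v by auto
      thus "w \<in> ?A" using v sub scan_ok_iff_fits[OF assms(1,2), of "[]" w] by auto
    qed
  qed
  hence "card ?A = card ?B" by (rule bij_betw_same_card)
  moreover have "?B = (if C (M - outer s) then {v. mset v = M - outer s \<and> fits P (thresholds X [] s) v} else {})"
    by auto
  ultimately show ?thesis by simp
qed

text \<open>
  Words are grouped by their skeletons.  A skeleton fixes the outer letters, hence the board and the
  multiset of the inner letters; the predicate \<open>C\<close> selects skeletons by that multiset.
\<close>
theorem card_scan_ok_eq:
  assumes X: "X \<noteq> []" and her: "hereditary P" "hereditary Q"
    and eq: "\<And>ts V. sorted ts \<Longrightarrow> C V \<Longrightarrow>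
       card {v. mset v = V \<and> fits P ts v} = card {v. mset v = V \<and> fits Q ts v}"
  shows "card {w. mset w = M \<and> scan_ok P X [] w \<and> C (mset (inner X [] w))}
       = card {w. mset w = M \<and> scan_ok Q X [] w \<and> C (mset (inner X [] w))}"
proof -
  let ?K = "skeleton X [] ` {w. mset w = M}"
  let ?F = "\<lambda>P s. {w. mset w = M \<and> scan_ok P X [] w \<and> C (mset (inner X [] w)) \<and> skeleton X [] w = s}"
  have fin: "finite ?K" using finite_mset_fits[of M "\<lambda>_. True"] by simp
  have split: "card {w. mset w = M \<and> scan_ok P X [] w \<and> C (mset (inner X [] w))} = (\<Sum>s\<in>?K. card (?F P s))" for P
  proof -
    have "{w. mset w = M \<and> scan_ok P X [] w \<and> C (mset (inner X [] w))} = (\<Union>s\<in>?K. ?F P s)" by blast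
    moreover have "card (\<Union>s\<in>?K. ?F P s) = (\<Sum>s\<in>?K. card (?F P s))"
      by (rule card_UN_disjoint) (use fin in auto)
    ultimately show ?thesis by simp
  qed
  have "card (?F P s) = card (?F Q s)" if "s \<in> ?K" for s
  proof -
    have "sorted (thresholds X [] s)" using sorted_thresholds[OF X, of "[]" s] by simp
    thus ?thesis using eq card_scan_ok_fibre[OF X her(1) that] card_scan_ok_fibre[OF X her(2) that] by simp
  qed
  thus ?thesis unfolding split by (rule sum.cong[OF refl])
qed

section \<open>The patterns 123, 312 and 321 in fillings\<close>

text \<open>
  The \<open>q\<close>-analogue of the number \<open>m\<close>.
\<close>
definition geo :: "nat \<Rightarrow> int poly" where "geo m = (\<Sum>i<m. monom 1 i)"

lemma coeff_geo: "coeff (geo m) i = (if i < m then 1 else 0)"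
  by (simp add: geo_def coeff_sum)

lemma geo_0 [simp]: "geo 0 = 0" and geo_1 [simp]: "geo (Suc 0) = 1"
  by (simp_all add: geo_def)

lemma geo_add: "geo (a + b) = geo a + monom 1 a * geo b"
proof -
  have "geo (a + b) = (\<Sum>i<a. monom 1 i) + (\<Sum>i\<in>{a..<a+b}. monom 1 i)"
    unfolding geo_def by (simp add: sum.atLeastLessThan_concat lessThan_atLeast0)
  also have "(\<Sum>i\<in>{a..<a+b}. monom 1 i) = (\<Sum>i<b. monom 1 (i + a) :: int poly)"
    using sum.shift_bounds_nat_ivl[of "monom 1" 0 a b] by (simp add: lessThan_atLeast0 add.commute)
  also have "\<dots> = monom 1 a * geo b"
    by (simp add: geo_def sum_distrib_left mult_monom add.commute)
  finally show ?thesis by (simp add: geo_def)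
qed

lemma geo_Suc: "geo (Suc a) = 1 + monom 1 1 * geo a"
  using geo_add[of 1 a] by simp

lemma geo_prod: "geo (Suc a) * geo (Suc c) = geo (Suc (a + c)) + monom 1 1 * geo a * geo c"
proof (induction a)
  case 0
  show ?case by simp
next
  case (Suc a)
  have "geo (Suc (Suc a)) * geo (Suc c) = geo (Suc c) + monom 1 1 * (geo (Suc a) * geo (Suc c))"
    by (simp add: geo_Suc[of "Suc a"] algebra_simps)
  also have "\<dots> = 1 + monom 1 1 * geo c + monom 1 1 * geo (Suc (a + c)) + monom 1 1 * monom 1 1 * geo a * geo c"
    unfolding Suc unfolding geo_Suc[of c] by (simp add: algebra_simps)
  also have "\<dots> = geo (Suc (Suc a + c)) + monom 1 1 * (1 + monom 1 1 * geo a) * geo c"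
    by (simp add: geo_Suc[of "Suc (a + c)"] algebra_simps)
  finally show ?case by (simp add: geo_Suc[of a])
qed

definition block_poly :: "nat list \<Rightarrow> int poly" where
  "block_poly as = (\<Prod>a\<leftarrow>as. geo (Suc a))"

text \<open>
  The sum over \<open>i\<close> of the block polynomials that arise when the \<open>i\<close>-th of the blocks loses an element
  and all later blocks are merged.
\<close>
fun step_poly :: "nat list \<Rightarrow> int poly" where
  "step_poly [] = 0"
| "step_poly (a # as) = geo a * geo (Suc (sum_list as)) + geo (Suc a) * step_poly as"

text \<open>
  This identity carries the whole comparison: the sum over all possible steps depends on the sizes of
  the blocks only through the symmetric polynomial \<open>block_poly\<close> and the total size.
\<close>
lemma step_poly_eq:
  "monom 1 1 * step_poly as = (1 + monom 1 1) * block_poly as - geo (sum_list as + 2)"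
proof (induction as)
  case Nil
  show ?case by (simp add: block_poly_def numeral_2_eq_2 geo_Suc)
next
  case (Cons a as)
  let ?n = "sum_list as"
  have "monom 1 1 * step_poly (a # as)
      = monom 1 1 * geo a * geo (Suc ?n) + geo (Suc a) * (monom 1 1 * step_poly as)"
    by (simp add: algebra_simps)
  also have "\<dots> = monom 1 1 * geo a * geo (Suc ?n) - geo (Suc a) * geo (?n + 2)
       + (1 + monom 1 1) * block_poly (a # as)"
    unfolding Cons.IH by (simp add: algebra_simps block_poly_def)
  also have "geo (Suc a) * geo (?n + 2) = geo (a + ?n + 2) + monom 1 1 * geo a * geo (Suc ?n)"
    using geo_prod[of a "Suc ?n"] by simp
  finally show ?case by simp
qed

text \<open>
  The polynomial of all steps as a function of \<open>F = block_poly as\<close>.  Since \<open>F\<close> has constant term 1,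
  the constant multiple of \<open>geo\<close> in the identity above may be written with the factor \<open>coeff F 0\<close>;
  this makes the operator linear, so that it can be applied to sums of block polynomials.
\<close>
definition delta :: "nat \<Rightarrow> int poly \<Rightarrow> int poly" where
  "delta n F = poly_shift 1 ((1 + monom 1 1) * F - smult (coeff F 0) (geo (n + 2)))"

lemma delta_add: "delta n (F + H) = delta n F + delta n H"
  by (rule poly_eqI) (simp add: delta_def coeff_poly_shift algebra_simps smult_add_left)

lemma delta_0 [simp]: "delta n 0 = 0"
  by (simp add: delta_def)

lemma coeff_block_poly_0: "coeff (block_poly as) 0 = 1"
  by (induction as) (auto simp: block_poly_def coeff_mult coeff_geo)

lemma delta_block_poly: "delta (sum_list as) (block_poly as) = step_poly as"
proof -
  have "delta (sum_list as) (block_poly as) = poly_shift 1 (monom 1 1 * step_poly as)"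
    unfolding step_poly_eq delta_def coeff_block_poly_0 by simp
  also have "\<dots> = step_poly as"
    by (rule poly_eqI) (simp add: coeff_poly_shift coeff_monom_mult)
  finally show ?thesis .
qed

text \<open>
  The number of ways to complete a filling: \<open>U\<close> holds the rows that are not yet available, \<open>n\<close> is the
  number of available entries, and \<open>F\<close> is the block polynomial of the current state.  What matters
  is that the value is linear in \<open>F\<close> and knows nothing else about the state.
\<close>
fun fill_count :: "nat list \<Rightarrow> nat multiset \<Rightarrow> nat \<Rightarrow> int poly \<Rightarrow> int" where
  "fill_count [] U n F = (if U = {#} \<and> n = 0 then coeff F 0 else 0)"
| "fill_count (t # ts) U n F =
     (let W = filter_mset (\<lambda>y. y < t) U; m = n + size W in
      fill_count ts (filter_mset (\<lambda>y. \<not> y < t) U) (m - 1)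
        (delta m (F * (\<Prod>y\<in>set_mset W. geo (Suc (count W y))))))"

lemma fill_count_add: "fill_count ts U n (F + H) = fill_count ts U n F + fill_count ts U n H"
  by (induction ts arbitrary: U n F H) (simp_all add: Let_def distrib_right delta_add)

lemma fill_count_0 [simp]: "fill_count ts U n 0 = 0"
  by (induction ts arbitrary: U n) (simp_all add: Let_def)

lemma fill_count_sum: "fill_count ts U n (\<Sum>i\<in>I. f i) = (\<Sum>i\<in>I. fill_count ts U n (f i))"
  by (induction I rule: infinite_finite_induct) (simp_all add: fill_count_add)

text \<open>
  After each letter \<open>x\<close>, the letters on one side of it (those \<open>y\<close> with \<open>S x y\<close>) come in the order \<open>R\<close>.
  Suitable choices of \<open>R\<close> and \<open>S\<close> express avoidance of 123, of 321 and of 312.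
\<close>
fun tail_sorted :: "(nat \<Rightarrow> nat \<Rightarrow> bool) \<Rightarrow> (nat \<Rightarrow> nat \<Rightarrow> bool) \<Rightarrow> nat list \<Rightarrow> bool" where
  "tail_sorted R S [] \<longleftrightarrow> True"
| "tail_sorted R S (x # u) \<longleftrightarrow> sorted_wrt R (filter (S x) u) \<and> tail_sorted R S u"

lemma hereditary_tail_sorted: "hereditary (tail_sorted R S)"
proof -
  have "tail_sorted R S v \<longrightarrow> tail_sorted R S u" if "subseq u v" for u v
    using that
  proof (induction rule: list_emb.induct)
    case (list_emb_Cons2 x y xs ys)
    have "subseq (filter (S y) xs) (filter (S y) ys)" using list_emb_Cons2(2) by simp
    thus ?case using list_emb_Cons2 hereditary_sorted_wrt[of R] unfolding hereditary_def by auto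
  qed auto
  thus ?thesis by (auto simp: hereditary_def)
qed

text \<open>
  The block that loses \<open>x\<close> keeps its other entries, and the blocks behind it are merged into one.
  No empty block is appended if there are none behind it; for 312 the last block then remains the only
  one that may have several different letters.
\<close>
definition merge_step :: "nat multiset list \<Rightarrow> nat \<Rightarrow> nat \<Rightarrow> nat multiset list" where
  "merge_step bs i x = take i bs @ (bs ! i - {#x#}) #
     (if Suc i < length bs then [sum_list (drop (Suc i) bs)] else [])"

lemma sum_step_poly:
  "(\<Sum>i<length as. block_poly (take i as) * geo (as ! i) * geo (Suc (sum_list (drop (Suc i) as))))
     = step_poly as"
proof (induction as)
  case (Cons a as)
  show ?case
    by (simp add: sum.lessThan_Suc_shift Cons.IH[symmetric] block_poly_def sum_distrib_left
        mult.assoc del: sum.lessThan_Suc)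
qed (simp)

lemma size_sum_list:
  fixes bs :: "nat multiset list"
  shows "size (sum_list bs) = sum_list (map size bs)"
  by (induction bs) auto

lemma block_poly_merge_step:
  assumes "i < length bs" "x \<in># bs ! i"
  shows "block_poly (map size (merge_step bs i x)) =
     block_poly (take i (map size bs)) * geo (map size bs ! i) * geo (Suc (sum_list (drop (Suc i) (map size bs))))"
proof -
  have "Suc (size (bs ! i - {#x#})) = size (bs ! i)" using assms(2)
    by (metis insert_DiffM size_add_mset)
  moreover have "size (sum_list (drop (Suc i) bs)) = sum_list (drop (Suc i) (map size bs))"
    by (simp add: size_sum_list drop_map)
  moreover have "drop (Suc i) bs = []" if "\<not> Suc i < length bs" using that by simp
  ultimately show ?thesis using assms(1)
    by (auto simp: merge_step_def block_poly_def take_map drop_map mult.assoc)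
qed

text \<open>
  A filling is built column by column.  The available entries are divided into blocks; the entries of
  one block must be used in the order \<open>R\<close>, entries of different blocks are not yet related.  The next
  entry \<open>x\<close> is therefore the first one of some block.  Afterwards all entries on the side \<open>S\<close> of \<open>x\<close>
  must come in the order \<open>R\<close>, which merges the blocks behind that of \<open>x\<close>.  Rows that become available
  form new blocks, each with a single row.  The three choices of the orders belong to 123, 321 and 312,
  and in all of them the numbers of possibilities depend only on the block polynomial.
\<close>
locale chain_process =
  fixes R S :: "nat \<Rightarrow> nat \<Rightarrow> bool"
  assumes orders: "(R = (\<ge>) \<and> S = (<)) \<or> (R = (\<le>) \<and> S = (>)) \<or> (R = (\<ge>) \<and> S = (>))"
begin

lemma R_refl [simp]: "R x x" and S_irrefl [simp]: "\<not> S x x"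
  and R_total: "\<not> R x y \<Longrightarrow> R y x" and R_antisym: "R x y \<Longrightarrow> R y x \<Longrightarrow> x = y"
  and R_trans: "R x y \<Longrightarrow> R y z \<Longrightarrow> R x z"
  and S_total: "x \<noteq> y \<Longrightarrow> \<not> S x y \<Longrightarrow> S y x" and S_asym: "S x y \<Longrightarrow> \<not> S y x"
  using orders by auto

text \<open>
  Blocks are listed in the order \<open>S\<close>.  The last condition concerns 312, where \<open>R\<close> and \<open>S\<close> point in
  the same direction: there every block but the last consists of copies of one letter, so that using
  one of them leaves no entry of the same block on the side \<open>S\<close>.
\<close>
definition blocks_ok :: "nat \<Rightarrow> nat multiset list \<Rightarrow> bool" where
  "blocks_ok t bs \<longleftrightarrow> sorted_wrt (\<lambda>b c. \<forall>y\<in>#b. \<forall>z\<in>#c. S y z) bs \<and> (\<forall>b\<in>set bs. \<forall>y\<in>#b. y < t) \<and>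
     (\<forall>b\<in>set (butlast bs). \<forall>y\<in>#b. \<forall>z\<in>#b. R y z \<longrightarrow> \<not> S y z)"

definition state_words :: "nat list \<Rightarrow> nat multiset list \<Rightarrow> nat multiset \<Rightarrow> nat list set" where
  "state_words ts bs U = {v. mset v = sum_list bs + U \<and> fits (tail_sorted R S) ts v \<and>
     (\<forall>b\<in>set bs. sorted_wrt R (filter (\<lambda>y. y \<in># b) v))}"

lemma in_sum_list: "y \<in># sum_list bs \<longleftrightarrow> (\<exists>b\<in>set bs. y \<in># b)" for bs :: "nat multiset list"
  by (induction bs) auto

text \<open>
  The entries on the side \<open>S\<close> of \<open>x\<close> are those of the later blocks \<open>rs\<close>; if \<open>rs\<close> is empty, all of them
  belong to the block of \<open>x\<close>, which is sorted anyway.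
\<close>
lemma state_words_Cons_iff:
  assumes ok: "blocks_ok t (ls @ b # rs)" and U: "\<forall>z\<in>#U. t \<le> z" and ts: "sorted (t # ts)"
    and x: "x \<in># b" "\<forall>y\<in>#b. R x y"
  shows "x # v \<in> state_words (t # ts) (ls @ b # rs) U \<longleftrightarrow>
         v \<in> state_words ts (ls @ (b - {#x#}) # (if rs = [] then [] else [sum_list rs])) U"
    (is "_ \<longleftrightarrow> v \<in> state_words ts ?bs' U")
proof -
  have xt: "x < t" using ok x(1) by (auto simp: blocks_ok_def)
  have ls: "S y x" if "c \<in> set ls" "y \<in># c" for c y
    using ok that x(1) unfolding blocks_ok_def by (auto simp: sorted_wrt_append)
  have rs: "S x y" if "c \<in> set rs" "y \<in># c" for c y
    using ok that x(1) unfolding blocks_ok_def by (auto simp: sorted_wrt_append)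
  have lt: "y < t" if "c \<in> set rs" "y \<in># c" for c y
    using ok that unfolding blocks_ok_def by auto
  have b: "\<not> S x y" if "y \<in># b" "rs \<noteq> []" for y
    using ok that x unfolding blocks_ok_def by (auto simp: butlast_append)
  have msets: "mset (x # v) = sum_list (ls @ b # rs) + U \<longleftrightarrow> mset v = sum_list ?bs' + U"
  proof -
    obtain b' where b': "b = add_mset x b'" using x(1) by (meson multi_member_split)
    show ?thesis by (auto simp: b')
  qed
  show ?thesis
  proof (cases "mset v = sum_list ?bs' + U")
    case False
    thus ?thesis using msets by (simp add: state_words_def)
  next
    case mv: True
    have inv: "(\<exists>c\<in>set ls. y \<in># c) \<or> y \<in># b - {#x#} \<or> (\<exists>c\<in>set rs. y \<in># c) \<or> t \<le> y" if "y \<in> set v" for y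
    proof -
      have "y \<in># sum_list ?bs' + U" using that mv by (metis set_mset_mset)
      thus ?thesis using U by (auto simp: in_sum_list split: if_splits)
    qed
    have fb: "filter (\<lambda>y. y \<in># b) (x # v) = x # filter (\<lambda>y. y \<in># b - {#x#}) v"
    proof -
      have "y \<in># b - {#x#}" if "y \<in> set v" "y \<in># b" for y
      proof (cases "y = x")
        case True
        thus ?thesis using inv[OF that(1)] ls[of _ x] rs[of _ x] xt by auto
      next
        case False
        thus ?thesis using that(2) x(1) by (metis insertE insert_DiffM set_mset_add_mset_insert)
      qed
      thus ?thesis using x(1) by (auto intro!: filter_cong dest: in_diffD)
    qed
    have sb: "sorted_wrt R (filter (\<lambda>y. y \<in># b) (x # v)) \<longleftrightarrow> sorted_wrt R (filter (\<lambda>y. y \<in># b - {#x#}) v)"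
      unfolding fb using x(2) by (auto dest: in_diffD)
    have sl: "sorted_wrt R (filter (\<lambda>y. y \<in># c) (x # v)) \<longleftrightarrow> sorted_wrt R (filter (\<lambda>y. y \<in># c) v)"
      if "c \<in> set ls \<union> set rs" for c
      using that ls[of c x] rs[of c x] by auto
    \<comment> \<open>These are the entries that reading \<open>x\<close> newly forces into the order \<open>R\<close>.\<close>
    define T where "T = filter (S x) (filter (\<lambda>y. y < t) v)"
    have f: "fits (tail_sorted R S) (t # ts) (x # v) \<longleftrightarrow> sorted_wrt R T \<and> fits (tail_sorted R S) ts v"
      unfolding T_def using xt
      by (subst fits_Cons_iff[OF ts, where A = "\<lambda>u. sorted_wrt R (filter (S x) u)"])
         (auto simp: hereditary_tail_sorted)
    show ?thesis
    proof (cases "rs = []")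
      case True
      have "sorted_wrt R T" if "sorted_wrt R (filter (\<lambda>y. y \<in># b - {#x#}) v)"
      proof -
        have "z \<in># b - {#x#}" if "z \<in> set v" "S x z" "z < t" for z
          using inv[OF that(1)] that True ls[of _ z] S_asym[of x z] by auto
        hence "T = filter (\<lambda>y. S x y \<and> y < t) (filter (\<lambda>y. y \<in># b - {#x#}) v)"
          unfolding T_def filter_filter by (intro filter_cong) auto
        thus ?thesis using that sorted_wrt_filter by metis
      qed
      thus ?thesis using True msets mv f sb sl by (auto simp: state_words_def)
    next
      case False
      have "z \<in># sum_list rs" if "z \<in> set v" "S x z" "z < t" for z
        using inv[OF that(1)] that False ls[of _ z] S_asym[of x z] b[of z]
        by (auto simp: in_sum_list dest: in_diffD)
      hence T: "T = filter (\<lambda>y. y \<in># sum_list rs) v"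
        unfolding T_def filter_filter using rs lt by (intro filter_cong) (auto simp: in_sum_list)
      have "sorted_wrt R (filter (\<lambda>y. y \<in># c) v)" if "sorted_wrt R T" "c \<in> set rs" for c
      proof -
        have "filter (\<lambda>y. y \<in># c) v = filter (\<lambda>y. y \<in># c) T"
          unfolding T filter_filter using that(2) by (intro filter_cong) (auto simp: in_sum_list)
        thus ?thesis using that(1) sorted_wrt_filter by metis
      qed
      thus ?thesis using False msets mv f sb sl by (auto simp: state_words_def T)
    qed
  qed
qed

lemma ex_first: "b \<noteq> {#} \<Longrightarrow> \<exists>x. x \<in># b \<and> (\<forall>y\<in>#b. R x y)"
proof (induction b)
  case (add a b)
  show ?case
  proof (cases "b = {#}")
    case False
    then obtain x where x: "x \<in># b" "\<forall>y\<in>#b. R x y" using add by blast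
    show ?thesis using x R_total[of x a] R_trans[of a x] by (cases "R x a") (auto intro: exI[of _ x] exI[of _ a])
  qed auto
qed auto

definition first :: "nat multiset \<Rightarrow> nat" where
  "first b = (SOME x. x \<in># b \<and> (\<forall>y\<in>#b. R x y))"

lemma first: "b \<noteq> {#} \<Longrightarrow> first b \<in># b \<and> (\<forall>y\<in>#b. R (first b) y)"
  unfolding first_def using someI_ex[OF ex_first] .

lemma first_unique: "x \<in># b \<Longrightarrow> \<forall>y\<in>#b. R x y \<Longrightarrow> x = first b"
  by (metis R_antisym empty_iff first set_mset_empty)

lemma merge_step_append: "merge_step (ls @ b # rs) (length ls) x = ls @ (b - {#x#}) # (if rs = [] then [] else [sum_list rs])"
  by (auto simp: merge_step_def)

lemma state_words_step:
  assumes ok: "blocks_ok t bs" and U: "\<forall>z\<in>#U. t \<le> z" and ts: "sorted (t # ts)"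
  shows "state_words (t # ts) bs U =
    (\<Union>i\<in>{i. i < length bs \<and> bs ! i \<noteq> {#}}. (#) (first (bs ! i)) ` state_words ts (merge_step bs i (first (bs ! i))) U)"
    (is "_ = (\<Union>i\<in>?I. ?f i)")
proof (intro equalityI subsetI)
  fix w assume "w \<in> (\<Union>i\<in>?I. ?f i)"
  then obtain i v where i: "i < length bs" "bs ! i \<noteq> {#}" and w: "w = first (bs ! i) # v"
     "v \<in> state_words ts (merge_step bs i (first (bs ! i))) U" by auto
  have bs: "bs = take i bs @ bs ! i # drop (Suc i) bs" using i by (simp add: id_take_nth_drop)
  have "length (take i bs) = i" using i by simp
  thus "w \<in> state_words (t # ts) bs U"
    using state_words_Cons_iff[of t "take i bs" "bs ! i" "drop (Suc i) bs" U ts "first (bs ! i)" v]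
      merge_step_append[of "take i bs" "bs ! i" "drop (Suc i) bs"] first[OF i(2)] ok U ts w bs by simp
next
  fix w assume w: "w \<in> state_words (t # ts) bs U"
  then obtain x v where xv: "w = x # v" by (cases w) (auto simp: state_words_def)
  have "x < t" "mset (x # v) = sum_list bs + U" using w xv by (auto simp: state_words_def)
  hence "x \<in># sum_list bs" using U by (metis leD list.set_intros(1) set_mset_mset union_iff)
  then obtain i where i: "i < length bs" "x \<in># bs ! i" by (auto simp: in_sum_list in_set_conv_nth)
  have bs: "bs = take i bs @ bs ! i # drop (Suc i) bs" using i by (simp add: id_take_nth_drop)
  have len: "length (take i bs) = i" using i by simp
  have fx: "\<forall>y\<in>#bs ! i. R x y"
  proof
    fix y assume y: "y \<in># bs ! i"
    have "y = x \<or> y \<in> set v"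
    proof -
      have "y \<in># sum_list bs" using y i by (auto simp: in_sum_list)
      thus ?thesis using \<open>mset (x # v) = sum_list bs + U\<close> by (metis set_ConsD set_mset_mset union_iff)
    qed
    moreover have "sorted_wrt R (filter (\<lambda>y. y \<in># bs ! i) (x # v))"
      using w xv nth_mem[OF i(1)] unfolding state_words_def by blast
    ultimately show "R x y" using y i by auto
  qed
  have "x = first (bs ! i)" using first_unique i fx by blast
  moreover have "v \<in> state_words ts (merge_step bs i x) U"
    using state_words_Cons_iff[of t "take i bs" "bs ! i" "drop (Suc i) bs" U ts x v]
      merge_step_append[of "take i bs" "bs ! i" "drop (Suc i) bs"] i fx ok U ts w xv bs len by simp
  moreover have "i \<in> ?I" using i by auto
  ultimately show "w \<in> (\<Union>i\<in>?I. ?f i)" using xv by blast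
qed

lemma first_inj:
  assumes "blocks_ok t bs" "i < length bs" "j < length bs" "bs ! i \<noteq> {#}" "bs ! j \<noteq> {#}"
    "first (bs ! i) = first (bs ! j)"
  shows "i = j"
proof (rule ccontr)
  assume "i \<noteq> j"
  moreover have "S (first (bs ! i)) (first (bs ! j))" if "i < j" "j < length bs" "bs ! i \<noteq> {#}" "bs ! j \<noteq> {#}" for i j
    using assms(1) that first unfolding blocks_ok_def sorted_wrt_iff_nth_less by blast
  ultimately show False using assms S_irrefl by (metis linorder_neqE_nat)
qed

lemma sum_list_merge_step:
  assumes "i < length bs" "x \<in># bs ! i"
  shows "sum_list (merge_step bs i x) = sum_list bs - {#x#}"
proof -
  obtain b' where b': "bs ! i = add_mset x b'" using assms(2) by (meson multi_member_split)
  have "sum_list bs = sum_list (take i bs) + (bs ! i + sum_list (drop (Suc i) bs))"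
    using assms(1) by (metis id_take_nth_drop sum_list.append sum_list.Cons)
  thus ?thesis using assms by (auto simp: merge_step_def b')
qed

lemma blocks_ok_merge_step:
  assumes ok: "blocks_ok t bs" and i: "i < length bs"
  shows "blocks_ok t (merge_step bs i x)"
proof -
  define ls b rs where "ls = take i bs" and "b = bs ! i" and "rs = drop (Suc i) bs"
  have bs: "bs = ls @ b # rs" "length ls = i" using i by (auto simp: id_take_nth_drop ls_def b_def rs_def)
  have "merge_step bs i x = ls @ (b - {#x#}) # (if rs = [] then [] else [sum_list rs])"
    using merge_step_append[of ls b rs x] bs by simp
  moreover have sub: "y \<in># b" if "y \<in># b - {#x#}" for y using that by (rule in_diffD)
  have ok': "sorted_wrt (\<lambda>b c. \<forall>y\<in>#b. \<forall>z\<in>#c. S y z) (ls @ b # rs)"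
       "\<forall>c\<in>set (ls @ b # rs). \<forall>y\<in>#c. y < t"
       "\<forall>c\<in>set (butlast (ls @ b # rs)). \<forall>y\<in>#c. \<forall>z\<in>#c. R y z \<longrightarrow> \<not> S y z"
    using ok unfolding bs(1) blocks_ok_def by blast+
  have "sorted_wrt (\<lambda>b c. \<forall>y\<in>#b. \<forall>z\<in>#c. S y z) (ls @ (b - {#x#}) # (if rs = [] then [] else [sum_list rs]))"
    using ok'(1) by (auto simp: sorted_wrt_append in_sum_list dest: sub)
  moreover have "\<forall>c\<in>set (ls @ (b - {#x#}) # (if rs = [] then [] else [sum_list rs])). \<forall>y\<in>#c. y < t"
    using ok'(2) by (auto simp: in_sum_list dest: sub)
  moreover have "\<forall>c\<in>set (butlast (ls @ (b - {#x#}) # (if rs = [] then [] else [sum_list rs]))).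
       \<forall>y\<in>#c. \<forall>z\<in>#c. R y z \<longrightarrow> \<not> S y z"
  proof -
    have "\<not> S y z" if "c \<in> set ls \<or> c = b \<and> rs \<noteq> []" "y \<in># c" "z \<in># c" "R y z" for c y z
      using ok'(3) that by (auto simp: butlast_append)
    thus ?thesis by (auto simp: butlast_append dest: sub)
  qed
  ultimately show ?thesis unfolding blocks_ok_def by simp
qed

definition fresh_blocks :: "nat multiset \<Rightarrow> nat multiset list" where
  "fresh_blocks W = map (\<lambda>y. replicate_mset (count W y) y) (sorted_list_of_set (set_mset W))"

text \<open>
  New rows are above all available ones, so they come last if \<open>S\<close> is the increasing order and first
  otherwise.
\<close>
definition open_blocks :: "nat multiset list \<Rightarrow> nat multiset \<Rightarrow> nat multiset list" where
  "open_blocks bs W = (if S 0 1 then bs @ fresh_blocks W else rev (fresh_blocks W) @ bs)"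

lemma sum_list_fresh_blocks: "sum_list (fresh_blocks W) = W"
proof -
  have "sum_list (fresh_blocks W) = (\<Sum>y\<in>set_mset W. replicate_mset (count W y) y)"
    unfolding fresh_blocks_def by (subst sum_list_distinct_conv_sum_set) simp_all
  also have "\<dots> = W"
  proof (rule multiset_eqI)
    fix z
    have "count (\<Sum>y\<in>set_mset W. replicate_mset (count W y) y) z
        = (\<Sum>y\<in>set_mset W. if y = z then count W z else 0)"
      by (auto simp: count_sum intro: sum.cong)
    also have "\<dots> = count W z" by (auto simp: sum.delta not_in_iff)
    finally show "count (\<Sum>y\<in>set_mset W. replicate_mset (count W y) y) z = count W z" .
  qed
  finally show ?thesis .
qed

lemma sum_list_open_blocks: "sum_list (open_blocks bs W) = sum_list bs + W"
  by (simp add: open_blocks_def sum_list_fresh_blocks sum_list_rev add.commute)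

lemma block_poly_open_blocks:
  "block_poly (map size (open_blocks bs W)) =
     block_poly (map size bs) * (\<Prod>y\<in>set_mset W. geo (Suc (count W y)))"
proof -
  have "(\<Prod>b\<leftarrow>fresh_blocks W. geo (Suc (size b))) = (\<Prod>y\<in>set_mset W. geo (Suc (count W y)))"
    unfolding fresh_blocks_def by (simp add: o_def prod.distinct_set_conv_list[symmetric])
  moreover have "block_poly (map size (open_blocks bs W)) = (\<Prod>b\<leftarrow>bs @ fresh_blocks W. geo (Suc (size b)))"
    unfolding block_poly_def open_blocks_def prod_mset_prod_list[symmetric] by (simp add: o_def ac_simps)
  ultimately show ?thesis by (simp add: block_poly_def o_def)
qed

lemma blocks_ok_open:
  assumes ok: "blocks_ok t0 bs" and U: "\<forall>z\<in>#U. t0 \<le> z" and t: "t0 \<le> t"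
  shows "blocks_ok t (open_blocks bs (filter_mset (\<lambda>y. y < t) U))"
proof -
  let ?W = "filter_mset (\<lambda>y. y < t) U"
  have fr: "y \<in># U \<and> y < t" "y = z" if "b \<in> set (fresh_blocks ?W)" "y \<in># b" "z \<in># b" for b y z
    using that by (auto simp: fresh_blocks_def split: if_splits)
  have inc: "sorted_wrt (\<lambda>b c. \<forall>y\<in>#b. \<forall>z\<in>#c. y < z) (fresh_blocks ?W)"
    unfolding fresh_blocks_def sorted_wrt_map
    by (rule sorted_wrt_mono_rel[OF _ strict_sorted_list_of_set]) (auto split: if_splits)
  have lt: "y < z" if "b \<in> set bs" "y \<in># b" "c \<in> set (fresh_blocks ?W)" "z \<in># c" for b c y z
    using that ok U fr[of c z z] unfolding blocks_ok_def by (meson leD leI less_le_trans)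
  have S: "S = (<) \<and> R = (\<ge>) \<or> S = (>)" using orders by auto
  have bl: "b \<in> set (butlast bs) \<or> b \<in> set (fresh_blocks ?W)"
    if "b \<in> set (butlast (rev (fresh_blocks ?W) @ bs))" for b
    using that in_set_butlastD[of b "rev (fresh_blocks ?W)"] by (auto simp: butlast_append split: if_splits)
  have old: "\<forall>b\<in>set bs. \<forall>y\<in>#b. y < t" using ok t unfolding blocks_ok_def by (meson less_le_trans)
  from S show ?thesis
  proof
    assume "S = (<) \<and> R = (\<ge>)"
    thus ?thesis using ok inc lt fr(1) old unfolding blocks_ok_def open_blocks_def
      by (auto simp: sorted_wrt_append dest!: in_set_butlastD)
  next
    assume S: "S = (>)"
    have dec: "sorted_wrt (\<lambda>b c. \<forall>y\<in>#b. \<forall>z\<in>#c. S y z) (rev (fresh_blocks ?W))"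
      unfolding sorted_wrt_rev by (rule sorted_wrt_mono_rel[OF _ inc]) (auto simp: S)
    have "\<not> S 0 1" using S by simp
    hence "open_blocks bs ?W = rev (fresh_blocks ?W) @ bs" by (simp add: open_blocks_def)
    moreover have "\<forall>b\<in>set (butlast (rev (fresh_blocks ?W) @ bs)). \<forall>y\<in>#b. \<forall>z\<in>#b. R y z \<longrightarrow> \<not> S y z"
    proof (intro ballI impI)
      fix b y z assume b: "b \<in> set (butlast (rev (fresh_blocks ?W) @ bs))" "y \<in># b" "z \<in># b" "R y z"
      from bl[OF b(1)] show "\<not> S y z"
      proof
        assume "b \<in> set (butlast bs)"
        thus ?thesis using ok b unfolding blocks_ok_def by blast
      next
        assume "b \<in> set (fresh_blocks ?W)"
        hence "y = z" using fr(2) b by blast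
        thus ?thesis by simp
      qed
    qed
    moreover have "sorted_wrt (\<lambda>b c. \<forall>y\<in>#b. \<forall>z\<in>#c. S y z) (rev (fresh_blocks ?W) @ bs)"
      using ok dec lt unfolding blocks_ok_def by (auto simp: sorted_wrt_append S)
    ultimately show ?thesis using fr(1) old unfolding blocks_ok_def by auto
  qed
qed

lemma state_words_open:
  "state_words ts (open_blocks bs (filter_mset (\<lambda>y. y < t) U)) (filter_mset (\<lambda>y. \<not> y < t) U) = state_words ts bs U"
proof -
  let ?W = "filter_mset (\<lambda>y. y < t) U"
  have const: "sorted_wrt R u" if "\<forall>a\<in>set u. a = z" for u z
    using that by (induction u) auto
  have "sorted_wrt R (filter (\<lambda>y. y \<in># b) v)" if "b \<in> set (fresh_blocks ?W)" for b v
  proof -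
    obtain z n where b: "b = replicate_mset n z" using \<open>b \<in> _\<close> by (auto simp: fresh_blocks_def)
    show ?thesis by (rule const[of _ z]) (auto simp: b split: if_splits)
  qed
  moreover have "set (open_blocks bs ?W) = set bs \<union> set (fresh_blocks ?W)"
    by (auto simp: open_blocks_def)
  moreover have "sum_list bs + ?W + filter_mset (\<lambda>y. \<not> y < t) U = sum_list bs + U"
    by (simp add: add.assoc)
  ultimately show ?thesis unfolding state_words_def sum_list_open_blocks by auto
qed

lemma finite_state_words [simp]: "finite (state_words ts bs U)"
  unfolding state_words_def by simp

text \<open>
  The steps of a state have block polynomials whose sum is \<open>delta\<close> of the block polynomial of that
  state, and \<open>fill_count\<close> is linear.
\<close>
lemma card_state_words:
  assumes "blocks_ok t0 bs" "\<forall>z\<in>#U. t0 \<le> z" "sorted (t0 # ts)"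
  shows "int (card (state_words ts bs U)) = fill_count ts U (size (sum_list bs)) (block_poly (map size bs))"
  using assms
proof (induction ts arbitrary: t0 bs U)
  case Nil
  have eq: "state_words [] bs U = (if sum_list bs + U = {#} then {[]} else {})"
    by (auto simp: state_words_def)
  show ?case by (simp add: eq coeff_block_poly_0)
next
  case (Cons t ts)
  let ?W = "filter_mset (\<lambda>y. y < t) U" and ?U = "filter_mset (\<lambda>y. \<not> y < t) U"
  define cs where "cs = open_blocks bs ?W"
  let ?I = "{i. i < length cs \<and> cs ! i \<noteq> {#}}"
  let ?st = "\<lambda>i. merge_step cs i (first (cs ! i))"
  have ok: "blocks_ok t cs" unfolding cs_def 
    by (rule blocks_ok_open[OF Cons.prems(1,2)]) (use Cons.prems(3) in simp)
  have U: "\<forall>z\<in>#?U. t \<le> z" by auto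
  have st: "sorted (t # ts)" using Cons.prems by simp
  have "state_words (t # ts) bs U = state_words (t # ts) cs ?U"
    unfolding cs_def by (rule state_words_open[symmetric])
  hence "card (state_words (t # ts) bs U) = card (\<Union>i\<in>?I. (#) (first (cs ! i)) ` state_words ts (?st i) ?U)"
    using state_words_step[OF ok U st] by simp
  also have "\<dots> = (\<Sum>i\<in>?I. card ((#) (first (cs ! i)) ` state_words ts (?st i) ?U))"
  proof (rule card_UN_disjoint)
    show "\<forall>i\<in>?I. \<forall>j\<in>?I. i \<noteq> j \<longrightarrow> (#) (first (cs ! i)) ` state_words ts (?st i) ?U \<inter>
            (#) (first (cs ! j)) ` state_words ts (?st j) ?U = {}"
    proof (intro ballI impI)
      fix i j assume "i \<in> ?I" "j \<in> ?I" "i \<noteq> j"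
      hence "first (cs ! i) \<noteq> first (cs ! j)" using first_inj[OF ok, of i j] by blast
      thus "(#) (first (cs ! i)) ` state_words ts (?st i) ?U \<inter>
            (#) (first (cs ! j)) ` state_words ts (?st j) ?U = {}" by auto
    qed
  qed simp_all
  also have "\<dots> = (\<Sum>i\<in>?I. card (state_words ts (?st i) ?U))"
    by (rule sum.cong[OF refl]) (simp add: card_image)
  finally have "int (card (state_words (t # ts) bs U)) = (\<Sum>i\<in>?I. int (card (state_words ts (?st i) ?U)))"
    by simp
  also have "\<dots> = (\<Sum>i\<in>?I. fill_count ts ?U (size (sum_list cs) - 1) (block_poly (map size (?st i))))"
  proof (rule sum.cong[OF refl])
    fix i assume i: "i \<in> ?I"
    hence f: "first (cs ! i) \<in># cs ! i" using first by blast
    have "size (sum_list (?st i)) = size (sum_list cs) - 1"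
    proof -
      have "first (cs ! i) \<in># sum_list cs" using f i by (auto simp: in_sum_list)
      thus ?thesis using sum_list_merge_step[of i cs] f i by (simp add: size_Diff_singleton)
    qed
    thus "int (card (state_words ts (?st i) ?U))
        = fill_count ts ?U (size (sum_list cs) - 1) (block_poly (map size (?st i)))"
      using Cons.IH[OF blocks_ok_merge_step[OF ok] U st] i by simp
  qed
  also have "\<dots> = fill_count ts ?U (size (sum_list cs) - 1) (\<Sum>i\<in>?I. block_poly (map size (?st i)))"
    by (simp add: fill_count_sum)
  also have "(\<Sum>i\<in>?I. block_poly (map size (?st i))) = (\<Sum>i<length cs. block_poly (take i (map size cs))
       * geo (map size cs ! i) * geo (Suc (sum_list (drop (Suc i) (map size cs)))))"
  proof (rule sum.mono_neutral_cong_left)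
    show "\<forall>i\<in>{..<length cs} - ?I. block_poly (take i (map size cs))
       * geo (map size cs ! i) * geo (Suc (sum_list (drop (Suc i) (map size cs)))) = 0" by simp
    show "block_poly (map size (?st i)) = block_poly (take i (map size cs))
       * geo (map size cs ! i) * geo (Suc (sum_list (drop (Suc i) (map size cs))))" if "i \<in> ?I" for i
      using that first by (intro block_poly_merge_step) auto
  qed auto
  also have "\<dots> = step_poly (map size cs)" using sum_step_poly[of "map size cs"] by simp
  also have "\<dots> = delta (size (sum_list cs)) (block_poly (map size cs))"
    by (simp add: size_sum_list delta_block_poly)
  finally show ?case
    by (simp add: Let_def cs_def sum_list_open_blocks block_poly_open_blocks)
qed

lemma card_fits_tail_sorted:
  assumes "sorted ts"
  shows "int (card {v. mset v = V \<and> fits (tail_sorted R S) ts v}) = fill_count ts V 0 1"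
proof -
  have "blocks_ok 0 []" by (simp add: blocks_ok_def)
  from card_state_words[OF this, of V ts] show ?thesis
    using assms by (simp add: state_words_def block_poly_def)
qed

end

lemma card_fits_tail_sorted_eq:
  assumes "sorted ts"
  shows "card {v. mset v = V \<and> fits (tail_sorted (\<ge>) (<)) ts v} = card {v. mset v = V \<and> fits (tail_sorted (\<le>) (>)) ts v}"
    and "card {v. mset v = V \<and> fits (tail_sorted (\<ge>) (>)) ts v} = card {v. mset v = V \<and> fits (tail_sorted (\<le>) (>)) ts v}"
proof -
  have "chain_process (\<ge>) (<)" "chain_process (\<le>) (>)" "chain_process (\<ge>) (>)"
    by (unfold_locales, simp)+
  from this[THEN chain_process.card_fits_tail_sorted, OF assms, of V]
  show "card {v. mset v = V \<and> fits (tail_sorted (\<ge>) (<)) ts v} = card {v. mset v = V \<and> fits (tail_sorted (\<le>) (>)) ts v}"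
    and "card {v. mset v = V \<and> fits (tail_sorted (\<ge>) (>)) ts v} = card {v. mset v = V \<and> fits (tail_sorted (\<le>) (>)) ts v}"
    by linarith+
qed

section \<open>The patterns 132 and 213 in fillings\<close>

text \<open>
  For each \<open>j\<close>, the \<open>j\<close>-th smallest element of \<open>X\<close> is at most the \<open>j\<close>-th smallest element of \<open>M\<close>.
\<close>
definition dominates :: "nat set \<Rightarrow> nat set \<Rightarrow> bool" where
  "dominates X M \<longleftrightarrow> (\<forall>l. card (M \<inter> {..l}) \<le> card (X \<inter> {..l}))"

lemma card_rank_ge:
  fixes A :: "nat set"
  assumes "finite A"
  shows "card {c \<in> A. q \<le> card (A \<inter> {..c})} = card A - (q - 1)"
  using assms
proof (induction A rule: finite_linorder_max_induct)
  case (insert b A)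
  have b: "A \<inter> {..b} = A" "b \<notin> A" using insert(2) by auto
  have e1: "insert b A \<inter> {..b} = insert b A" using b by auto
  have e2: "insert b A \<inter> {..c} = A \<inter> {..c}" if "c \<in> A" for c using insert(2) that by auto
  have "{c \<in> insert b A. q \<le> card (insert b A \<inter> {..c})} =
     (if q \<le> card (insert b A) then {b} else {}) \<union> {c \<in> A. q \<le> card (A \<inter> {..c})}"
  proof (rule set_eqI)
    fix c
    consider "c = b" | "c \<noteq> b" "c \<in> A" | "c \<noteq> b" "c \<notin> A" by blast
    thus "c \<in> {c \<in> insert b A. q \<le> card (insert b A \<inter> {..c})} \<longleftrightarrow>
       c \<in> (if q \<le> card (insert b A) then {b} else {}) \<union> {c \<in> A. q \<le> card (A \<inter> {..c})}"
      by cases (simp_all add: e1 e2 b(2) del: Int_insert_left)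
  qed
  hence "{c \<in> insert b A. q \<le> card (insert b A \<inter> {..c})} =
     (if q \<le> Suc (card A) then {b} else {}) \<union> {c \<in> A. q \<le> card (A \<inter> {..c})}"
    using b insert(1) by simp
  also have "card \<dots> = (if q \<le> Suc (card A) then 1 else 0) + card {c \<in> A. q \<le> card (A \<inter> {..c})}"
    using b insert(1) by (subst card_Un_disjoint) auto
  also have "\<dots> = Suc (card A) - (q - 1)" using insert(3) by auto
  finally show ?case using b insert(1) by simp
qed simp

lemma dominates_Int_iff:
  assumes "finite X" "M \<subseteq> {..<h}"
  shows "dominates (X \<inter> {..<h}) M \<longleftrightarrow> dominates X M"
proof
  assume d: "dominates (X \<inter> {..<h}) M"
  show "dominates X M" unfolding dominates_def
  proof
    fix l
    have "card (M \<inter> {..l}) \<le> card (X \<inter> {..<h} \<inter> {..l})" using d by (simp add: dominates_def)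
    also have "\<dots> \<le> card (X \<inter> {..l})" using assms(1) by (intro card_mono) auto
    finally show "card (M \<inter> {..l}) \<le> card (X \<inter> {..l})" .
  qed
next
  assume d: "dominates X M"
  show "dominates (X \<inter> {..<h}) M" unfolding dominates_def
  proof
    fix l
    show "card (M \<inter> {..l}) \<le> card (X \<inter> {..<h} \<inter> {..l})"
    proof (cases "h = 0")
      case True
      thus ?thesis using assms(2) by auto
    next
      case False
      have "card (M \<inter> {..l}) = card (M \<inter> {..min l (h - 1)})"
        by (rule arg_cong[of _ _ card]) (use assms(2) False in auto)
      also have "\<dots> \<le> card (X \<inter> {..min l (h - 1)})" using d by (simp add: dominates_def)
      also have "X \<inter> {..min l (h - 1)} = X \<inter> {..<h} \<inter> {..l}" using False by auto
      finally show ?thesis .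
    qed
  qed
qed

lemma dominates_truncation_iff:
  assumes fin: "finite A" and c: "c \<in> A \<or> c = 0"
  shows "dominates (A \<inter> {..c}) M \<longleftrightarrow> dominates A M \<and> (\<forall>l. card (M \<inter> {..l}) \<le> card (A \<inter> {..c}))"
proof
  assume d: "dominates (A \<inter> {..c}) M"
  have "card (M \<inter> {..l}) \<le> card (A \<inter> {..l})" "card (M \<inter> {..l}) \<le> card (A \<inter> {..c})" for l
  proof -
    have "card (M \<inter> {..l}) \<le> card (A \<inter> {..c} \<inter> {..l})" using d by (simp add: dominates_def)
    moreover have "card (A \<inter> {..c} \<inter> {..l}) \<le> card (A \<inter> {..l})" "card (A \<inter> {..c} \<inter> {..l}) \<le> card (A \<inter> {..c})"
      using fin by (auto intro!: card_mono)
    ultimately show "card (M \<inter> {..l}) \<le> card (A \<inter> {..l})" "card (M \<inter> {..l}) \<le> card (A \<inter> {..c})" by auto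
  qed
  thus "dominates A M \<and> (\<forall>l. card (M \<inter> {..l}) \<le> card (A \<inter> {..c}))" by (simp add: dominates_def)
next
  assume d: "dominates A M \<and> (\<forall>l. card (M \<inter> {..l}) \<le> card (A \<inter> {..c}))"
  have "A \<inter> {..c} \<inter> {..l} = (if l \<le> c then A \<inter> {..l} else A \<inter> {..c})" for l by auto
  thus "dominates (A \<inter> {..c}) M" using d by (simp add: dominates_def)
qed

text \<open>
  Filling up \<open>M\<close> above \<open>c\<close> asks for many elements of \<open>K\<close>: since \<open>A\<close> misses \<open>h - card A\<close> of the
  numbers below \<open>h\<close>, the complement of \<open>M\<close> must have at least that many elements up to \<open>c\<close>.  Above \<open>c\<close>
  the domination of \<open>M\<close> by \<open>A\<close> then holds automatically.
\<close>
lemma dominates_refill_iff: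
  assumes K: "K \<subseteq> {1..<h - 1}" and M: "M \<subseteq> {1..<h}" and c: "c < h" "c \<notin> M"
  defines "A \<equiv> K \<union> ({h - 1} - {0})" and "L \<equiv> {..<h} - M"
  shows "dominates K (M \<inter> {..<c} \<union> {c + 1..<h - 1}) \<longleftrightarrow>
     dominates A M \<and> h \<le> card A + card (L \<inter> {..c})"
proof -
  let ?N = "M \<inter> {..<c} \<union> {c + 1..<h - 1}"
  have Kb: "1 \<le> k" "k < h - 1" if "k \<in> K" for k using that K by auto
  have Mb: "1 \<le> k" "k < h" if "k \<in> M" for k using that M by auto
  have fin: "finite K" "finite M" "finite A" using K M finite_subset unfolding A_def by auto
  have cardA: "card A = card K + (if h = 1 then 0 else 1)"
  proof -
    have "h - 1 \<notin> K" using K by auto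
    thus ?thesis using fin(1) c(1) by (auto simp: A_def)
  qed
  have cnt_split: "card (M \<inter> {..l}) + card (L \<inter> {..l}) = Suc l" if "l < h" for l
  proof -
    have "card (M \<inter> {..l} \<union> L \<inter> {..l}) = card (M \<inter> {..l}) + card (L \<inter> {..l})"
      using fin by (intro card_Un_disjoint) (auto simp: L_def)
    moreover have "M \<inter> {..l} \<union> L \<inter> {..l} = {..l}" using that M by (auto simp: L_def)
    ultimately show ?thesis by simp
  qed
  have AK: "A \<inter> {..l} = K \<inter> {..l}" if "l < h - 1" for l using that by (auto simp: A_def)
  have Aall: "A \<inter> {..l} = A" if "h - 1 \<le> l" for l using that Kb by (fastforce simp: A_def)
  have Mall: "M \<inter> {..l} = M" if "h - 1 \<le> l" for l using that Mb by fastforce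
  have Mc: "M \<inter> {..<c} = M \<inter> {..c}" using c(2) by (auto simp: order_le_less)
  have Kl: "card K \<le> card (K \<inter> {..l}) + (h - 2 - l)" for l
  proof -
    have "card K \<le> card (K \<inter> {..l} \<union> {l<..<h - 1})" using fin K by (intro card_mono) auto
    also have "\<dots> \<le> card (K \<inter> {..l}) + card {l<..<h - 1}" by (rule card_Un_le)
    finally show ?thesis by simp
  qed
  have Nl: "card (?N \<inter> {..l}) = card (M \<inter> {..<c}) + (min l (h - 2) - c)" if "c \<le> l" for l
  proof -
    have "?N \<inter> {..l} = M \<inter> {..<c} \<union> {c<..min l (h - 2)}" using that by auto
    moreover have "card (M \<inter> {..<c} \<union> {c<..min l (h - 2)}) = card (M \<inter> {..<c}) + card {c<..min l (h - 2)}"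
      by (rule card_Un_disjoint) auto
    ultimately show ?thesis by simp
  qed
  have Nlow: "?N \<inter> {..l} = M \<inter> {..l}" if "l < c" for l using that by auto
  show ?thesis
  proof
    assume d: "dominates K ?N"
    have low: "card (M \<inter> {..l}) \<le> card (K \<inter> {..l})" if "l < c" for l
      using d Nlow[OF that] unfolding dominates_def by metis
    have key: "h \<le> card A + card (L \<inter> {..c})"
    proof (cases "c = h - 1")
      case True
      have "card (?N \<inter> {..c}) \<le> card (K \<inter> {..c})" using d by (simp add: dominates_def)
      hence "card (M \<inter> {..c}) \<le> card K" using Nl[of c] Mc True fin
        by (auto intro: order_trans card_mono)
      thus ?thesis using cnt_split[of c] c True cardA by linarith
    next
      case False
      hence ch: "c \<le> h - 2" "2 \<le> h" using c by auto
      have "card (?N \<inter> {..h - 2}) \<le> card (K \<inter> {..h - 2})" using d by (simp add: dominates_def)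
      also have "\<dots> \<le> card K" using fin by (intro card_mono) auto
      finally have "card (M \<inter> {..c}) + (h - 2 - c) \<le> card K" using Nl[OF ch(1)] Mc by simp
      thus ?thesis using cnt_split[OF c(1)] cardA ch by auto
    qed
    have "card (M \<inter> {..l}) \<le> card (A \<inter> {..l})" for l
    proof (cases "l < c")
      case True
      thus ?thesis using low AK[of l] c(1) by simp
    next
      case False
      have mono: "card (L \<inter> {..c}) \<le> card (L \<inter> {..l})" using False by (intro card_mono) (auto simp: L_def)
      show ?thesis
      proof (cases "l < h - 1")
        case True
        have "card A = card K + 1" "l < h" using cardA True by auto
        hence "card (M \<inter> {..l}) \<le> card (K \<inter> {..l})"
          using cnt_split[of l] True mono key Kl[of l] by linarith
        thus ?thesis using AK[OF True] by simp
      next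
        case l: False
        have "card (L \<inter> {..c}) \<le> card (L \<inter> {..h - 1})"
          using c(1) by (intro card_mono) (auto simp: L_def)
        hence "card M \<le> card A" using cnt_split[of "h - 1"] Mall[of "h - 1"] key c(1) by auto
        thus ?thesis using Mall[of l] Aall[of l] l by simp
      qed
    qed
    thus "dominates A M \<and> h \<le> card A + card (L \<inter> {..c})" using key by (simp add: dominates_def)
  next
    assume d: "dominates A M \<and> h \<le> card A + card (L \<inter> {..c})"
    have low: "card (M \<inter> {..l}) \<le> card (K \<inter> {..l})" if "l < h - 1" for l
      using d AK[OF that] unfolding dominates_def by metis
    have "card (?N \<inter> {..l}) \<le> card (K \<inter> {..l})" for l
    proof (cases "l < c")
      case True
      thus ?thesis using low[of l] Nlow[OF True] c(1) by simp
    next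
      case False
      show ?thesis
      proof (cases "c = h - 1")
        case True
        have "card (?N \<inter> {..l}) = card (M \<inter> {..<c})" using Nl[of l] False True by simp
        also have "\<dots> \<le> card (K \<inter> {..l})"
        proof (cases "c = 0")
          case c0: False
          hence "M \<inter> {..<c} = M \<inter> {..h - 2}" using True by auto
          hence "card (M \<inter> {..<c}) \<le> card (K \<inter> {..h - 2})" using low[of "h - 2"] c0 True by simp
          also have "\<dots> \<le> card (K \<inter> {..l})" using fin False True by (intro card_mono) auto
          finally show ?thesis .
        qed simp
        finally show ?thesis .
      next
        case ch: False
        let ?l = "min l (h - 2)"
        have "card (?N \<inter> {..l}) = card (M \<inter> {..c}) + (?l - c)" using Nl[of l] False Mc by simp
        also have "\<dots> \<le> card (K \<inter> {..?l})"
        proof -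
          have "card A = card K + 1" "?l < h - 1" "c \<le> ?l" using cardA ch c(1) False by auto
          moreover have "?l - c + (h - 2 - ?l) = h - 2 - c" "c \<le> h - 2" using calculation by auto
          ultimately show ?thesis using cnt_split[OF c(1)] d Kl[of ?l] by linarith
        qed
        also have "\<dots> \<le> card (K \<inter> {..l})" using fin by (intro card_mono) auto
        finally show ?thesis .
      qed
    qed
    thus "dominates K ?N" by (simp add: dominates_def)
  qed
qed

text \<open>
  On the left the admissible \<open>c\<close> are all but the first \<open>card M\<close> elements of \<open>{0} \<union> A\<close>, where \<open>A\<close>
  is \<open>K\<close> together with \<open>h - 1\<close>; on the right they are all but the first \<open>h - 1 - card A\<close> elements of the complement of \<open>M\<close>.  Both
  numbers are \<open>card A + 1 - card M\<close> if \<open>A\<close> dominates \<open>M\<close>, and 0 otherwise.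
\<close>
lemma card_dominates_eq:
  assumes K: "K \<subseteq> {1..<h - 1}" and M: "M \<subseteq> {1..<h}" and h: "h > 0"
  shows "card {c. c < h \<and> (c = 0 \<or> c = h - 1 \<or> c \<in> K) \<and> dominates (K \<inter> {..<c} \<union> ({c} - {0})) M}
       = card {c. c < h \<and> c \<notin> M \<and> dominates K (M \<inter> {..<c} \<union> {c + 1..<h - 1})}"
proof -
  have Kb: "1 \<le> k" "k < h - 1" if "k \<in> K" for k using that K by auto
  have Mb: "1 \<le> k" "k < h" if "k \<in> M" for k using that M by auto
  define A where "A = K \<union> ({h - 1} - {0})"
  define L where "L = {..<h} - M"
  have fin: "finite K" "finite M" "finite A" using K M finite_subset[OF _ finite_atLeastLessThan] unfolding A_def by auto
  have A: "A \<subseteq> {1..<h}" using Kb h by (fastforce simp: A_def)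
  have cardL: "card L = h - card M" unfolding L_def using M fin by (subst card_Diff_subset) auto
  have Mh: "card M < h" using card_mono[OF _ M] h by simp
  have Ah: "card A < h" using card_mono[OF _ A] h by simp
  have M': "card (M \<inter> {..l}) \<le> card M" for l using fin by (intro card_mono) auto
  have M'': "card (M \<inter> {..h}) = card M" using M by (intro arg_cong[of _ _ card]) auto
  have "{c. c < h \<and> (c = 0 \<or> c = h - 1 \<or> c \<in> K) \<and> dominates (K \<inter> {..<c} \<union> ({c} - {0})) M}
      = {c \<in> insert 0 A. dominates A M \<and> Suc (card M) \<le> card (insert 0 A \<inter> {..c})}" (is "?lhs = ?lhs'")
  proof (rule set_eqI)
    fix c
    have 1: "c < h \<and> (c = 0 \<or> c = h - 1 \<or> c \<in> K) \<longleftrightarrow> c \<in> insert 0 A"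
      using Kb h by (fastforce simp: A_def)
    have 2: "dominates (K \<inter> {..<c} \<union> ({c} - {0})) M \<longleftrightarrow> dominates A M \<and> Suc (card M) \<le> card (insert 0 A \<inter> {..c})"
      if c: "c \<in> insert 0 A"
    proof -
      have eq: "K \<inter> {..<c} \<union> ({c} - {0}) = A \<inter> {..c}"
        using c Kb by (fastforce simp: A_def)
      have "insert 0 A \<inter> {..c} = insert 0 (A \<inter> {..c})" by auto
      moreover have "0 \<notin> A" using A by auto
      ultimately have "card (insert 0 A \<inter> {..c}) = Suc (card (A \<inter> {..c}))" using fin by simp
      moreover have "(\<forall>l. card (M \<inter> {..l}) \<le> card (A \<inter> {..c})) \<longleftrightarrow> card M \<le> card (A \<inter> {..c})"
        using M' M'' le_trans by metis
      ultimately show ?thesis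
        unfolding eq using dominates_truncation_iff[OF fin(3), of c M] c by auto
    qed
    show "c \<in> ?lhs \<longleftrightarrow> c \<in> ?lhs'"
    proof (cases "c \<in> insert 0 A")
      case True
      thus ?thesis unfolding mem_Collect_eq using 1 2[OF True] by blast
    next
      case False
      thus ?thesis unfolding mem_Collect_eq using 1 by blast
    qed
  qed
  note lhs = this
  have rhs: "{c. c < h \<and> c \<notin> M \<and> dominates K (M \<inter> {..<c} \<union> {c + 1..<h - 1})}
      = {c \<in> L. dominates A M \<and> h - card A \<le> card (L \<inter> {..c})}"
    using dominates_refill_iff[OF K M] unfolding A_def[symmetric] L_def[symmetric]
    by (auto simp: L_def)
  have "card {c \<in> insert 0 A. Suc (card M) \<le> card (insert 0 A \<inter> {..c})}
      = card {c \<in> L. h - card A \<le> card (L \<inter> {..c})}" if d: "dominates A M"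
  proof -
    have "card (M \<inter> {..h}) \<le> card (A \<inter> {..h})" using d by (simp add: dominates_def)
    also have "\<dots> \<le> card A" using fin by (intro card_mono) auto
    finally have "card M \<le> card A" using M'' by simp
    moreover have "0 \<notin> A" using A by auto
    ultimately show ?thesis using card_rank_ge[of "insert 0 A" "Suc (card M)"] card_rank_ge[of L "h - card A"]
       fin cardL Mh Ah by (simp add: L_def)
  qed
  thus ?thesis unfolding lhs rhs by (cases "dominates A M") (simp_all del: insert_iff)
qed

text \<open>
  Fillings that avoid 132, counted by rank.  Among \<open>h\<close> available entries, the set \<open>M\<close> contains the
  ranks (from 0) of those that have to wait for the entry just below them.  Using the entry of rank \<open>c\<close>
  makes all higher ones come in increasing order; the ranks above \<open>c\<close> drop by one, and rank \<open>c\<close> now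
  belongs to the lowest of the higher entries, which does not have to wait.
\<close>
fun ascending_count :: "nat list \<Rightarrow> nat multiset \<Rightarrow> nat \<Rightarrow> nat set \<Rightarrow> nat" where
  "ascending_count [] U h M = (if U = {#} \<and> h = 0 then 1 else 0)"
| "ascending_count (t # ts) U h M = (let h' = h + size (filter_mset (\<lambda>y. y < t) U) in
     \<Sum>c\<in>{c. c < h' \<and> c \<notin> M}.
       ascending_count ts (filter_mset (\<lambda>y. \<not> y < t) U) (h' - 1) (M \<inter> {..<c} \<union> {c + 1..<h' - 1}))"

text \<open>
  Fillings that avoid 213, counted by rank.  A cut at \<open>c\<close> means that all available entries of rank at
  least \<open>c\<close> are used before all others.  After the entry of rank \<open>c\<close> has been used, the remaining filling
  must have a cut at \<open>c\<close>, unless all remaining entries are on one side.  With this entry in front the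
  cuts are those below \<open>c\<close>, and \<open>c\<close> itself unless it is 0.  The intersection with \<open>{..<h}\<close> forgets the
  cuts that separate new rows from each other or from the old ones.
\<close>
fun cut_count :: "nat list \<Rightarrow> nat multiset \<Rightarrow> nat \<Rightarrow> nat set \<Rightarrow> nat" where
  "cut_count [] U h K = (if U = {#} \<and> h = 0 \<and> K = {} then 1 else 0)"
| "cut_count (t # ts) U h K = (let h' = h + size (filter_mset (\<lambda>y. y < t) U) in
     \<Sum>c<h'. \<Sum>K'\<in>{K'\<in>Pow {1..<h' - 1}. (c = 0 \<or> c = h' - 1 \<or> c \<in> K') \<and>
                        (K' \<inter> {..<c} \<union> ({c} - {0})) \<inter> {..<h} = K}.
       cut_count ts (filter_mset (\<lambda>y. \<not> y < t) U) (h' - 1) K')"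

lemma sum_filter_count:
  fixes b :: "'b \<Rightarrow> nat"
  assumes "finite C" "finite T"
  shows "(\<Sum>c\<in>C. \<Sum>k\<in>{k\<in>T. Q c k}. b k) = (\<Sum>k\<in>T. card {c\<in>C. Q c k} * b k)"
proof -
  have "(\<Sum>c\<in>C. \<Sum>k\<in>{k\<in>T. Q c k}. b k) = (\<Sum>c\<in>C. \<Sum>k\<in>T. if Q c k then b k else 0)"
    using assms by (simp add: sum.inter_filter)
  also have "\<dots> = (\<Sum>k\<in>T. \<Sum>c\<in>C. if Q c k then b k else 0)" by (rule sum.swap)
  also have "\<dots> = (\<Sum>k\<in>T. \<Sum>c\<in>{c\<in>C. Q c k}. b k)"
    by (rule sum.cong[OF refl], rule sum.inter_filter[symmetric], rule assms)
  finally show ?thesis by simp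
qed

lemma sum_over_fibres:
  assumes "finite D" "finite T"
  shows "(\<Sum>K\<in>D. \<Sum>k\<in>{k\<in>T. Q k \<and> g k = K}. b k) = (\<Sum>k\<in>{k\<in>T. Q k \<and> g k \<in> D}. b k)"
proof -
  let ?S = "{k\<in>T. Q k \<and> g k \<in> D}"
  have "(\<Sum>k\<in>?S. b k) = (\<Sum>K\<in>D. \<Sum>k\<in>{k\<in>?S. g k = K}. b k)"
    by (rule sum.group[symmetric]) (use assms in auto)
  also have "\<dots> = (\<Sum>K\<in>D. \<Sum>k\<in>{k\<in>T. Q k \<and> g k = K}. b k)"
  proof (rule sum.cong[OF refl])
    fix K assume "K \<in> D"
    hence "{k\<in>?S. g k = K} = {k\<in>T. Q k \<and> g k = K}" by blast
    thus "(\<Sum>k\<in>{k\<in>?S. g k = K}. b k) = (\<Sum>k\<in>{k\<in>T. Q k \<and> g k = K}. b k)" by simp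
  qed
  finally show ?thesis by simp
qed

text \<open>
  The two ways of counting run in opposite directions, one constraining the future and the other
  observing it.  The 132-avoiding fillings with waiting set \<open>M\<close> are as many as the 213-avoiding fillings
  whose set of cuts dominates \<open>M\<close>; with \<open>M\<close> empty the latter is no condition.
\<close>
lemma ascending_count_eq_sum_cut_count:
  "M \<subseteq> {1..<h} \<Longrightarrow> ascending_count ts U h M = (\<Sum>K\<in>{K\<in>Pow {1..<h}. dominates K M}. cut_count ts U h K)"
proof (induction ts arbitrary: U h M)
  case Nil
  show ?case
  proof (cases "U = {#} \<and> h = 0")
    case True
    hence "{K \<in> Pow {1..<h}. dominates K M} = {{}}" using Nil by (auto simp: dominates_def)
    thus ?thesis using True by simp
  qed auto
next
  case (Cons t ts)
  let ?U = "filter_mset (\<lambda>y. \<not> y < t) U"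
  define h' where "h' = h + size (filter_mset (\<lambda>y. y < t) U)"
  let ?T = "Pow {1..<h' - 1}" and ?D = "{K\<in>Pow {1..<h}. dominates K M}"
  let ?b = "cut_count ts ?U (h' - 1)"
  let ?N = "\<lambda>c. M \<inter> {..<c} \<union> {c + 1..<h' - 1}"
  let ?g = "\<lambda>c K'. (K' \<inter> {..<c} \<union> ({c} - {0})) \<inter> {..<h}"
  let ?ok = "\<lambda>c K'. c = 0 \<or> c = h' - 1 \<or> c \<in> K'"
  have M: "M \<subseteq> {1..<h'}" using Cons.prems by (auto simp: h'_def)
  have Mh: "M \<subseteq> {..<h}" using Cons.prems by auto
  have "ascending_count (t # ts) U h M = (\<Sum>c\<in>{c. c < h' \<and> c \<notin> M}. ascending_count ts ?U (h' - 1) (?N c))"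
    by (simp add: Let_def h'_def)
  also have "\<dots> = (\<Sum>c\<in>{c. c < h' \<and> c \<notin> M}. \<Sum>K\<in>{K\<in>?T. dominates K (?N c)}. ?b K)"
  proof (rule sum.cong[OF refl])
    fix c assume "c \<in> {c. c < h' \<and> c \<notin> M}"
    hence "?N c \<subseteq> {1..<h' - 1}" using M by fastforce
    thus "ascending_count ts ?U (h' - 1) (?N c) = (\<Sum>K\<in>{K\<in>?T. dominates K (?N c)}. ?b K)" by (rule Cons.IH)
  qed
  also have "\<dots> = (\<Sum>K\<in>?T. card {c \<in> {c. c < h' \<and> c \<notin> M}. dominates K (?N c)} * ?b K)"
    by (rule sum_filter_count) auto
  \<comment> \<open>The comparison of the two processes is pointwise in the set of cuts of the remaining filling.\<close>
  also have "\<dots> = (\<Sum>K\<in>?T. card {c \<in> {..<h'}. ?ok c K \<and> ?g c K \<in> ?D} * ?b K)"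
  proof (rule sum.cong[OF refl])
    fix K assume K: "K \<in> ?T"
    have "?g c K \<in> ?D \<longleftrightarrow> dominates (K \<inter> {..<c} \<union> ({c} - {0})) M" for c
    proof -
      have "finite (K \<inter> {..<c} \<union> ({c} - {0}))" by simp
      moreover have "?g c K \<subseteq> {1..<h}" using K by fastforce
      ultimately show ?thesis by (simp only: dominates_Int_iff[OF _ Mh] mem_Collect_eq Pow_iff simp_thms)
    qed
    hence "{c \<in> {..<h'}. ?ok c K \<and> ?g c K \<in> ?D} =
        {c. c < h' \<and> ?ok c K \<and> dominates (K \<inter> {..<c} \<union> ({c} - {0})) M}" by auto
    moreover have "{c \<in> {c. c < h' \<and> c \<notin> M}. dominates K (?N c)} = {c. c < h' \<and> c \<notin> M \<and> dominates K (?N c)}"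
      by auto
    moreover have "h' = 0 \<Longrightarrow> {c. c < h' \<and> Q c} = {}" for Q by auto
    ultimately show "card {c \<in> {c. c < h' \<and> c \<notin> M}. dominates K (?N c)} * ?b K
        = card {c \<in> {..<h'}. ?ok c K \<and> ?g c K \<in> ?D} * ?b K"
      using card_dominates_eq[of K h' M] K M by (cases "h' = 0") auto
  qed
  also have "\<dots> = (\<Sum>c<h'. \<Sum>K'\<in>{K'\<in>?T. ?ok c K' \<and> ?g c K' \<in> ?D}. ?b K')"
    by (rule sum_filter_count[symmetric]) auto
  also have "\<dots> = (\<Sum>c<h'. \<Sum>K\<in>?D. \<Sum>K'\<in>{K'\<in>?T. ?ok c K' \<and> ?g c K' = K}. ?b K')"
    by (rule sum.cong[OF refl], rule sum_over_fibres[symmetric]) auto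
  also have "\<dots> = (\<Sum>K\<in>?D. \<Sum>c<h'. \<Sum>K'\<in>{K'\<in>?T. ?ok c K' \<and> ?g c K' = K}. ?b K')"
    by (rule sum.swap)
  also have "\<dots> = (\<Sum>K\<in>?D. cut_count (t # ts) U h K)"
    by (rule sum.cong[OF refl]) (simp add: Let_def h'_def)
  finally show ?case .
qed

lemma subseq2_Cons: "subseq [a, b] (x # v) \<longleftrightarrow> x = a \<and> b \<in> set v \<or> subseq [a, b] v"
  by (auto simp: subseq_singleton_left dest: subseq_Cons')

lemma subseq2_set: "subseq [a, b] v \<Longrightarrow> a \<in> set v \<and> b \<in> set v"
  by (metis in_set_nthsD list.set_intros subseq_conv_nths)

lemma sorted_wrt_iff_subseq2: "sorted_wrt R v \<longleftrightarrow> (\<forall>a b. subseq [a, b] v \<longrightarrow> R a b)"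
  by (induction v) (auto simp: subseq2_Cons simp del: list_emb_code(3) subseq_Cons2_iff)

lemma subseq2_filter: "subseq [a, b] (filter Q v) \<longleftrightarrow> subseq [a, b] v \<and> Q a \<and> Q b"
  by (induction v) (auto simp: subseq2_Cons simp del: list_emb_code(3) subseq_Cons2_iff dest: subseq2_set)

definition delete_nth :: "nat \<Rightarrow> 'a list \<Rightarrow> 'a list" where
  "delete_nth c os = take c os @ drop (Suc c) os"

lemma length_delete_nth: "c < length os \<Longrightarrow> length (delete_nth c os) = length os - 1"
  by (simp add: delete_nth_def)

lemma nth_delete_nth: "c < length os \<Longrightarrow> i < length os - 1 \<Longrightarrow> delete_nth c os ! i = (if i < c then os ! i else os ! Suc i)"
  by (auto simp: delete_nth_def nth_append)

lemma mset_delete_nth: "c < length os \<Longrightarrow> mset (delete_nth c os) = mset os - {#os ! c#}"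
proof -
  assume "c < length os"
  hence "mset os = mset (take c os @ os ! c # drop (Suc c) os)" by (simp add: id_take_nth_drop[symmetric])
  thus ?thesis by (simp add: delete_nth_def)
qed

lemma sorted_delete_nth:
  assumes "sorted_wrt (<) os" "c < length os"
  shows "sorted_wrt (<) (delete_nth c os)"
proof -
  have "sorted_wrt (<) (take c os @ os ! c # drop (Suc c) os)"
    using assms by (simp add: id_take_nth_drop[symmetric])
  thus ?thesis by (simp add: delete_nth_def sorted_wrt_append)
qed

lemma set_delete_nth_subset: "set (delete_nth c os) \<subseteq> set os"
  unfolding delete_nth_def using set_take_subset set_drop_subset by fastforce

lemma card_first_letter:
  fixes os :: "nat list"
  assumes os: "distinct os" and U: "\<forall>z\<in>#U. t \<le> z"
    and Q: "\<And>w. Q w \<Longrightarrow> w \<noteq> [] \<and> hd w < t"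
  shows "card {w. mset w = mset os + U \<and> Q w} =
    (\<Sum>c<length os. card {v. mset v = mset (delete_nth c os) + U \<and> Q (os ! c # v)})"
proof -
  let ?F = "\<lambda>c. {v. mset v = mset (delete_nth c os) + U \<and> Q (os ! c # v)}"
  have "{w. mset w = mset os + U \<and> Q w} = (\<Union>c<length os. (#) (os ! c) ` ?F c)"
  proof (intro equalityI subsetI)
    fix w assume w: "w \<in> {w. mset w = mset os + U \<and> Q w}"
    then obtain x v where xv: "w = x # v" "x < t" using Q by (cases w) force+
    have "mset (x # v) = mset os + U" using w xv by simp
    hence "x \<in># mset os + U" by (metis list.set_intros(1) set_mset_mset)
    moreover have "x \<notin># U" using U xv(2) by auto
    ultimately have "x \<in> set os" by simp
    then obtain c where c: "c < length os" "x = os ! c" by (auto simp: in_set_conv_nth)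
    have "mset v = mset (delete_nth c os) + U"
    proof -
      have "add_mset x (mset v) = mset os + U" using \<open>mset (x # v) = _\<close> by simp
      hence "mset v = mset os + U - {#x#}" by (metis add_mset_remove_trivial)
      thus ?thesis using c \<open>x \<in> set os\<close> by (simp add: mset_delete_nth)
    qed
    thus "w \<in> (\<Union>c<length os. (#) (os ! c) ` ?F c)" using w xv c by auto
  next
    fix w assume "w \<in> (\<Union>c<length os. (#) (os ! c) ` ?F c)"
    then obtain c v where "c < length os" "w = os ! c # v" "mset v = mset (delete_nth c os) + U" "Q w" by auto
    thus "w \<in> {w. mset w = mset os + U \<and> Q w}" by (simp add: mset_delete_nth)
  qed
  hence "card {w. mset w = mset os + U \<and> Q w} = card (\<Union>c<length os. (#) (os ! c) ` ?F c)" by simp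
  also have "\<dots> = (\<Sum>c<length os. card ((#) (os ! c) ` ?F c))"
  proof (rule card_UN_disjoint)
    show "\<forall>i\<in>{..<length os}. \<forall>j\<in>{..<length os}. i \<noteq> j \<longrightarrow> (#) (os ! i) ` ?F i \<inter> (#) (os ! j) ` ?F j = {}"
      using os by (auto simp: nth_eq_iff_index_eq)
  qed auto
  also have "\<dots> = (\<Sum>c<length os. card (?F c))"
    by (rule sum.cong[OF refl]) (simp add: card_image)
  finally show ?thesis .
qed

text \<open>
  This is avoidance of 213, with \<open>x\<close> in the role of the 2.
\<close>
fun high_first :: "nat list \<Rightarrow> bool" where
  "high_first [] \<longleftrightarrow> True"
| "high_first (x # u) \<longleftrightarrow> sorted_wrt (\<lambda>y z. \<not> (y < x \<and> x < z)) u \<and> high_first u"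

lemma hereditary_high_first: "hereditary high_first"
proof -
  have "high_first v \<longrightarrow> high_first u" if "subseq u v" for u v
    using that
  proof (induction rule: list_emb.induct)
    case (list_emb_Cons2 x y xs ys)
    thus ?case using hereditary_sorted_wrt[of "\<lambda>a b. \<not> (a < y \<and> y < b)"] unfolding hereditary_def by auto
  qed auto
  thus ?thesis by (auto simp: hereditary_def)
qed

text \<open>
  Waiting entries form runs, in which every entry is used after all entries of its run below it.
  Constraining all pairs of a run, not only neighbours, makes the condition stable under the removal
  of an entry.
\<close>
definition keeps :: "nat list \<Rightarrow> nat set \<Rightarrow> nat list \<Rightarrow> bool" where
  "keeps os M v \<longleftrightarrow> (\<forall>i j. i < j \<and> j < length os \<and> {i<..j} \<subseteq> M \<longrightarrow> \<not> subseq [os ! j, os ! i] v)"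

definition cuts :: "nat list \<Rightarrow> nat list \<Rightarrow> nat set" where
  "cuts os v = {c. 1 \<le> c \<and> c < length os \<and> (\<forall>i<c. \<forall>j. c \<le> j \<and> j < length os \<longrightarrow> \<not> subseq [os ! i, os ! j] v)}"

lemma nth_less_iff:
  fixes os :: "nat list"
  assumes "sorted_wrt (<) os" "i < length os" "j < length os"
  shows "os ! i < os ! j \<longleftrightarrow> i < j"
  using assms by (metis linorder_neqE_nat not_less_iff_gr_or_eq sorted_wrt_nth_less)

lemma nth_delete_nth_less: "i < c \<Longrightarrow> c < length os \<Longrightarrow> delete_nth c os ! i = os ! i"
  by (simp add: delete_nth_def nth_append)

lemma nth_delete_nth_ge: "c \<le> i \<Longrightarrow> Suc i < length os \<Longrightarrow> delete_nth c os ! i = os ! Suc i"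
  by (simp add: nth_delete_nth)

lemma nth_delete_nth_pred: "c < j \<Longrightarrow> j < length os \<Longrightarrow> delete_nth c os ! (j - 1) = os ! j"
  by (cases j) (auto simp: nth_delete_nth)

lemma not_in_delete_nth:
  fixes os :: "nat list"
  assumes os: "sorted_wrt (<) os" "\<forall>y\<in>set os. y < t" and U: "\<forall>z\<in>#U. t \<le> z" and c: "c < length os"
    and v: "mset v = mset (delete_nth c os) + U"
  shows "os ! c \<notin> set v" and "i < length os \<Longrightarrow> i \<noteq> c \<Longrightarrow> os ! i \<in> set v"
    and "y \<in> set v \<Longrightarrow> y < t \<Longrightarrow> \<exists>i<length os. i \<noteq> c \<and> y = os ! i"
proof -
  have setv: "set v = set (delete_nth c os) \<union> set_mset U" using v by (metis set_mset_mset set_mset_union)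
  have sd: "y \<in> set (delete_nth c os) \<longleftrightarrow> (\<exists>i<length os. i \<noteq> c \<and> y = os ! i)" for y
  proof
    assume "y \<in> set (delete_nth c os)"
    then obtain i where "i < length os - 1" "y = delete_nth c os ! i" using c by (auto simp: in_set_conv_nth length_delete_nth)
    thus "\<exists>i<length os. i \<noteq> c \<and> y = os ! i" using c
      by (cases "i < c") (auto simp: nth_delete_nth intro: exI[of _ i] exI[of _ "Suc i"])
  next
    assume "\<exists>i<length os. i \<noteq> c \<and> y = os ! i"
    then obtain i where i: "i < length os" "i \<noteq> c" "y = os ! i" by blast
    define j where "j = (if i < c then i else i - 1)"
    have "j < length (delete_nth c os)" "delete_nth c os ! j = y" using i c by (auto simp: j_def nth_delete_nth length_delete_nth)
    thus "y \<in> set (delete_nth c os)" by (auto simp: in_set_conv_nth)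
  qed
  have "os ! c \<notin># U" using U os(2) c by (meson leD nth_mem)
  moreover have "os ! c \<notin> set (delete_nth c os)"
    using sd os(1) c by (metis linorder_neqE_nat less_irrefl nth_less_iff)
  ultimately show "os ! c \<notin> set v" using setv by auto
  show "i < length os \<Longrightarrow> i \<noteq> c \<Longrightarrow> os ! i \<in> set v" using setv sd by blast
  show "y \<in> set v \<Longrightarrow> y < t \<Longrightarrow> \<exists>i<length os. i \<noteq> c \<and> y = os ! i"
    using setv sd U by (metis UnE leD)
qed

lemma fits_asc_step:
  assumes os: "sorted_wrt (<) os" "\<forall>y\<in>set os. y < t" and U: "\<forall>z\<in>#U. t \<le> z" and c: "c < length os"
    and v: "mset v = mset (delete_nth c os) + U" and ts: "sorted (t # ts)"
  shows "fits (tail_sorted (\<le>) (<)) (t # ts) (os ! c # v) \<longleftrightarrow>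
     (\<forall>i j. c < i \<and> i < j \<and> j < length os \<longrightarrow> \<not> subseq [os ! j, os ! i] v) \<and> fits (tail_sorted (\<le>) (<)) ts v"
proof -
  have "fits (tail_sorted (\<le>) (<)) (t # ts) (os ! c # v) \<longleftrightarrow> os ! c < t \<and>
     sorted_wrt (\<le>) (filter (\<lambda>y. os ! c < y) (filter (\<lambda>y. y < t) v)) \<and> fits (tail_sorted (\<le>) (<)) ts v"
    by (rule fits_Cons_iff[OF ts]) (simp_all add: hereditary_tail_sorted)
  moreover have "sorted_wrt (\<le>) (filter (\<lambda>y. os ! c < y) (filter (\<lambda>y. y < t) v)) \<longleftrightarrow>
      (\<forall>i j. c < i \<and> i < j \<and> j < length os \<longrightarrow> \<not> subseq [os ! j, os ! i] v)" (is "?L \<longleftrightarrow> ?R")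
  proof
    assume L: ?L
    show ?R
    proof (intro allI impI notI)
      fix i j assume ij: "c < i \<and> i < j \<and> j < length os" "subseq [os ! j, os ! i] v"
      have "os ! j < t" "os ! i < t" "os ! c < os ! i" "os ! c < os ! j" "os ! i < os ! j"
        using ij os c nth_less_iff[OF os(1)] by auto
      thus False using L ij(2) unfolding sorted_wrt_iff_subseq2 subseq2_filter by fastforce
    qed
  next
    assume R: ?R
    show ?L unfolding sorted_wrt_iff_subseq2 subseq2_filter
    proof (intro allI impI)
      fix a b assume ab: "((subseq [a, b] v \<and> a < t \<and> b < t) \<and> os ! c < a \<and> os ! c < b)"
      obtain j i where ij: "j < length os" "a = os ! j" "i < length os" "b = os ! i"
        using not_in_delete_nth(3)[OF os U c v] ab subseq2_set[of a b v] by metis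
      have "c < i" "c < j" using ab ij nth_less_iff[OF os(1) c] by auto
      hence "\<not> i < j" using R ab ij by auto
      thus "a \<le> b" using ij nth_less_iff[OF os(1), of i j] by auto
    qed
  qed
  ultimately show ?thesis using os(2) c by auto
qed

lemma keeps_step:
  assumes os: "sorted_wrt (<) os" "\<forall>y\<in>set os. y < t" and U: "\<forall>z\<in>#U. t \<le> z" and c: "c < length os"
    and v: "mset v = mset (delete_nth c os) + U" and ts: "sorted (t # ts)" and M: "M \<subseteq> {1..<length os}"
  shows "fits (tail_sorted (\<le>) (<)) (t # ts) (os ! c # v) \<and> keeps os M (os ! c # v) \<longleftrightarrow>
     c \<notin> M \<and> fits (tail_sorted (\<le>) (<)) ts v \<and> keeps (delete_nth c os) (M \<inter> {..<c} \<union> {c + 1..<length os - 1}) v"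
    (is "?L \<longleftrightarrow> ?R")
proof
  assume ?L
  hence fit: "fits (tail_sorted (\<le>) (<)) ts v" and asc: "\<And>i j. c < i \<Longrightarrow> i < j \<Longrightarrow> j < length os \<Longrightarrow> \<not> subseq [os ! j, os ! i] v"
    and resp: "\<And>i j. i < j \<Longrightarrow> j < length os \<Longrightarrow> {i<..j} \<subseteq> M \<Longrightarrow> \<not> subseq [os ! j, os ! i] (os ! c # v)"
    unfolding fits_asc_step[OF os U c v ts] keeps_def by blast+
  have "c \<notin> M"
  proof
    assume "c \<in> M"
    hence "1 \<le> c" using M by auto
    hence pred: "c - 1 < c" "c - 1 < length os" "c - 1 \<noteq> c" "{c - 1<..c} = {c}" using c by auto
    hence "\<not> subseq [os ! c, os ! (c - 1)] (os ! c # v)" 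
      using resp[OF pred(1) c] \<open>c \<in> M\<close> by (simp only: pred(4) insert_subset empty_subsetI simp_thms not_False_eq_True)
    thus False using not_in_delete_nth(2)[OF os U c v pred(2,3)] unfolding subseq2_Cons by blast
  qed
  moreover have "keeps (delete_nth c os) (M \<inter> {..<c} \<union> {c + 1..<length os - 1}) v"
    unfolding keeps_def
  proof (intro allI impI)
    fix i j assume ij: "i < j \<and> j < length (delete_nth c os) \<and> {i<..j} \<subseteq> M \<inter> {..<c} \<union> {c + 1..<length os - 1}"
    hence "c \<notin> {i<..j}" by auto
    hence "j < c \<or> c \<le> i" by auto
    thus "\<not> subseq [delete_nth c os ! j, delete_nth c os ! i] v"
    proof
      assume j: "j < c"
      have "{i<..j} \<subseteq> M" using ij j by auto
      moreover have "i < j" "j < length os" "i < c" using ij j c by auto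
      ultimately have "\<not> subseq [os ! j, os ! i] v" using resp[of i j] unfolding subseq2_Cons by blast
      thus ?thesis using j c \<open>i < c\<close> by (simp add: nth_delete_nth_less)
    next
      assume "c \<le> i"
      moreover have "i < j" "Suc j < length os" "Suc i < length os" using ij c by (auto simp: length_delete_nth)
      ultimately show ?thesis using asc[of "Suc i" "Suc j"] by (simp add: nth_delete_nth_ge)
    qed
  qed
  ultimately show ?R using fit by blast
next
  assume R: ?R
  hence resp: "\<And>i j. i < j \<Longrightarrow> j < length os - 1 \<Longrightarrow> {i<..j} \<subseteq> M \<inter> {..<c} \<union> {c + 1..<length os - 1} \<Longrightarrow>
     \<not> subseq [delete_nth c os ! j, delete_nth c os ! i] v" and cM: "c \<notin> M"
    using c unfolding keeps_def by (auto simp: length_delete_nth)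
  have asc: "\<not> subseq [os ! j, os ! i] v" if "c < i" "i < j" "j < length os" for i j
  proof -
    have "{i - 1<..j - 1} \<subseteq> M \<inter> {..<c} \<union> {c + 1..<length os - 1}" "i - 1 < j - 1" "j - 1 < length os - 1"
      using that by auto
    hence "\<not> subseq [delete_nth c os ! (j - 1), delete_nth c os ! (i - 1)] v" using resp by blast
    moreover have "c < j" "i < length os" using that by auto
    ultimately show ?thesis using that by (simp only: nth_delete_nth_pred not_False_eq_True)
  qed
  have "keeps os M (os ! c # v)" unfolding keeps_def
  proof (intro allI impI)
    fix i j assume ij: "i < j \<and> j < length os \<and> {i<..j} \<subseteq> M"
    hence jc: "j < c \<or> c \<le> i" "j \<noteq> c" using cM by (auto simp: subset_iff) (metis linorder_not_less)
    have "\<not> subseq [os ! j, os ! i] v"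
    proof -
      consider "j < c" | "i = c" | "c < i" using jc by linarith
      thus ?thesis
      proof cases
        case 1
        have "{i<..j} \<subseteq> M \<inter> {..<c} \<union> {c + 1..<length os - 1}" "i < j" "j < length os - 1"
          using ij 1 c by auto
        hence "\<not> subseq [delete_nth c os ! j, delete_nth c os ! i] v" using resp by blast
        thus ?thesis using ij 1 c by (simp add: nth_delete_nth_less)
      next
        case 2
        thus ?thesis using not_in_delete_nth(1)[OF os U c v] subseq2_set by metis
      next
        case 3
        thus ?thesis using asc ij by blast
      qed
    qed
    moreover have "os ! c \<noteq> os ! j" using nth_less_iff[OF os(1), of c j] nth_less_iff[OF os(1), of j c] jc(2) ij c by auto
    ultimately show "\<not> subseq [os ! j, os ! i] (os ! c # v)" by (simp add: subseq2_Cons del: list_emb_code)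
  qed
  thus ?L using R asc unfolding fits_asc_step[OF os U c v ts] by blast
qed

lemma fits_high_first_step:
  assumes os: "sorted_wrt (<) os" "\<forall>y\<in>set os. y < t" and U: "\<forall>z\<in>#U. t \<le> z" and c: "c < length os"
    and v: "mset v = mset (delete_nth c os) + U" and ts: "sorted (t # ts)"
  shows "fits high_first (t # ts) (os ! c # v) \<longleftrightarrow>
     (c = 0 \<or> c = length os - 1 \<or> c \<in> cuts (delete_nth c os) v) \<and> fits high_first ts v"
proof -
  have "fits high_first (t # ts) (os ! c # v) \<longleftrightarrow> os ! c < t \<and>
     sorted_wrt (\<lambda>y z. \<not> (y < os ! c \<and> os ! c < z)) (filter (\<lambda>y. y < t) v) \<and> fits high_first ts v"
    by (rule fits_Cons_iff[OF ts]) (simp_all add: hereditary_high_first)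
  moreover have "sorted_wrt (\<lambda>y z. \<not> (y < os ! c \<and> os ! c < z)) (filter (\<lambda>y. y < t) v) \<longleftrightarrow>
      (\<forall>i j. i < c \<and> c < j \<and> j < length os \<longrightarrow> \<not> subseq [os ! i, os ! j] v)" (is "?L \<longleftrightarrow> ?R")
  proof
    assume L: ?L
    show ?R
    proof (intro allI impI notI)
      fix i j assume ij: "i < c \<and> c < j \<and> j < length os" "subseq [os ! i, os ! j] v"
      have "os ! j < t" "os ! i < t" "os ! i < os ! c" "os ! c < os ! j"
        using ij os c nth_less_iff[OF os(1)] by auto
      thus False using L ij(2) unfolding sorted_wrt_iff_subseq2 subseq2_filter by blast
    qed
  next
    assume R: ?R
    show ?L unfolding sorted_wrt_iff_subseq2 subseq2_filter
    proof (intro allI impI notI)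
      fix a b assume ab: "subseq [a, b] v \<and> a < t \<and> b < t" "a < os ! c \<and> os ! c < b"
      obtain j i where ij: "i < length os" "a = os ! i" "j < length os" "b = os ! j"
        using not_in_delete_nth(3)[OF os U c v] ab subseq2_set[of a b v] by metis
      have "i < c" "c < j" using ab ij nth_less_iff[OF os(1)] c by auto
      thus False using R ab ij by auto
    qed
  qed
  moreover have "?R \<longleftrightarrow> c = 0 \<or> c = length os - 1 \<or> c \<in> cuts (delete_nth c os) v"
  proof
    assume R: ?R
    have "c \<in> cuts (delete_nth c os) v" if "c \<noteq> 0" "c \<noteq> length os - 1"
      using R that c by (auto simp: cuts_def length_delete_nth nth_delete_nth)
    thus "c = 0 \<or> c = length os - 1 \<or> c \<in> cuts (delete_nth c os) v" by blast
  next
    assume A: "c = 0 \<or> c = length os - 1 \<or> c \<in> cuts (delete_nth c os) v"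
    show ?R
    proof (intro allI impI)
      fix i j assume ij: "i < c \<and> c < j \<and> j < length os"
      hence "c \<in> cuts (delete_nth c os) v" using A by auto
      hence "\<not> subseq [delete_nth c os ! i, delete_nth c os ! (j - 1)] v"
      proof -
        have "c \<le> j - 1" "j - 1 < length (delete_nth c os)" using ij c by (auto simp: length_delete_nth)
        thus ?thesis using \<open>c \<in> cuts (delete_nth c os) v\<close> ij unfolding cuts_def by blast
      qed
      moreover have "delete_nth c os ! i = os ! i" "delete_nth c os ! (j - 1) = os ! j"
        using ij c nth_delete_nth_less[of i c os] nth_delete_nth_pred[of c j os] by auto
      ultimately show "\<not> subseq [os ! i, os ! j] v" by simp
    qed
  qed
  ultimately show ?thesis using os(2) c by auto
qed

lemma cuts_step:
  assumes os: "sorted_wrt (<) os" "\<forall>y\<in>set os. y < t" and U: "\<forall>z\<in>#U. t \<le> z" and c: "c < length os"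
    and v: "mset v = mset (delete_nth c os) + U"
    and ok: "c = 0 \<or> c = length os - 1 \<or> c \<in> cuts (delete_nth c os) v"
  shows "cuts os (os ! c # v) = cuts (delete_nth c os) v \<inter> {..<c} \<union> ({c} - {0})"
proof (rule set_eqI)
  fix d
  note nin = not_in_delete_nth[OF os U c v]
  have inj: "os ! c = os ! i \<longleftrightarrow> c = i" if "i < length os" for i
    using nth_less_iff[OF os(1), of c i] nth_less_iff[OF os(1), of i c] that c by auto
  consider "d = 0" | "d \<noteq> 0" "d < c" | "d \<noteq> 0" "d = c" | "c < d" by linarith
  thus "d \<in> cuts os (os ! c # v) \<longleftrightarrow> d \<in> cuts (delete_nth c os) v \<inter> {..<c} \<union> ({c} - {0})"
  proof cases
    case 1
    thus ?thesis by (simp add: cuts_def)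
  next
    case 2
    have "(\<forall>i<d. \<forall>j. d \<le> j \<and> j < length os \<longrightarrow> \<not> subseq [os ! i, os ! j] (os ! c # v)) \<longleftrightarrow>
          (\<forall>i<d. \<forall>j. d \<le> j \<and> j < length os - 1 \<longrightarrow> \<not> subseq [delete_nth c os ! i, delete_nth c os ! j] v)" (is "?A \<longleftrightarrow> ?B")
    proof
      assume A: ?A
      show ?B
      proof (intro allI impI)
        fix i j assume ij: "i < d" "d \<le> j \<and> j < length os - 1"
        have "\<not> subseq [os ! i, os ! (if j < c then j else Suc j)] (os ! c # v)" using A ij by auto
        hence "\<not> subseq [os ! i, os ! (if j < c then j else Suc j)] v" unfolding subseq2_Cons by blast
        thus "\<not> subseq [delete_nth c os ! i, delete_nth c os ! j] v"
          using ij 2 c by (auto simp: nth_delete_nth split: if_splits)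
      qed
    next
      assume B: ?B
      show ?A
      proof (intro allI impI notI)
        fix i j assume ij: "i < d" "d \<le> j \<and> j < length os" and s: "subseq [os ! i, os ! j] (os ! c # v)"
        hence s': "subseq [os ! i, os ! j] v" using inj[of i] 2 by (simp add: subseq2_Cons del: list_emb_code)
        hence "j \<noteq> c" using nin(1) subseq2_set by metis
        define k where "k = (if j < c then j else j - 1)"
        have "delete_nth c os ! k = os ! j" "d \<le> k" "k < length os - 1" using \<open>j \<noteq> c\<close> ij 2 c by (auto simp: k_def nth_delete_nth)
        moreover have "delete_nth c os ! i = os ! i" using ij 2 c by (simp add: nth_delete_nth)
        ultimately show False using B s' ij by metis
      qed
    qed
    thus ?thesis using 2 c by (auto simp: cuts_def length_delete_nth)
  next
    case 3
    have "\<not> subseq [os ! i, os ! j] (os ! c # v)" if ij: "i < c" "c \<le> j" "j < length os" for i j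
    proof
      assume "subseq [os ! i, os ! j] (os ! c # v)"
      hence s: "subseq [os ! i, os ! j] v" using inj[of i] ij by (simp add: subseq2_Cons del: list_emb_code)
      hence "j \<noteq> c" using nin(1) subseq2_set by metis
      hence "c \<in> cuts (delete_nth c os) v" using ok ij 3 by auto
      hence "\<not> subseq [delete_nth c os ! i, delete_nth c os ! (j - 1)] v"
      proof -
        have "c \<le> j - 1" "j - 1 < length (delete_nth c os)" using ij c \<open>j \<noteq> c\<close> by (auto simp: length_delete_nth)
        thus ?thesis using \<open>c \<in> cuts (delete_nth c os) v\<close> ij unfolding cuts_def by blast
      qed
      moreover have "delete_nth c os ! i = os ! i" "delete_nth c os ! (j - 1) = os ! j"
        using ij c \<open>j \<noteq> c\<close> nth_delete_nth_less[of i c os] nth_delete_nth_pred[of c j os] by auto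
      ultimately show False using s by simp
    qed
    thus ?thesis using 3 c by (auto simp: cuts_def)
  next
    case 4
    have "d \<notin> cuts os (os ! c # v)"
    proof
      assume d: "d \<in> cuts os (os ! c # v)"
      hence dl: "d < length os" by (simp add: cuts_def)
      have "\<not> subseq [os ! c, os ! d] (os ! c # v)" using d 4 by (auto simp: cuts_def)
      thus False using nin(2)[OF dl] 4 by (simp add: subseq_singleton_left)
    qed
    thus ?thesis using 4 by auto
  qed
qed

lemma distinct_iff_count: "distinct xs \<longleftrightarrow> (\<forall>z. count (mset xs) z \<le> 1)"
  unfolding distinct_count_atmost_1
proof (intro iff_allI)
  fix a
  show "count (mset xs) a = (if a \<in> set xs then 1 else 0) \<longleftrightarrow> count (mset xs) a \<le> 1"
  proof (cases "count (mset xs) a = 0")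
    case False
    hence "a \<in> set xs" by (metis count_eq_zero_iff set_mset_mset)
    thus ?thesis using False by (simp only: if_True) linarith
  next
    case True
    hence "a \<notin> set xs" by (metis count_eq_zero_iff set_mset_mset)
    thus ?thesis unfolding True by simp
  qed
qed

lemma subseq2_total: "a \<in> set w \<Longrightarrow> b \<in> set w \<Longrightarrow> a \<noteq> b \<Longrightarrow> subseq [a, b] w \<or> subseq [b, a] w"
proof (induction w)
  case (Cons x w)
  thus ?case unfolding subseq2_Cons by auto
qed simp

lemma subseq2_glue:
  "subseq [a, b] w \<Longrightarrow> subseq [b, c] w \<Longrightarrow> distinct w \<Longrightarrow> subseq [a, b, c] w"
proof (induction w rule: list.induct)
  case (Cons x w)
  show ?case
  proof (cases "x = a")
    case True
    have "b \<in> set w" using Cons.prems(1) True by (simp add: subseq_singleton_left)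
    hence "x \<noteq> b" using Cons.prems(3) by auto
    hence "subseq [b, c] w" using Cons.prems(2) by simp
    thus ?thesis using True by simp
  next
    case False
    hence ab: "subseq [a, b] w" using Cons.prems(1) by simp
    hence "x \<noteq> b" using subseq2_set[OF ab] Cons.prems(3) by auto
    hence "subseq [b, c] w" using Cons.prems(2) by simp
    hence "subseq [a, b, c] w" using Cons.IH[OF ab] Cons.prems(3) by simp
    thus ?thesis by (rule list_emb_Cons)
  qed
qed simp

definition opened :: "nat list \<Rightarrow> nat multiset \<Rightarrow> nat \<Rightarrow> nat list" where
  "opened os U t = os @ sorted_list_of_multiset (filter_mset (\<lambda>y. y < t) U)"

lemma opened_props:
  assumes os: "sorted_wrt (<) os" "\<forall>y\<in>set os. y < t0" and U: "\<forall>z\<in>#U. t0 \<le> z" "\<forall>z. count U z \<le> 1" and t: "t0 \<le> t"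
  shows "sorted_wrt (<) (opened os U t)" and "\<forall>y\<in>set (opened os U t). y < t"
    and "mset (opened os U t) + filter_mset (\<lambda>y. \<not> y < t) U = mset os + U"
    and "length (opened os U t) = length os + size (filter_mset (\<lambda>y. y < t) U)"
proof -
  let ?W = "filter_mset (\<lambda>y. y < t) U"
  have "distinct (sorted_list_of_multiset ?W)" using U(2) by (simp add: distinct_iff_count)
  hence "sorted_wrt (<) (sorted_list_of_multiset ?W)"
    by (simp add: strict_sorted_iff sorted_sorted_list_of_multiset)
  thus "sorted_wrt (<) (opened os U t)"
    unfolding opened_def sorted_wrt_append using os U(1) by (auto intro: less_le_trans)
  show "\<forall>y\<in>set (opened os U t). y < t" using os(2) t by (auto simp: opened_def)
  show "mset (opened os U t) + filter_mset (\<lambda>y. \<not> y < t) U = mset os + U"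
    by (simp add: opened_def add.assoc)
  show "length (opened os U t) = length os + size ?W"
    unfolding size_mset[symmetric] by (simp add: opened_def)
qed

lemma keeps_opened:
  assumes "M \<subseteq> {1..<length os}"
  shows "keeps (opened os U t) M v \<longleftrightarrow> keeps os M v"
proof -
  have j: "j < length os" if "i < j" "{i<..j} \<subseteq> M" for i j
    using that assms by (auto simp: subset_iff)
  have nth: "opened os U t ! i = os ! i" if "i < length os" for i
    using that by (simp add: opened_def nth_append)
  have len: "length os \<le> length (opened os U t)" by (simp add: opened_def)
  show ?thesis unfolding keeps_def
  proof (intro iff_allI)
    fix i j
    have "j < length os \<and> j < length (opened os U t) \<and> opened os U t ! j = os ! j \<and> opened os U t ! i = os ! i"
      if "i < j" "{i<..j} \<subseteq> M" using j[OF that] that(1) len nth by auto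
    thus "(i < j \<and> j < length (opened os U t) \<and> {i<..j} \<subseteq> M \<longrightarrow> \<not> subseq [opened os U t ! j, opened os U t ! i] v) \<longleftrightarrow>
       (i < j \<and> j < length os \<and> {i<..j} \<subseteq> M \<longrightarrow> \<not> subseq [os ! j, os ! i] v)"
      by metis
  qed
qed

text \<open>
  New rows do not disturb old cuts: if a new entry were used after an entry below the cut, then together
  with an earlier entry above the cut they would form 213 among the available rows.
\<close>
lemma cuts_opened:
  assumes os: "sorted_wrt (<) os" "\<forall>y\<in>set os. y < t0" and U: "\<forall>z\<in>#U. t0 \<le> z" "\<forall>z. count U z \<le> 1" and t: "t0 \<le> t"
    and v: "mset v = mset os + U" and fit: "high_first (filter (\<lambda>y. y < t) v)"
  shows "cuts os v = cuts (opened os U t) v \<inter> {..<length os}"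
proof (rule set_eqI)
  fix c
  let ?os = "opened os U t"
  note pr = opened_props[OF os U t]
  have len: "length os \<le> length ?os" by (simp add: opened_def)
  have nth: "?os ! i = os ! i" if "i < length os" for i using that by (simp add: opened_def nth_append)
  have hf: "\<not> subseq [y, a, n] w" if "high_first w" "a < y" "y < n" for y a n w
    using that(1)
  proof (induction w)
    case (Cons x w)
    thus ?case using that(2,3) by (auto simp: sorted_wrt_iff_subseq2)
  qed simp
  have "c \<in> cuts ?os v" if c: "c \<in> cuts os v"
  proof -
    have cl: "1 \<le> c" "c < length os" using c by (auto simp: cuts_def)
    have "\<not> subseq [?os ! i, ?os ! j] v" if ij: "i < c" "c \<le> j" "j < length ?os" for i j
    proof (cases "j < length os")
      case True
      thus ?thesis using c ij by (simp add: cuts_def nth)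
    next
      case False
      show ?thesis
      proof
        assume s: "subseq [?os ! i, ?os ! j] v"
        let ?a = "os ! i" and ?y = "os ! c" and ?n = "?os ! j"
        have ay: "?a < ?y" using ij cl os(1) by (simp add: sorted_wrt_nth_less)
        have yn: "?y < ?n" using sorted_wrt_nth_less[OF pr(1), of c j] ij(3) False cl nth by simp
        have "\<not> subseq [?a, ?y] v" using c ij cl by (auto simp: cuts_def)
        moreover have "?a \<in> set v" "?y \<in> set v"
          using v ij cl by (metis (no_types) UnI1 nth_mem order.strict_trans set_mset_mset set_mset_union)+
        ultimately have ya: "subseq [?y, ?a] v" using subseq2_total[of ?y v ?a] ay by simp
        have dist: "distinct v"
        proof -
          have "count (mset v) z \<le> 1" for z
          proof (cases "z \<in> set os")
            case True
            hence "count U z = 0" using os(2) U(1) by (meson count_inI leD)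
            moreover have "distinct os" using os(1) strict_sorted_iff by blast
            ultimately show ?thesis using v by (simp add: distinct_iff_count)
          next
            case False
            hence "count (mset os) z = 0" by (simp add: count_eq_zero_iff)
            moreover have "count (mset v) z = count (mset os) z + count U z" using v by simp
            ultimately show ?thesis using U(2) by (metis add_0)
          qed
          thus ?thesis by (simp add: distinct_iff_count)
        qed
        have "subseq [?y, ?a, ?n] v" using subseq2_glue[OF ya _ dist] s nth[of i] ij cl by simp
        moreover have "?n < t" using pr(2) ij(3) by simp
        ultimately have "subseq [?y, ?a, ?n] (filter (\<lambda>y. y < t) v)"
          using ay yn subseq_filter[of "[?y, ?a, ?n]" v "\<lambda>y. y < t"] by simp
        thus False using hf[OF fit ay yn] by blast
      qed
    qed
    thus ?thesis using cl len by (auto simp: cuts_def)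
  qed
  moreover have "c \<in> cuts os v" if c: "c \<in> cuts ?os v" "c < length os"
  proof -
    have "\<not> subseq [os ! i, os ! j] v" if ij: "i < c" "c \<le> j" "j < length os" for i j
    proof -
      have "\<not> subseq [?os ! i, ?os ! j] v" using c ij len by (simp add: cuts_def)
      thus ?thesis using nth[of i] nth[of j] ij by simp
    qed
    thus ?thesis using c by (simp add: cuts_def)
  qed
  moreover have "c < length os" if "c \<in> cuts os v" using that by (simp add: cuts_def)
  ultimately show "c \<in> cuts os v \<longleftrightarrow> c \<in> cuts ?os v \<inter> {..<length os}" by blast
qed

lemma card_asc_words:
  assumes "sorted_wrt (<) os" "\<forall>y\<in>set os. y < t0" "\<forall>z\<in>#U. t0 \<le> z" "\<forall>z. count U z \<le> 1"
    and "sorted (t0 # ts)" "M \<subseteq> {1..<length os}"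
  shows "card {v. mset v = mset os + U \<and> fits (tail_sorted (\<le>) (<)) ts v \<and> keeps os M v} = ascending_count ts U (length os) M"
  using assms
proof (induction ts arbitrary: t0 os U M)
  case Nil
  have "{v. mset v = mset os + U \<and> fits (tail_sorted (\<le>) (<)) [] v \<and> keeps os M v} =
     (if os = [] \<and> U = {#} then {[]} else {})"
    by (auto simp: keeps_def)
  thus ?case by auto
next
  case (Cons t ts)
  let ?P = "fits (tail_sorted (\<le>) (<))"
  let ?os = "opened os U t" and ?U = "filter_mset (\<lambda>y. \<not> y < t) U"
  let ?M = "\<lambda>c. M \<inter> {..<c} \<union> {c + 1..<length ?os - 1}"
  have t: "t0 \<le> t" "sorted (t # ts)" using Cons.prems(5) by auto
  note pr = opened_props[OF Cons.prems(1-4) t(1)]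
  have U: "\<forall>z\<in>#?U. t \<le> z" "\<forall>z. count ?U z \<le> 1" using Cons.prems(4) by auto
  have M: "M \<subseteq> {1..<length ?os}" using Cons.prems(6) pr(4) by auto
  have dist: "distinct ?os" using pr(1) strict_sorted_iff by blast
  have "card {v. mset v = mset os + U \<and> ?P (t # ts) v \<and> keeps os M v}
      = card {v. mset v = mset ?os + ?U \<and> (?P (t # ts) v \<and> keeps ?os M v)}"
    by (simp add: pr(3) keeps_opened[OF Cons.prems(6)])
  also have "\<dots> = (\<Sum>c<length ?os. card {v. mset v = mset (delete_nth c ?os) + ?U \<and>
      (?P (t # ts) (?os ! c # v) \<and> keeps ?os M (?os ! c # v))})"
  proof (rule card_first_letter[OF dist U(1)])
    fix w assume "?P (t # ts) w \<and> keeps ?os M w"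
    thus "w \<noteq> [] \<and> hd w < t" by (cases w) auto
  qed
  also have "\<dots> = (\<Sum>c<length ?os. if c \<in> M then 0 else ascending_count ts ?U (length ?os - 1) (?M c))"
  proof (rule sum.cong[OF refl])
    fix c assume "c \<in> {..<length ?os}"
    hence c: "c < length ?os" by simp
    have "{v. mset v = mset (delete_nth c ?os) + ?U \<and> (?P (t # ts) (?os ! c # v) \<and> keeps ?os M (?os ! c # v))}
       = {v. mset v = mset (delete_nth c ?os) + ?U \<and> c \<notin> M \<and> ?P ts v \<and> keeps (delete_nth c ?os) (?M c) v}"
      using keeps_step[OF pr(1,2) U(1) c _ t(2) M] by blast
    moreover have "card {v. mset v = mset (delete_nth c ?os) + ?U \<and> ?P ts v \<and> keeps (delete_nth c ?os) (?M c) v}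
       = ascending_count ts ?U (length (delete_nth c ?os)) (?M c)" if "c \<notin> M"
    proof (rule Cons.IH[OF sorted_delete_nth[OF pr(1) c] _ U t(2)])
      show "\<forall>y\<in>set (delete_nth c ?os). y < t" using pr(2) set_delete_nth_subset by fast
      have "1 \<le> m \<and> m < length ?os" if "m \<in> M" for m using M that by auto
      thus "?M c \<subseteq> {1..<length (delete_nth c ?os)}" using c by (fastforce simp: length_delete_nth)
    qed
    ultimately show "card {v. mset v = mset (delete_nth c ?os) + ?U \<and> (?P (t # ts) (?os ! c # v) \<and> keeps ?os M (?os ! c # v))}
       = (if c \<in> M then 0 else ascending_count ts ?U (length ?os - 1) (?M c))"
      using c by (simp add: length_delete_nth)
  qed
  also have "\<dots> = (\<Sum>c\<in>{c. c < length ?os \<and> c \<notin> M}. ascending_count ts ?U (length ?os - 1) (?M c))"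
    by (rule sum.mono_neutral_cong_right) auto
  also have "\<dots> = ascending_count (t # ts) U (length os) M"
    by (simp add: Let_def pr(4))
  finally show ?case .
qed

lemma card_high_first_words:
  assumes "sorted_wrt (<) os" "\<forall>y\<in>set os. y < t0" "\<forall>z\<in>#U. t0 \<le> z" "\<forall>z. count U z \<le> 1"
    and "sorted (t0 # ts)"
  shows "card {v. mset v = mset os + U \<and> fits high_first ts v \<and> cuts os v = K} = cut_count ts U (length os) K"
  using assms
proof (induction ts arbitrary: t0 os U K)
  case Nil
  have "{v. mset v = mset os + U \<and> fits high_first [] v \<and> cuts os v = K} =
     (if os = [] \<and> U = {#} \<and> K = {} then {[]} else {})"
    by (auto simp: cuts_def)
  thus ?case by auto
next
  case (Cons t ts)
  let ?P = "fits high_first"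
  let ?os = "opened os U t" and ?U = "filter_mset (\<lambda>y. \<not> y < t) U"
  let ?h = "length os" and ?h' = "length (opened os U t)"
  let ?g = "\<lambda>c K'. (K' \<inter> {..<c} \<union> ({c} - {0})) \<inter> {..<?h}"
  let ?ok = "\<lambda>c K'. c = 0 \<or> c = ?h' - 1 \<or> c \<in> K'"
  have t: "t0 \<le> t" "sorted (t # ts)" using Cons.prems(5) by auto
  note pr = opened_props[OF Cons.prems(1-4) t(1)]
  have U: "\<forall>z\<in>#?U. t \<le> z" "\<forall>z. count ?U z \<le> 1" using Cons.prems(4) by auto
  have dist: "distinct ?os" using pr(1) strict_sorted_iff by blast
  have "cuts os v = cuts ?os v \<inter> {..<?h}" if "mset v = mset os + U" "?P (t # ts) v" for v
  proof -
    have "high_first (filter (\<lambda>y. y < t) v)" using that(2) by (cases v) (auto split: if_splits)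
    thus ?thesis by (rule cuts_opened[OF Cons.prems(1-4) t(1) that(1)])
  qed
  hence "{v. mset v = mset os + U \<and> ?P (t # ts) v \<and> cuts os v = K}
      = {v. mset v = mset ?os + ?U \<and> (?P (t # ts) v \<and> cuts ?os v \<inter> {..<?h} = K)}"
    unfolding pr(3) by auto
  hence "card {v. mset v = mset os + U \<and> ?P (t # ts) v \<and> cuts os v = K}
      = card {v. mset v = mset ?os + ?U \<and> (?P (t # ts) v \<and> cuts ?os v \<inter> {..<?h} = K)}" by simp
  also have "\<dots> = (\<Sum>c<?h'. card {v. mset v = mset (delete_nth c ?os) + ?U \<and>
      (?P (t # ts) (?os ! c # v) \<and> cuts ?os (?os ! c # v) \<inter> {..<?h} = K)})"
  proof (rule card_first_letter[OF dist U(1)])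
    fix w assume "?P (t # ts) w \<and> cuts ?os w \<inter> {..<?h} = K"
    thus "w \<noteq> [] \<and> hd w < t" by (cases w) auto
  qed
  also have "\<dots> = (\<Sum>c<?h'. \<Sum>K'\<in>{K'\<in>Pow {1..<?h' - 1}. ?ok c K' \<and> ?g c K' = K}. cut_count ts ?U (?h' - 1) K')"
  proof (rule sum.cong[OF refl])
    fix c assume "c \<in> {..<?h'}"
    hence c: "c < ?h'" by simp
    let ?T = "{K'\<in>Pow {1..<?h' - 1}. ?ok c K' \<and> ?g c K' = K}"
    let ?V = "{v. mset v = mset (delete_nth c ?os) + ?U \<and> ?P ts v \<and> ?ok c (cuts (delete_nth c ?os) v) \<and> ?g c (cuts (delete_nth c ?os) v) = K}"
    have "{v. mset v = mset (delete_nth c ?os) + ?U \<and> (?P (t # ts) (?os ! c # v) \<and> cuts ?os (?os ! c # v) \<inter> {..<?h} = K)} = ?V"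
      (is "?V' = _")
    proof (rule Collect_cong)
      fix v
      show "mset v = mset (delete_nth c ?os) + ?U \<and> (?P (t # ts) (?os ! c # v) \<and> cuts ?os (?os ! c # v) \<inter> {..<?h} = K) \<longleftrightarrow>
        mset v = mset (delete_nth c ?os) + ?U \<and> ?P ts v \<and> ?ok c (cuts (delete_nth c ?os) v) \<and> ?g c (cuts (delete_nth c ?os) v) = K"
      proof (cases "mset v = mset (delete_nth c ?os) + ?U \<and> ?ok c (cuts (delete_nth c ?os) v)")
        case True
        thus ?thesis using fits_high_first_step[OF pr(1,2) U(1) c _ t(2), of v] cuts_step[OF pr(1,2) U(1) c, of v] by simp
      next
        case False
        thus ?thesis using fits_high_first_step[OF pr(1,2) U(1) c _ t(2), of v] by blast
      qed
    qed
    hence "card ?V' = card ?V" by simp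
    also have "card ?V = (\<Sum>K'\<in>?T. card {v \<in> ?V. cuts (delete_nth c ?os) v = K'})"
    proof -
      have fin: "finite ?V" "finite ?T" by simp_all
      have "cuts (delete_nth c ?os) v \<subseteq> {1..<?h' - 1}" for v using c by (auto simp: cuts_def length_delete_nth)
      hence sub: "cuts (delete_nth c ?os) ` ?V \<subseteq> ?T" by blast
      show ?thesis using sum.group[OF fin sub, of "\<lambda>_. 1 :: nat"] by simp
    qed
    also have "\<dots> = (\<Sum>K'\<in>?T. cut_count ts ?U (?h' - 1) K')"
    proof (rule sum.cong[OF refl])
      fix K' assume "K' \<in> ?T"
      hence "{v \<in> ?V. cuts (delete_nth c ?os) v = K'} = {v. mset v = mset (delete_nth c ?os) + ?U \<and> ?P ts v \<and> cuts (delete_nth c ?os) v = K'}"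
        by blast
      moreover have "\<forall>y\<in>set (delete_nth c ?os). y < t" using pr(2) set_delete_nth_subset by fast
      ultimately show "card {v \<in> ?V. cuts (delete_nth c ?os) v = K'} = cut_count ts ?U (?h' - 1) K'"
        using Cons.IH[OF sorted_delete_nth[OF pr(1) c] _ U t(2), of K'] c by (simp add: length_delete_nth)
    qed
    finally show "card ?V' = (\<Sum>K'\<in>?T. cut_count ts ?U (?h' - 1) K')" .
  qed
  also have "\<dots> = cut_count (t # ts) U ?h K"
    unfolding cut_count.simps Let_def pr(4)[symmetric] ..
  finally show ?case .
qed

theorem card_fits_132_213:
  assumes "sorted ts" "\<forall>z. count V z \<le> 1"
  shows "card {v. mset v = V \<and> fits (tail_sorted (\<le>) (<)) ts v} = card {v. mset v = V \<and> fits high_first ts v}"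
proof -
  have "card {v. mset v = V \<and> fits (tail_sorted (\<le>) (<)) ts v} = ascending_count ts V 0 {}"
    using card_asc_words[of "[]" 0 V ts "{}"] assms by (simp add: keeps_def)
  also have "\<dots> = cut_count ts V 0 {}"
  proof -
    have "{K \<in> Pow {1..<0}. dominates K {}} = {{}}" by (auto simp: dominates_def)
    thus ?thesis using ascending_count_eq_sum_cut_count[of "{}" 0 ts V] by simp
  qed
  also have "\<dots> = card {v. mset v = V \<and> fits high_first ts v}"
    using card_high_first_words[of "[]" 0 V ts "{}"] assms by (simp add: cuts_def)
  finally show ?thesis .
qed

section \<open>The equivalences\<close>

lemma avoids_length_2:
  "\<not> contains_pattern v [1, 2] \<longleftrightarrow> sorted_wrt (\<ge>) v"
  "\<not> contains_pattern v [2, 1] \<longleftrightarrow> sorted_wrt (\<le>) v"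
proof -
  have iso: "order_iso s [1, 2] \<longleftrightarrow> (\<exists>a b. a < b \<and> s = [a, b])"
     "order_iso s [2, 1] \<longleftrightarrow> (\<exists>a b. b < a \<and> s = [a, b])" for s
    by (cases "\<exists>a b. s = [a, b]"; auto simp: order_iso_def All_less_Suc length_Suc_conv)+
  show "\<not> contains_pattern v [1, 2] \<longleftrightarrow> sorted_wrt (\<ge>) v"
    "\<not> contains_pattern v [2, 1] \<longleftrightarrow> sorted_wrt (\<le>) v"
    unfolding contains_pattern_iff iso sorted_wrt_iff_subseq2 by (auto simp: not_less)
qed

lemma subseq3_Cons: "subseq [a, b, c] (x # v) \<longleftrightarrow> x = a \<and> subseq [b, c] v \<or> subseq [a, b, c] v"
  by (auto dest: subseq_Cons')

lemma tail_sorted_iff: "tail_sorted R S v \<longleftrightarrow> (\<forall>a b c. subseq [a, b, c] v \<longrightarrow> S a b \<longrightarrow> S a c \<longrightarrow> R b c)"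
proof (induction v)
  case (Cons x v)
  have "sorted_wrt R (filter (S x) v) \<longleftrightarrow> (\<forall>b c. subseq [b, c] v \<longrightarrow> S x b \<longrightarrow> S x c \<longrightarrow> R b c)"
    unfolding sorted_wrt_iff_subseq2 subseq2_filter by blast
  thus ?case unfolding tail_sorted.simps Cons.IH subseq3_Cons by blast
qed simp

lemma high_first_iff: "high_first v \<longleftrightarrow> (\<forall>a b c. subseq [a, b, c] v \<longrightarrow> \<not> (b < a \<and> a < c))"
proof (induction v)
  case (Cons x v)
  show ?case unfolding high_first.simps Cons.IH subseq3_Cons sorted_wrt_iff_subseq2 by blast
qed simp

lemma avoids_length_3:
  "\<not> contains_pattern v [1, 2, 3] \<longleftrightarrow> tail_sorted (\<ge>) (<) v"
  "\<not> contains_pattern v [3, 2, 1] \<longleftrightarrow> tail_sorted (\<le>) (>) v"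
  "\<not> contains_pattern v [3, 1, 2] \<longleftrightarrow> tail_sorted (\<ge>) (>) v"
  "\<not> contains_pattern v [1, 3, 2] \<longleftrightarrow> tail_sorted (\<le>) (<) v"
  "\<not> contains_pattern v [2, 1, 3] \<longleftrightarrow> high_first v"
proof -
  have iso: "order_iso s [1, 2, 3] \<longleftrightarrow> (\<exists>a b c. (a < b \<and> b < c) \<and> s = [a, b, c])"
     "order_iso s [3, 2, 1] \<longleftrightarrow> (\<exists>a b c. (c < b \<and> b < a) \<and> s = [a, b, c])"
     "order_iso s [3, 1, 2] \<longleftrightarrow> (\<exists>a b c. (b < c \<and> c < a) \<and> s = [a, b, c])"
     "order_iso s [1, 3, 2] \<longleftrightarrow> (\<exists>a b c. (a < c \<and> c < b) \<and> s = [a, b, c])"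
     "order_iso s [2, 1, 3] \<longleftrightarrow> (\<exists>a b c. (b < a \<and> a < c) \<and> s = [a, b, c])" for s
    by (cases "\<exists>a b c. s = [a, b, c]"; auto simp: order_iso_def All_less_Suc length_3_iff)+
  have ex: "(\<exists>s. subseq s v \<and> (\<exists>a b c. P a b c \<and> s = [a, b, c])) \<longleftrightarrow> (\<exists>a b c. subseq [a, b, c] v \<and> P a b c)" for P
    by blast
  show "\<not> contains_pattern v [1, 2, 3] \<longleftrightarrow> tail_sorted (\<ge>) (<) v"
    unfolding contains_pattern_iff iso ex tail_sorted_iff by (meson leD le_less_trans not_le order.strict_trans)
  show "\<not> contains_pattern v [3, 2, 1] \<longleftrightarrow> tail_sorted (\<le>) (>) v"
    unfolding contains_pattern_iff iso ex tail_sorted_iff by (meson leD le_less_trans not_le order.strict_trans)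
  show "\<not> contains_pattern v [3, 1, 2] \<longleftrightarrow> tail_sorted (\<ge>) (>) v"
    unfolding contains_pattern_iff iso ex tail_sorted_iff by (meson leD le_less_trans not_le order.strict_trans)
  show "\<not> contains_pattern v [1, 3, 2] \<longleftrightarrow> tail_sorted (\<le>) (<) v"
    unfolding contains_pattern_iff iso ex tail_sorted_iff by (meson leD le_less_trans not_le order.strict_trans)
  show "\<not> contains_pattern v [2, 1, 3] \<longleftrightarrow> high_first v"
    unfolding contains_pattern_iff iso ex high_first_iff by blast
qed

lemma hereditary_avoids: "r \<noteq> [] \<Longrightarrow> hereditary (\<lambda>v. \<not> contains_pattern v r)"
  unfolding hereditary_def using contains_pattern_subseq by auto

definition fill_equiv :: "(nat multiset \<Rightarrow> bool) \<Rightarrow> nat list \<Rightarrow> nat list \<Rightarrow> bool" where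
  "fill_equiv C p q \<longleftrightarrow> (\<forall>ts V. sorted ts \<longrightarrow> C V \<longrightarrow>
     card {v. mset v = V \<and> fits (\<lambda>u. \<not> contains_pattern u p) ts v} =
     card {v. mset v = V \<and> fits (\<lambda>u. \<not> contains_pattern u q) ts v})"

lemma fill_equiv_12_21: "fill_equiv (\<lambda>_. True) [2, 1] [1, 2]"
  unfolding fill_equiv_def avoids_length_2 by (auto intro: card_fits_sorted_eq)

lemma fill_equiv_123_321_312:
  "fill_equiv (\<lambda>_. True) [3, 2, 1] [1, 2, 3]" "fill_equiv (\<lambda>_. True) [3, 2, 1] [3, 1, 2]"
  unfolding fill_equiv_def avoids_length_3 by (simp_all add: card_fits_tail_sorted_eq)

lemma fill_equiv_132_213: "fill_equiv (\<lambda>V. \<forall>z. count V z \<le> 1) [1, 3, 2] [2, 1, 3]"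
  unfolding fill_equiv_def avoids_length_3 by (auto intro: card_fits_132_213)

text \<open>
  Each multiplicity is inspected in full at the first column that is high enough, because no copy of a
  row can be used before.
\<close>
lemma fits_count_le_iff:
  assumes "fits Q ts v"
  shows "fits (\<lambda>u. \<forall>z. count (mset u) z \<le> c) ts v \<longleftrightarrow> (\<forall>z. count (mset v) z \<le> c)"
  using assms
proof (induction ts arbitrary: v)
  case (Cons t ts)
  then obtain x v' where v: "v = x # v'" by (cases v) auto
  have IH: "fits (\<lambda>u. \<forall>z. count (mset u) z \<le> c) ts v' \<longleftrightarrow> (\<forall>z. count (mset v') z \<le> c)" and xt: "x < t"
    using Cons v by auto
  have filt: "count (mset (filter (\<lambda>y. y < t) v)) z = (if z < t then count (mset v) z else 0)" for z by simp
  have "(\<forall>z. count (mset (filter (\<lambda>y. y < t) v)) z \<le> c) \<and> (\<forall>z. count (mset v') z \<le> c) \<longleftrightarrow> (\<forall>z. count (mset v) z \<le> c)"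
  proof (intro iffI allI conjI)
    fix z assume A: "(\<forall>z. count (mset (filter (\<lambda>y. y < t) v)) z \<le> c) \<and> (\<forall>z. count (mset v') z \<le> c)"
    show "count (mset v) z \<le> c"
    proof (cases "z < t")
      case True
      thus ?thesis using A filt[of z] by metis
    next
      case False
      thus ?thesis using A xt v by auto
    qed
  next
    fix z assume A: "\<forall>z. count (mset v) z \<le> c"
    show "count (mset (filter (\<lambda>y. y < t) v)) z \<le> c" using A filt[of z] by simp
    have "count (mset v') z \<le> count (mset v) z" using v by simp
    thus "count (mset v') z \<le> c" using A le_trans by blast
  qed
  thus ?case using IH xt v by simp
qed simp

lemma avoids_replicate_iff: "\<not> contains_pattern v (replicate (Suc c) a) \<longleftrightarrow> (\<forall>z. count (mset v) z \<le> c)"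
  unfolding contains_replicate_iff by (simp add: not_le less_Suc_eq_le)

text \<open>
  Avoiding \<open>X\<close> followed by \<open>c + 1\<close> equal smaller letters bounds the multiplicities of the inner letters
  by \<open>c\<close>.  This is a condition on their multiset, hence on the skeleton alone.
\<close>
lemma av_prefix_constant_eq:
  assumes eq: "fill_equiv (\<lambda>V. \<forall>z. count V z \<le> c) p q" and ne: "X \<noteq> []" "p \<noteq> []" "q \<noteq> []"
    and X: "\<forall>a\<in>set X. \<forall>b\<in>set p \<union> set q. b < a" "\<forall>a\<in>set X. d < a"
  shows "av S {X @ replicate (Suc c) d, X @ p} = av S {X @ replicate (Suc c) d, X @ q}"
proof -
  let ?C = "\<lambda>V. \<forall>z. count V z \<le> c"
  have av: "av S {X @ replicate (Suc c) d, X @ r} =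
      card {w. mset w = S \<and> scan_ok (\<lambda>v. \<not> contains_pattern v r) X [] w \<and> ?C (mset (inner X [] w))}"
    if r: "r \<noteq> []" "\<forall>a\<in>set X. \<forall>b\<in>set r. b < a" for r
  proof -
    have const: "\<not> contains_pattern w (X @ replicate (Suc c) d) \<longleftrightarrow> ?C (mset (inner X [] w))"
      if "\<not> contains_pattern w (X @ r)" for w
    proof -
      have her: "hereditary (\<lambda>u. \<not> contains_pattern u r)" "hereditary (\<lambda>u. ?C (mset u))"
        using hereditary_avoids[OF r(1)] hereditary_avoids[of "replicate (Suc c) d"] avoids_replicate_iff[of _ c d] by auto
      have "fits (\<lambda>u. \<not> contains_pattern u r) (thresholds X [] (skeleton X [] w)) (inner X [] w)"
        using that avoids_append_iff_scan_ok[OF ne(1) r] scan_ok_iff_fits[OF ne(1) her(1)] by blast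
      hence fc: "fits (\<lambda>u. ?C (mset u)) (thresholds X [] (skeleton X [] w)) (inner X [] w) \<longleftrightarrow> ?C (mset (inner X [] w))"
        by (rule fits_count_le_iff)
      have "\<not> contains_pattern w (X @ replicate (Suc c) d) \<longleftrightarrow>
          scan_ok (\<lambda>v. \<not> contains_pattern v (replicate (Suc c) d)) X [] w"
        by (rule avoids_append_iff_scan_ok[OF ne(1)]) (use X(2) in auto)
      also have "\<dots> \<longleftrightarrow> scan_ok (\<lambda>v. ?C (mset v)) X [] w" unfolding avoids_replicate_iff ..
      also have "\<dots> \<longleftrightarrow> ?C (mset (inner X [] w))" using scan_ok_iff_fits[OF ne(1) her(2)] fc by blast
      finally show ?thesis .
    qed
    have "{w \<in> permutations_of_multiset S. \<forall>r'\<in>{X @ replicate (Suc c) d, X @ r}. \<not> contains_pattern w r'}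
       = {w. mset w = S \<and> scan_ok (\<lambda>v. \<not> contains_pattern v r) X [] w \<and> ?C (mset (inner X [] w))}"
      using const avoids_append_iff_scan_ok[OF ne(1) r] by (auto simp: permutations_of_multiset_def)
    thus ?thesis by (simp add: av_def)
  qed
  have "av S {X @ replicate (Suc c) d, X @ p} =
      card {w. mset w = S \<and> scan_ok (\<lambda>v. \<not> contains_pattern v p) X [] w \<and> ?C (mset (inner X [] w))}"
    by (rule av) (use ne X in auto)
  also have "\<dots> = card {w. mset w = S \<and> scan_ok (\<lambda>v. \<not> contains_pattern v q) X [] w \<and> ?C (mset (inner X [] w))}"
    by (rule card_scan_ok_eq[where C = ?C])
       (use ne eq in \<open>auto simp: hereditary_avoids fill_equiv_def\<close>)
  also have "\<dots> = av S {X @ replicate (Suc c) d, X @ q}" by (rule av[symmetric]) (use ne X in auto)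
  finally show ?thesis .
qed

lemma contains_pattern_length: "contains_pattern w r \<Longrightarrow> length r \<le> length w"
  unfolding contains_pattern_iff by (auto simp: order_iso_def dest: list_emb_length)

text \<open>
  For the bound \<open>c = size S\<close> the additional pattern is longer than the words.
\<close>
lemma av_prefix_eq:
  assumes eq: "fill_equiv (\<lambda>_. True) p q" and ne: "X \<noteq> []" "p \<noteq> []" "q \<noteq> []"
    and X: "\<forall>a\<in>set X. \<forall>b\<in>set p \<union> set q. b < a"
  shows "av S {X @ p} = av S {X @ q}"
proof -
  \<comment> \<open>Any number below the letters of \<open>X\<close> will do.\<close>
  obtain d where d: "\<forall>a\<in>set X. d < a" using X ne(2) by (meson UnI1 last_in_set)
  let ?c = "replicate (Suc (size S)) d"
  have "av S {X @ ?c, X @ r} = av S {X @ r}" for r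
  proof -
    have "\<not> contains_pattern w (X @ ?c)" if "mset w = S" for w
    proof
      assume "contains_pattern w (X @ ?c)"
      from contains_pattern_length[OF this] show False using that by auto
    qed
    thus ?thesis unfolding av_def by (intro arg_cong[of _ _ card]) (auto simp: permutations_of_multiset_def)
  qed
  moreover have "fill_equiv (\<lambda>V. \<forall>z. count V z \<le> size S) p q" using eq by (auto simp: fill_equiv_def)
  ultimately show ?thesis using av_prefix_constant_eq[OF _ ne X d] by metis
qed

text \<open>
  Reversal turns the larger letters at the end of the pattern into a prefix.
\<close>
lemma equiv_below_suffix:
  assumes "fill_equiv (\<lambda>_. True) (rev p) (rev q)" "X \<noteq> []" "p \<noteq> []" "q \<noteq> []"
    and "\<forall>a\<in>set X. \<forall>b\<in>set p \<union> set q. b < a"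
  shows "equiv_below j (p @ X) (q @ X)"
proof -
  have "equiv_below j (rev (p @ X)) (rev (q @ X))"
    unfolding rev_append by (rule equiv_belowI, rule av_prefix_eq) (use assms in auto)
  thus ?thesis by (simp only: equiv_below_rev)
qed

lemma m_equivalent_suffix_constant:
  assumes "fill_equiv (\<lambda>V. \<forall>z. count V z \<le> c) (rev p) (rev q)" "X \<noteq> []" "p \<noteq> []" "q \<noteq> []"
    and "\<forall>a\<in>set X. \<forall>b\<in>set p \<union> set q. b < a" "\<forall>a\<in>set X. d < a"
  shows "m_equivalent {replicate (Suc c) d @ X, p @ X} {replicate (Suc c) d @ X, q @ X}"
proof -
  have "m_equivalent (rev ` {replicate (Suc c) d @ X, p @ X}) (rev ` {replicate (Suc c) d @ X, q @ X})"
    unfolding m_equivalent_def image_insert image_empty rev_append rev_replicate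
    by (intro allI impI, rule av_prefix_constant_eq) (use assms in auto)
  thus ?thesis by (simp only: m_equivalent_rev)
qed

lemma fill_equiv_weaken: "fill_equiv (\<lambda>_. True) p q \<Longrightarrow> fill_equiv C p q"
  unfolding fill_equiv_def by auto

lemma equiv_below_reverse_complement:
  assumes "equiv_below j p q" "\<forall>x\<in>set p \<union> set q. x \<le> c"
  shows "equiv_below j (rev (map (\<lambda>x. c - x) p)) (rev (map (\<lambda>x. c - x) q))"
  unfolding equiv_below_rev using assms by (intro equiv_below_complement) auto

lemma contains_pattern_cong:
  assumes "order_iso r r'"
  shows "contains_pattern w r \<longleftrightarrow> contains_pattern w r'"
proof -
  have "order_iso s r \<longleftrightarrow> order_iso s r'" for s using assms unfolding order_iso_def by auto
  thus ?thesis unfolding contains_pattern_iff by simp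
qed

lemma m_equivalent_cong:
  assumes "order_iso r r'"
  shows "m_equivalent {r, p} {r, q} \<longleftrightarrow> m_equivalent {r', p} {r', q}"
  unfolding m_equivalent_def av_def by (simp add: contains_pattern_cong[OF assms])

theorem proposition2p9:
  shows "m_equivalent {[1,2,2], [1,1,1,1]} {[2,1,2], [1,1,1,1]} \<and>
    pairwise m_equivalent
      {{[1,1,1], [1,2,2,3]},
       {[1,1,1], [1,2,3,2]},
       {[1,1,1], [1,3,2,2]},
       {[1,1,1], [2,1,2,3]},
       {[1,1,1], [2,1,3,2]},
       {[1,1,1], [2,2,1,3]}} \<and>
    m_equivalent {[1,1,1], [1,2,3,3]} {[1,1,1], [2,1,3,3]} \<and>
    pairwise m_equivalent
      {{[1,1,1], [1,2,3,4]},
       {[1,1,1], [1,2,4,3]},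
       {[1,1,1], [1,4,3,2]},
       {[1,1,1], [2,1,3,4]},
       {[1,1,1], [2,1,4,3]},
       {[1,1,1], [3,2,1,4]}} \<and>
    pairwise m_equivalent
      {{[1,2,3], [1,1,1,1]},
       {[1,3,2], [1,1,1,1]},
       {[2,1,3], [1,1,1,1]}} \<and>
    m_equivalent {[1,2,3], [1,1,1,2]} {[2,1,3], [1,1,1,2]} \<and>
    pairwise m_equivalent
      {{[1,1,2], [1,2,3,4]},
       {[1,1,2], [2,1,3,4]},
       {[1,1,2], [3,2,1,4]}} \<and>
    m_equivalent {[1,1,2], [2,3,1,4]} {[1,1,2], [3,1,2,4]}"
    (is "?a \<and> ?b \<and> ?c \<and> ?d \<and> ?e \<and> ?f \<and> ?g \<and> ?h")
proof -
  have r3: "[1, 1, 1] = replicate 3 (1 :: nat)" and r4: "[1, 1, 1, 1] = replicate 4 (1 :: nat)"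
    by (simp_all add: numeral_eq_Suc)
  have m3: "m_equivalent {[1, 1, 1], p} {[1, 1, 1], q} \<longleftrightarrow> equiv_below 3 p q" for p q
    unfolding r3 by (rule m_equivalent_constant_iff) simp
  have m4: "m_equivalent {p, [1, 1, 1, 1]} {q, [1, 1, 1, 1]} \<longleftrightarrow> equiv_below 4 p q" for p q
    unfolding r4 insert_commute[of _ "replicate 4 1"] by (rule m_equivalent_constant_iff) simp
  have suf: "equiv_below j ([1, 2] @ X) ([2, 1] @ X)" if "X \<noteq> []" "\<forall>a\<in>set X. 2 < a" for j X
    by (rule equiv_below_suffix) (use that fill_equiv_12_21 in auto)
  have refl: "equiv_below j p p" for j p by (simp add: equiv_below_def)

  \<comment> \<open>The pattern 112 stands for two equal letters followed by a larger one, here the letter 4.\<close>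
  have m112: "m_equivalent {[1, 1, 2], p @ [4]} {[1, 1, 2], q @ [4]}"
    if "fill_equiv (\<lambda>V. \<forall>z. count V z \<le> 1) (rev p) (rev q)" "p \<noteq> []" "q \<noteq> []" "\<forall>b\<in>set p \<union> set q. b < 4" for p q
  proof -
    have "m_equivalent {replicate (Suc 1) 1 @ [4], p @ [4]} {replicate (Suc 1) 1 @ [4], q @ [4]}"
      by (rule m_equivalent_suffix_constant) (use that in auto)
    moreover have "order_iso (replicate (Suc 1) 1 @ [4]) [1, 1, 2]"
      by (simp add: order_iso_def All_less_Suc)
    ultimately show ?thesis by (simp only: m_equivalent_cong)
  qed

  have ?a unfolding m4 by (rule equiv_belowI) (rule av_122_eq_av_212)
  moreover have ?b
  proof -
    note x = equiv_below_3_one_before_three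
    have base: "equiv_below 3 [1, 2, 2, 3] [2, 1, 3, 2]" "equiv_below 3 [1, 2, 2, 3] [2, 1, 2, 3]"
      "equiv_below 3 [1, 2, 2, 3] [2, 2, 1, 3]"
      using x equiv_below_sym equiv_below_trans by blast+
    have "equiv_below 3 [1, 2, 2, 3] [1, 2, 3, 2]" "equiv_below 3 [1, 2, 2, 3] [1, 3, 2, 2]"
      using equiv_below_reverse_complement[OF base(2), of 4] equiv_below_reverse_complement[OF base(3), of 4]
      by simp_all
    with base refl show ?thesis
      by (intro pairwise_of_basepoint[of _ "{[1, 1, 1], [1, 2, 2, 3]}"])
         (auto simp: m3 simp del: One_nat_def)
  qed
  moreover have ?c unfolding m3 using suf[of "[3, 3]"] by (simp del: One_nat_def)
  moreover have ?d
  proof -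
    have base: "equiv_below 3 [1, 2, 3, 4] [2, 1, 3, 4]" "equiv_below 3 [1, 2, 4, 3] [2, 1, 4, 3]"
      using suf[of "[3, 4]"] suf[of "[4, 3]"] by (simp_all del: One_nat_def)
    have "equiv_below 3 ([1, 2, 3] @ [4]) ([3, 2, 1] @ [4])"
      by (rule equiv_below_suffix) (use fill_equiv_123_321_312 in \<open>auto simp del: One_nat_def\<close>)
    hence 3214: "equiv_below 3 [1, 2, 3, 4] [3, 2, 1, 4]" by (simp del: One_nat_def)
    have rc: "equiv_below 3 [1, 2, 3, 4] [1, 2, 4, 3]" "equiv_below 3 [1, 2, 3, 4] [1, 4, 3, 2]"
      using equiv_below_reverse_complement[OF base(1), of 5] equiv_below_reverse_complement[OF 3214, of 5]
      by simp_all
    have "equiv_below 3 [1, 2, 3, 4] [2, 1, 4, 3]" using equiv_below_trans[OF rc(1) base(2)] .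
    with base 3214 rc refl show ?thesis
      by (intro pairwise_of_basepoint[of _ "{[1, 1, 1], [1, 2, 3, 4]}"])
         (auto simp: m3 simp del: One_nat_def)
  qed
  moreover have ?e
  proof -
    have base: "equiv_below 4 [1, 2, 3] [2, 1, 3]" using suf[of "[3]"] by (simp del: One_nat_def)
    have "equiv_below 4 [1, 2, 3] [1, 3, 2]"
      using equiv_below_reverse_complement[OF base, of 4] by simp
    with base refl show ?thesis
      by (intro pairwise_of_basepoint[of _ "{[1, 2, 3], [1, 1, 1, 1]}"])
         (auto simp: m4 simp del: One_nat_def)
  qed
  moreover have ?f
  proof -
    have "m_equivalent {replicate (Suc 2) 1 @ [3], [1, 2] @ [3]} {replicate (Suc 2) 1 @ [3], [2, 1] @ [3]}"
      by (rule m_equivalent_suffix_constant)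
         (use fill_equiv_weaken[OF fill_equiv_12_21] in \<open>auto simp del: One_nat_def\<close>)
    moreover have "order_iso (replicate (Suc 2) 1 @ [3]) [1, 1, 1, 2]"
      by (simp add: order_iso_def All_less_Suc numeral_2_eq_2)
    ultimately have "m_equivalent {[1, 1, 1, 2], [1, 2] @ [3]} {[1, 1, 1, 2], [2, 1] @ [3]}"
      by (simp only: m_equivalent_cong)
    thus ?thesis by (simp add: insert_commute del: One_nat_def)
  qed
  moreover have ?g
  proof -
    have "m_equivalent {[1, 1, 2], [1, 2, 3] @ [4]} {[1, 1, 2], [2, 1, 3] @ [4]}"
      "m_equivalent {[1, 1, 2], [1, 2, 3] @ [4]} {[1, 1, 2], [3, 2, 1] @ [4]}"
      by (rule m112; use fill_equiv_123_321_312[THEN fill_equiv_weaken] in \<open>simp del: One_nat_def\<close>)+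
    moreover have "m_equivalent P P" for P by (simp add: m_equivalent_def)
    ultimately show ?thesis
      by (intro pairwise_of_basepoint[of _ "{[1, 1, 2], [1, 2, 3, 4]}"]) (auto simp del: One_nat_def)
  qed
  moreover have ?h
  proof -
    have "m_equivalent {[1, 1, 2], [2, 3, 1] @ [4]} {[1, 1, 2], [3, 1, 2] @ [4]}"
      by (rule m112; use fill_equiv_132_213 in \<open>simp del: One_nat_def\<close>)
    thus ?thesis by (simp del: One_nat_def)
  qed
  ultimately show ?thesis by blast
qed

end
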